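(* Let $X_\gamma$ be a homogeneous Poisson point process of intensity $\gamma$ in $\mathbb{R}^d$ and let $W\subset\mathbb{R}^d$ be a convex body of volume $1$. Then \[\mathbb{P}\left(\forall x\in X_\gamma,\ R(C_{X_\gamma}(x))=R_{\min}(\gamma)\Longrightarrow F_{d-1}(C_{X_\gamma}(x))=d+1\right)\underset{\gamma\to\infty}{\longrightarrow}1.\]
   Context: A convex body is a convex compact set with non-empty interior. $B(x,r)$ is the ball of radius $r$ centered at $x$. For a locally finite set $\chi\subset\mathbb{R}^d$ and $x\in\chi$, the Voronoi cell of nucleus $x$ is $C_\chi(x)=\{y\in\mathbb{R}^d: |y-x|\leq|y-x'| \text{ for all } x'\in\chi,\ x'\neq x\}$; its circumscribed radius is $R(C_\chi(x))=\min\{R\geq 0: B(x,R)\supset C_\chi(x)\}$, and $F_{d-1}(C_\chi(x))$ denotes its number of hyperfaces (i.e. $(d-1)$-dimensional faces). Define $R_{\min}(\gamma)=\min_{x\in X_\gamma\cap W}R(C_{X_\gamma}(x))$. *)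

theory Defs
  imports "HOL-Probability.Probability"
begin

definition convex_body :: "'a::euclidean_space set \<Rightarrow> bool" where
  "convex_body W \<longleftrightarrow> convex W \<and> compact W \<and> interior W \<noteq> {}"

definition locally_finite_set :: "'a::metric_space set \<Rightarrow> bool" where
  "locally_finite_set \<eta> \<longleftrightarrow> (\<forall>B. bounded B \<longrightarrow> finite (\<eta> \<inter> B))"

definition voronoi_cell :: "'a::euclidean_space set \<Rightarrow> 'a \<Rightarrow> 'a set" where
  "voronoi_cell \<eta> x = {y. \<forall>x'\<in>\<eta>. x' \<noteq> x \<longrightarrow> dist y x \<le> dist y x'}"

(* Radii are extended reals, so an unbounded cell has circumscribed radius \<infinity>.
   For bounded cells the infimum is attained, see circumscribed_radius_attained below. *)
definition circumscribed_radius :: "'a::euclidean_space set \<Rightarrow> 'a \<Rightarrow> ennreal" where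
  "circumscribed_radius \<eta> x = (INF R\<in>{R. 0 \<le> R \<and> voronoi_cell \<eta> x \<subseteq> cball x R}. ennreal R)"

definition num_hyperfaces :: "'a::euclidean_space set \<Rightarrow> nat" where
  "num_hyperfaces C = card {F. F face_of C \<and> aff_dim F = int DIM('a) - 1}"

(* For a bounded window W and locally finite \<eta>, the infimum is over a finite set, hence a minimum
   unless \<eta> \<inter> W = {}, where it takes the value \<infinity>. *)
definition min_circumscribed_radius :: "'a::euclidean_space set \<Rightarrow> 'a set \<Rightarrow> ennreal" where
  "min_circumscribed_radius W \<eta> = (INF x\<in>\<eta> \<inter> W. circumscribed_radius \<eta> x)"

(* A point process is a random locally finite set, observed through its counts in bounded Borel sets.
   The Poisson probabilities are written out because poisson_pmf is only specified for positive rates,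
   whereas null sets B have rate 0 (and 0 ^ 0 = 1 then gives an almost surely empty intersection). *)
definition homogeneous_poisson_process ::
    "'w measure \<Rightarrow> real \<Rightarrow> ('w \<Rightarrow> 'a::euclidean_space set) \<Rightarrow> bool" where
  "homogeneous_poisson_process M \<gamma> X \<longleftrightarrow>
     prob_space M \<and>
     (\<forall>\<omega>\<in>space M. locally_finite_set (X \<omega>)) \<and>
     (\<forall>B\<in>sets borel. bounded B \<longrightarrow>
        (\<lambda>\<omega>. card (X \<omega> \<inter> B)) \<in> M \<rightarrow>\<^sub>M count_space UNIV \<and>
        (\<forall>n. measure M {\<omega> \<in> space M. card (X \<omega> \<inter> B) = n} =
             exp (- (\<gamma> * measure lborel B)) * (\<gamma> * measure lborel B) ^ n / fact n)) \<and>
     (\<forall>(n::nat) B. (\<forall>i<n. B i \<in> sets borel \<and> bounded (B i)) \<and> disjoint_family_on B {..<n} \<longrightarrow>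
        prob_space.indep_vars M (\<lambda>_. count_space UNIV) (\<lambda>i \<omega>. card (X \<omega> \<inter> B i)) {..<n})"

lemma closed_voronoi_cell: "closed (voronoi_cell \<eta> x)"
proof -
  have "voronoi_cell \<eta> x = (\<Inter>x'\<in>\<eta> - {x}. {y. dist y x \<le> dist y x'})"
    by (auto simp: voronoi_cell_def)
  then show ?thesis
    by (auto intro!: closed_INT closed_Collect_le continuous_intros)
qed

lemma nucleus_in_voronoi_cell: "x \<in> voronoi_cell \<eta> x"
  by (simp add: voronoi_cell_def)

lemma circumscribed_radius_attained:
  assumes "bounded (voronoi_cell \<eta> x)"
  obtains R where "0 \<le> R" "voronoi_cell \<eta> x \<subseteq> cball x R"
    "\<And>r. 0 \<le> r \<Longrightarrow> voronoi_cell \<eta> x \<subseteq> cball x r \<Longrightarrow> R \<le> r"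
    "circumscribed_radius \<eta> x = ennreal R"
proof -
  have "compact (voronoi_cell \<eta> x)"
    using assms closed_voronoi_cell by (simp add: compact_eq_bounded_closed)
  moreover have "voronoi_cell \<eta> x \<noteq> {}"
    using nucleus_in_voronoi_cell by blast
  ultimately obtain y where y: "y \<in> voronoi_cell \<eta> x"
      "\<And>z. z \<in> voronoi_cell \<eta> x \<Longrightarrow> dist x z \<le> dist x y"
    using distance_attains_sup by metis
  have least: "dist x y \<le> r" if "voronoi_cell \<eta> x \<subseteq> cball x r" for r
    using that y(1) by auto
  have sub: "voronoi_cell \<eta> x \<subseteq> cball x (dist x y)"
    using y(2) by auto
  have "circumscribed_radius \<eta> x = ennreal (dist x y)"
    unfolding circumscribed_radius_def
    by (rule antisym) (auto intro!: INF_lower INF_greatest ennreal_leI sub least)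
  with least sub show thesis
    by (intro that[of "dist x y"]) auto
qed

lemma circumscribed_radius_unbounded:
  "\<not> bounded (voronoi_cell \<eta> x) \<Longrightarrow> circumscribed_radius \<eta> x = \<infinity>"
  using bounded_subset[OF bounded_cball]
  by (auto simp: circumscribed_radius_def intro!: antisym INF_greatest)

lemma min_circumscribed_radius_attained:
  assumes "locally_finite_set \<eta>" "bounded W" "\<eta> \<inter> W \<noteq> {}"
  obtains x where "x \<in> \<eta> \<inter> W" "circumscribed_radius \<eta> x = min_circumscribed_radius W \<eta>"
proof -
  have "finite (\<eta> \<inter> W)"
    using assms by (simp add: locally_finite_set_def)
  then have "Min (circumscribed_radius \<eta> ` (\<eta> \<inter> W)) \<in> circumscribed_radius \<eta> ` (\<eta> \<inter> W)"
    using assms(3) by (intro Min_in) auto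
  moreover have "Min (circumscribed_radius \<eta> ` (\<eta> \<inter> W)) = min_circumscribed_radius W \<eta>"
    using \<open>finite (\<eta> \<inter> W)\<close> assms(3) unfolding min_circumscribed_radius_def
    by (intro Min_Inf) auto
  ultimately show thesis
    using that by auto
qed

end

theory Submission
  imports Defs
begin

text \<open>
  Let \<open>d\<close> be the dimension and \<open>\<gamma>\<close> the intensity. The hyperfaces of a Voronoi cell correspond to the
  neighbours of its nucleus (\<open>num_hyperfaces_voronoi_cell\<close>). A bounded cell has at least \<open>d + 1\<close> of them
  (\<open>card_voronoi_neighbours_ge\<close>), and if its circumscribed radius is at most \<open>r\<close>, all neighbours lie within
  distance \<open>2 * r\<close> of the nucleus (\<open>dist_voronoi_neighbour_le\<close>). So a small cell with more than \<open>d + 1\<close>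
  hyperfaces forces a cluster of \<open>d + 3\<close> points, whereas \<open>d + 2\<close> points in simplex position already produce a
  small cell. The first event is much rarer than the second, and a length \<open>s\<close> can be chosen between the
  two scales such that \<open>\<gamma> * (\<gamma> * s ^ d) ^ (d + 1)\<close> tends to infinity while \<open>\<gamma> * (\<gamma> * s ^ d) ^ (d + 2)\<close> tends
  to zero.

  Up to a constant, the first of these quantities is the expected number of simplex configurations of size
  \<open>s\<close> in the window. They can be sought in
  separate blocks of small balls, which are independent, so that with high probability the minimal radius is
  at most a constant times \<open>s\<close> (\<open>prob_no_simplex_cell_le\<close>). The second quantity bounds, up to a constant, the
  probability of a cluster of \<open>d + 3\<close> points at scale \<open>s\<close> in a bounded region (\<open>prob_cluster_le\<close>).

  The nuclei whose radius is compared with the minimum range over the whole space, where clusters do occur.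
  They are excluded by absolute continuity: almost surely, two nuclei with the same finite circumscribed
  radius \<open>R\<close> are within distance \<open>4 * R\<close> (\<open>AE_distant_cells_distinct_radii\<close>), so only nuclei close to
  the window matter. Finally, the event has to be measurable (\<open>pred_minimal_cells_simplices\<close>); since
  only the counts in bounded Borel sets are known to be measurable, the points of the process are
  recovered one by one from countably many sets that isolate them.
\<close>

section \<open>Hyperfaces and neighbours of a Voronoi cell\<close>

lemma locally_finite_set_subset:
  "locally_finite_set \<eta> \<Longrightarrow> \<zeta> \<subseteq> \<eta> \<Longrightarrow> locally_finite_set \<zeta>"
  unfolding locally_finite_set_def by (meson Int_mono finite_subset order_refl)

lemma dist_le_iff_halfspace:
  fixes x x' y :: "'a::real_inner"
  shows "dist y x \<le> dist y x' \<longleftrightarrow> (x' - x) \<bullet> y \<le> (x' - x) \<bullet> midpoint x x'"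
  by (simp add: dist_norm norm_le midpoint_def inner_simps inner_commute) argo

lemma dist_less_iff_halfspace:
  fixes x x' y :: "'a::real_inner"
  shows "dist y x < dist y x' \<longleftrightarrow> (x' - x) \<bullet> y < (x' - x) \<bullet> midpoint x x'"
  by (simp add: dist_norm norm_lt midpoint_def inner_simps inner_commute) argo

lemma dist_eq_iff_hyperplane:
  fixes x x' y :: "'a::real_inner"
  shows "dist y x = dist y x' \<longleftrightarrow> (x' - x) \<bullet> y = (x' - x) \<bullet> midpoint x x'"
  using dist_le_iff_halfspace[of y x x'] dist_less_iff_halfspace[of y x x'] by linarith

text \<open>
  The hyperplane of points equidistant from two distinct points (the whole space if they coincide).
\<close>

definition bisector :: "'a::euclidean_space \<Rightarrow> 'a \<Rightarrow> 'a set" where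
  "bisector x x' = {y. dist y x = dist y x'}"

lemma bisector_eq_hyperplane:
  "bisector x x' = {y. (x' - x) \<bullet> y = (x' - x) \<bullet> midpoint x x'}"
  by (simp add: bisector_def dist_eq_iff_hyperplane)

lemma bisector_inj:
  assumes "bisector x x' = bisector x x''" "x' \<noteq> x" "x'' \<noteq> x"
  shows "x' = x''"
proof -
  define a where "a = x' - x"
  define b where "b = x'' - x"
  have ab: "a \<noteq> 0" "b \<noteq> 0" "x' = x + a" "x'' = x + b"
    using assms by (auto simp: a_def b_def)
  have iff: "2 * (a \<bullet> w) = a \<bullet> a \<longleftrightarrow> 2 * (b \<bullet> w) = b \<bullet> b" for w
  proof -
    have "x + w \<in> bisector x x' \<longleftrightarrow> x + w \<in> bisector x x''"
      using assms by simp
    then show ?thesis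
      unfolding bisector_eq_hyperplane ab by (simp add: midpoint_def inner_simps inner_commute field_simps)
  qed
  \<comment> \<open>the component of \<open>b\<close> orthogonal to \<open>a\<close>; it vanishes, so \<open>b\<close> is a multiple of \<open>a\<close>, with factor 1\<close>
  define w where "w = b - ((b \<bullet> a) / (a \<bullet> a)) *\<^sub>R a"
  have aw: "a \<bullet> w = 0"
    using ab by (simp add: w_def inner_simps inner_commute)
  have 1: "b \<bullet> a = b \<bullet> b"
    using iff[of "a /\<^sub>R 2"] by simp
  have 2: "2 * (b \<bullet> (a /\<^sub>R 2 + w)) = b \<bullet> b"
    using iff[of "a /\<^sub>R 2 + w"] aw by (simp add: inner_simps)
  then have bw: "b \<bullet> w = 0"
    using 1 by (simp add: inner_simps)
  have "w \<bullet> w = 0"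
    using aw bw by (subst w_def) (simp add: inner_simps)
  then have b: "b = ((b \<bullet> a) / (a \<bullet> a)) *\<^sub>R a"
    by (simp add: w_def)
  then obtain c where c: "b = c *\<^sub>R a" by blast
  with 1 ab have "c = 1" by (auto simp: c)
  then show ?thesis using c ab by simp
qed

lemma aff_dim_bisector: "x' \<noteq> x \<Longrightarrow> aff_dim (bisector x x') = int DIM('a) - 1"
  for x x' :: "'a::euclidean_space"
  by (simp add: bisector_eq_hyperplane aff_dim_hyperplane)

lemma convex_voronoi_cell: "convex (voronoi_cell \<eta> x)"
proof -
  have "voronoi_cell \<eta> x = (\<Inter>x'\<in>\<eta> - {x}. {y. (x' - x) \<bullet> y \<le> (x' - x) \<bullet> midpoint x x'})"
    by (auto simp: voronoi_cell_def dist_le_iff_halfspace)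
  then show ?thesis
    by (simp add: convex_INT convex_halfspace_le)
qed

lemma convex_strictly_nearest:
  fixes x :: "'a::euclidean_space"
  shows "convex {y. \<forall>x'\<in>\<zeta>. dist y x < dist y x'}"
proof -
  have "{y. \<forall>x'\<in>\<zeta>. dist y x < dist y x'} = (\<Inter>x'\<in>\<zeta>. {y. (x' - x) \<bullet> y < (x' - x) \<bullet> midpoint x x'})"
    by (auto simp: dist_less_iff_halfspace)
  then show ?thesis
    by (simp add: convex_INT convex_halfspace_lt)
qed

text \<open>
  Near a given point only finitely many nuclei matter, which turns the infinite intersection of
  half-spaces into a locally finite one.
\<close>

lemma open_strictly_nearest:
  fixes x :: "'a::euclidean_space"
  assumes "locally_finite_set \<zeta>"
  shows "open {y. \<forall>x'\<in>\<zeta>. dist y x < dist y x'}"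
proof (subst open_subopen, safe)
  fix y assume y: "\<forall>x'\<in>\<zeta>. dist y x < dist y x'"
  define F where "F = \<zeta> \<inter> cball y (dist y x + 1)"
  have fin: "finite F"
    using assms by (auto simp: F_def locally_finite_set_def)
  define T where "T = ball y (1/2) \<inter> (\<Inter>x'\<in>F. {z. dist z x < dist z x'})"
  have "open T"
    unfolding T_def using fin
    by (intro open_Int open_ball open_INT ballI open_Collect_less continuous_intros)
  moreover have "y \<in> T"
    using y by (auto simp: T_def F_def)
  moreover have "dist z x < dist z x'" if z: "z \<in> T" and x': "x' \<in> \<zeta>" for z x'
  proof (cases "x' \<in> F")
    case True
    with z show ?thesis by (auto simp: T_def)
  next
    case False
    then have "dist y x + 1 < dist y x'"
      using x' by (auto simp: F_def)
    moreover have "dist y z < 1/2"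
      using z by (auto simp: T_def)
    moreover have "dist z x \<le> dist y z + dist y x" "dist y x' \<le> dist y z + dist z x'"
      by (metis dist_commute dist_triangle) (rule dist_triangle)
    ultimately show ?thesis by linarith
  qed
  ultimately show "\<exists>T. open T \<and> y \<in> T \<and> T \<subseteq> {y. \<forall>x'\<in>\<zeta>. dist y x < dist y x'}"
    by (intro exI[of _ T]) auto
qed

lemma strictly_nearest_in_interior_voronoi_cell:
  assumes "locally_finite_set \<eta>" "\<And>x'. x' \<in> \<eta> - {x} \<Longrightarrow> dist y x < dist y x'"
  shows "y \<in> interior (voronoi_cell \<eta> x)"
proof (rule interiorI)
  show "open {y. \<forall>x'\<in>\<eta> - {x}. dist y x < dist y x'}"
    using assms(1) by (intro open_strictly_nearest) (rule locally_finite_set_subset, auto)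
qed (use assms in \<open>auto simp: voronoi_cell_def intro: less_imp_le\<close>)

lemma nucleus_in_interior_voronoi_cell:
  "locally_finite_set \<eta> \<Longrightarrow> x \<in> interior (voronoi_cell \<eta> x)"
  by (rule strictly_nearest_in_interior_voronoi_cell) auto

text \<open>
  For locally finite \<open>\<eta>\<close>, the points that share a hyperface with the cell of \<open>x\<close>: some point has \<open>x\<close> and the
  neighbour as its two equally near nuclei and is strictly further away from all other nuclei. Such a
  witness lies in the relative interior of the common hyperface.
\<close>

definition voronoi_neighbours :: "'a::euclidean_space set \<Rightarrow> 'a \<Rightarrow> 'a set" where
  "voronoi_neighbours \<eta> x = {x'\<in>\<eta> - {x}. \<exists>y. dist y x = dist y x' \<and>
     (\<forall>x''\<in>\<eta> - {x, x'}. dist y x < dist y x'')}"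

lemma voronoi_neighboursE:
  assumes "x' \<in> voronoi_neighbours \<eta> x"
  obtains y where "x' \<in> \<eta>" "x' \<noteq> x" "y \<in> voronoi_cell \<eta> x" "dist y x = dist y x'"
    "\<And>x''. x'' \<in> \<eta> - {x, x'} \<Longrightarrow> dist y x < dist y x''"
proof -
  obtain y where y: "dist y x = dist y x'" "\<forall>x''\<in>\<eta> - {x, x'}. dist y x < dist y x''"
    using assms by (auto simp: voronoi_neighbours_def)
  have "dist y x \<le> dist y z" if "z \<in> \<eta>" "z \<noteq> x" for z
    using y that by (cases "z = x'") (auto intro: less_imp_le)
  then show thesis
    using that[of y] y assms by (auto simp: voronoi_neighbours_def voronoi_cell_def)
qed

lemma facet_of_voronoi_neighbour:
  fixes x :: "'a::euclidean_space"
  assumes fin: "locally_finite_set \<eta>" and x': "x' \<in> voronoi_neighbours \<eta> x"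
  shows "voronoi_cell \<eta> x \<inter> bisector x x' face_of voronoi_cell \<eta> x"
    and "aff_dim (voronoi_cell \<eta> x \<inter> bisector x x') = int DIM('a) - 1"
proof -
  let ?C = "voronoi_cell \<eta> x"
  have ne: "x' \<noteq> x" "x' \<in> \<eta>" using x' by (auto simp: voronoi_neighbours_def)
  show "?C \<inter> bisector x x' face_of ?C"
    unfolding bisector_eq_hyperplane
    by (rule face_of_Int_supporting_hyperplane_le)
       (use ne in \<open>simp_all add: convex_voronoi_cell, auto simp: voronoi_cell_def dist_le_iff_halfspace\<close>)
  obtain y where y: "dist y x = dist y x'" "\<forall>x''\<in>\<eta> - {x, x'}. dist y x < dist y x''"
    using x' by (auto simp: voronoi_neighbours_def)
  define U where "U = {y. \<forall>x''\<in>\<eta> - {x, x'}. dist y x < dist y x''}"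
  have "open U"
    unfolding U_def using fin by (intro open_strictly_nearest) (rule locally_finite_set_subset, auto)
  moreover have "y \<in> bisector x x' \<inter> U"
    using y by (auto simp: U_def bisector_def)
  moreover have "convex (bisector x x')"
    by (simp add: bisector_eq_hyperplane convex_hyperplane)
  ultimately have "aff_dim (bisector x x' \<inter> U) = int DIM('a) - 1"
    using aff_dim_convex_Int_open[of "bisector x x'" U] aff_dim_bisector[OF ne(1)] by auto
  moreover have "bisector x x' \<inter> U \<subseteq> ?C \<inter> bisector x x'"
  proof -
    have "dist y x \<le> dist y z" if "y \<in> bisector x x' \<inter> U" "z \<in> \<eta>" "z \<noteq> x" for y z
      using that by (cases "z = x'") (auto simp: U_def bisector_def intro: less_imp_le)
    then show ?thesis by (auto simp: voronoi_cell_def)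
  qed
  moreover have "aff_dim (?C \<inter> bisector x x') \<le> int DIM('a) - 1"
    using aff_dim_subset[of "?C \<inter> bisector x x'" "bisector x x'"] aff_dim_bisector[OF ne(1)] by simp
  ultimately show "aff_dim (?C \<inter> bisector x x') = int DIM('a) - 1"
    using aff_dim_subset[of "bisector x x' \<inter> U" "?C \<inter> bisector x x'"] by linarith
qed

text \<open>
  A relative interior point of a hyperface cannot be an interior point of the cell, so it lies on some
  bisector; a face meeting the relative interior of a hyperface contains it, hence that bisector cuts the
  cell exactly in the hyperface. No second bisector passes through the point, because
  the affine hull of the hyperface determines the bisector and thereby the reflected nucleus.
\<close>

lemma facet_on_bisector_of_neighbour:
  fixes x :: "'a::euclidean_space"
  assumes fin: "locally_finite_set \<eta>"
    and F: "F face_of voronoi_cell \<eta> x" "aff_dim F = int DIM('a) - 1"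
  shows "\<exists>x'\<in>voronoi_neighbours \<eta> x. F = voronoi_cell \<eta> x \<inter> bisector x x'"
proof -
  let ?C = "voronoi_cell \<eta> x"
  have "aff_dim F \<noteq> -1"
    using F(2) DIM_positive[where 'a='a] by linarith
  then have "F \<noteq> {}" by auto
  moreover have "convex F"
    using F(1) face_of_imp_convex by blast
  ultimately obtain p where p: "p \<in> rel_interior F"
    using rel_interior_eq_empty by blast
  have pF: "p \<in> F" using p rel_interior_subset by blast
  have FC: "F \<subseteq> ?C" using F(1) by (rule face_of_imp_subset)
  have "aff_dim ?C = int DIM('a)"
    using nucleus_in_interior_voronoi_cell[OF fin] by (metis aff_dim_nonempty_interior empty_iff)
  then have "F \<noteq> ?C" using F(2) by auto
  then have "p \<notin> interior ?C"
    using face_of_disjoint_interior[OF F(1)] pF by blast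
  then obtain x' where x': "x' \<in> \<eta> - {x}" "\<not> dist p x < dist p x'"
    using strictly_nearest_in_interior_voronoi_cell[OF fin] by blast
  have eqF: "F = ?C \<inter> bisector x z \<and> affine hull F = bisector x z"
    if z: "z \<in> \<eta> - {x}" "\<not> dist p x < dist p z" for z
  proof
    let ?G = "?C \<inter> bisector x z"
    have G: "?G face_of ?C"
      unfolding bisector_eq_hyperplane
      by (rule face_of_Int_supporting_hyperplane_le)
         (use z in \<open>simp_all add: convex_voronoi_cell, auto simp: voronoi_cell_def dist_le_iff_halfspace\<close>)
    have "p \<in> ?G"
      using z pF FC by (force simp: bisector_def voronoi_cell_def)
    then have sub: "F \<subseteq> ?G"
      using subset_of_face_of[OF G FC] p by blast
    have "F face_of ?G"
      using F(1) sub by (rule face_of_subset) auto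
    moreover have dim: "aff_dim ?G \<le> int DIM('a) - 1"
      using aff_dim_subset[of ?G "bisector x z"] aff_dim_bisector[of z x] z by simp
    ultimately show "F = ?G"
      using face_of_aff_dim_lt[of ?G F] face_of_imp_convex[OF G] F(2) by fastforce
    have aff: "affine (bisector x z)"
      by (simp add: bisector_eq_hyperplane affine_hyperplane)
    show "affine hull F = bisector x z"
      by (rule affine_dim_equal)
         (use aff sub \<open>F \<noteq> {}\<close> F(2) aff_dim_bisector[of z x] z hull_minimal[of F "bisector x z" affine] in auto)
  qed
  have "dist p x < dist p z" if "z \<in> \<eta> - {x, x'}" for z
  proof (rule ccontr)
    assume "\<not> dist p x < dist p z"
    then have "bisector x x' = bisector x z"
      using eqF[of z] eqF[OF x'] that by auto
    then show False
      using bisector_inj[of x x' z] x' that by auto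
  qed
  moreover have "dist p x = dist p x'"
    using x' pF FC by (force simp: voronoi_cell_def)
  ultimately have "x' \<in> voronoi_neighbours \<eta> x"
    using x' unfolding voronoi_neighbours_def by blast
  with eqF[OF x'] show ?thesis by blast
qed

lemma num_hyperfaces_voronoi_cell:
  fixes x :: "'a::euclidean_space"
  assumes fin: "locally_finite_set \<eta>"
  shows "num_hyperfaces (voronoi_cell \<eta> x) = card (voronoi_neighbours \<eta> x)"
proof -
  let ?f = "\<lambda>x'. voronoi_cell \<eta> x \<inter> bisector x x'"
  have "bij_betw ?f (voronoi_neighbours \<eta> x)
    {F. F face_of voronoi_cell \<eta> x \<and> aff_dim F = int DIM('a) - 1}"
    unfolding bij_betw_def
  proof
    show "inj_on ?f (voronoi_neighbours \<eta> x)"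
    proof (rule inj_onI, rule ccontr)
      fix x' x'' assume *: "x' \<in> voronoi_neighbours \<eta> x" "x'' \<in> voronoi_neighbours \<eta> x"
        "?f x' = ?f x''" "x' \<noteq> x''"
      obtain y where y: "y \<in> voronoi_cell \<eta> x" "dist y x = dist y x'"
          "\<And>z. z \<in> \<eta> - {x, x'} \<Longrightarrow> dist y x < dist y z"
        using voronoi_neighboursE[OF *(1)] by blast
      then have "y \<in> ?f x'"
        by (simp add: bisector_def)
      moreover have "dist y x < dist y x''"
        using y(3)[of x''] * by (auto simp: voronoi_neighbours_def)
      then have "y \<notin> ?f x''"
        by (simp add: bisector_def)
      ultimately show False using * by simp
    qed
    show "?f ` voronoi_neighbours \<eta> x = {F. F face_of voronoi_cell \<eta> x \<and> aff_dim F = int DIM('a) - 1}"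
      using facet_of_voronoi_neighbour[OF fin] facet_on_bisector_of_neighbour[OF fin] by fastforce
  qed
  then show ?thesis
    unfolding num_hyperfaces_def using bij_betw_same_card by metis
qed

lemma dist_voronoi_neighbour_le:
  assumes "voronoi_cell \<eta> x \<subseteq> cball x r" "x' \<in> voronoi_neighbours \<eta> x"
  shows "dist x x' \<le> 2 * r"
proof -
  obtain y where y: "dist y x = dist y x'" "y \<in> voronoi_cell \<eta> x"
    using voronoi_neighboursE[OF assms(2)] by blast
  then have "dist y x \<le> r"
    using assms(1) by (auto simp: dist_commute)
  then show ?thesis
    using y(1) dist_triangle2[of x x' y] by (simp add: dist_commute)
qed

lemma finite_voronoi_neighbours:
  assumes "locally_finite_set \<eta>" "bounded (voronoi_cell \<eta> x)"
  shows "finite (voronoi_neighbours \<eta> x)"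
proof -
  obtain r where "voronoi_cell \<eta> x \<subseteq> cball x r"
    using assms(2) by (metis bounded_subset_ballD ball_subset_cball order_trans)
  then have "voronoi_neighbours \<eta> x \<subseteq> \<eta> \<inter> cball x (2 * r)"
    using dist_voronoi_neighbour_le by (fastforce simp: voronoi_neighbours_def)
  moreover have "finite (\<eta> \<inter> cball x (2 * r))"
    using assms(1) by (simp add: locally_finite_set_def)
  ultimately show ?thesis
    by (rule finite_subset)
qed

text \<open>
  If the cell lies within distance \<open>r\<close> of its nucleus, then so does the cell formed with the nuclei at
  distance at most \<open>2 * r + 2\<close> only: by convexity, a point of the latter beyond distance \<open>r + 1\<close> would
  produce one at distance exactly \<open>r + 1\<close>.
\<close>

lemma polyhedron_bounded_voronoi_cell:
  fixes x :: "'a::euclidean_space"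
  assumes fin: "locally_finite_set \<eta>" and bdd: "bounded (voronoi_cell \<eta> x)"
  shows "polyhedron (voronoi_cell \<eta> x)"
proof -
  obtain r where r: "voronoi_cell \<eta> x \<subseteq> cball x r" "r > 0"
    using bdd by (metis bounded_subset_ballD ball_subset_cball order_trans)
  define \<zeta> where "\<zeta> = \<eta> \<inter> cball x (2 * r + 2)"
  have near: "y \<in> voronoi_cell \<eta> x" if y: "y \<in> voronoi_cell \<zeta> x" "dist x y \<le> r + 1" for y
    unfolding voronoi_cell_def
  proof safe
    fix x' assume x': "x' \<in> \<eta>" "x' \<noteq> x"
    show "dist y x \<le> dist y x'"
    proof (cases "dist x x' \<le> 2 * r + 2")
      case True
      then show ?thesis using y x' by (auto simp: voronoi_cell_def \<zeta>_def)
    next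
      case False
      then show ?thesis using y dist_triangle[of x x' y] by (simp add: dist_commute)
    qed
  qed
  have "voronoi_cell \<zeta> x \<subseteq> voronoi_cell \<eta> x"
  proof
    fix y assume y: "y \<in> voronoi_cell \<zeta> x"
    show "y \<in> voronoi_cell \<eta> x"
    proof (cases "dist x y \<le> r + 1")
      case False
      define t where "t = (r + 1) / dist x y"
      have t: "0 \<le> t" "t \<le> 1" "t * dist x y = r + 1"
        using False r by (auto simp: t_def divide_simps)
      define z where "z = (1 - t) *\<^sub>R x + t *\<^sub>R y"
      have "z \<in> voronoi_cell \<zeta> x"
        unfolding z_def using convexD_alt[OF convex_voronoi_cell nucleus_in_voronoi_cell y t(1,2)] .
      moreover have "dist x z = r + 1"
      proof -
        have "x - z = t *\<^sub>R (x - y)" by (simp add: z_def algebra_simps)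
        then show ?thesis using t by (simp add: dist_norm)
      qed
      ultimately have "z \<in> cball x r"
        using near[of z] r by auto
      then show ?thesis using \<open>dist x z = r + 1\<close> by simp
    qed (use near y in auto)
  qed
  moreover have "voronoi_cell \<eta> x \<subseteq> voronoi_cell \<zeta> x"
    by (auto simp: voronoi_cell_def \<zeta>_def)
  ultimately have eq: "voronoi_cell \<eta> x = voronoi_cell \<zeta> x" by auto
  have "finite (\<zeta> - {x})"
    using fin by (auto simp: \<zeta>_def locally_finite_set_def)
  then show ?thesis
    unfolding eq polyhedron_def
    by (intro exI[of _ "(\<lambda>x'. {y. (x' - x) \<bullet> y \<le> (x' - x) \<bullet> midpoint x x'}) ` (\<zeta> - {x})"])
       (auto simp: voronoi_cell_def dist_le_iff_halfspace, metis right_minus_eq)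
qed

text \<open>
  At most \<open>d\<close> vectors in dimension \<open>d\<close> lie in a common closed half-space: either a nonzero vector is orthogonal
  to all of them, or they form a basis and a linear functional takes the value \<open>- 1\<close> on each.
\<close>

lemma exists_nonpositive_direction:
  fixes A :: "'a::euclidean_space set"
  assumes "finite A" "card A \<le> DIM('a)"
  shows "\<exists>u. u \<noteq> 0 \<and> (\<forall>a\<in>A. a \<bullet> u \<le> 0)"
proof (cases "span A = UNIV")
  case False
  then obtain u where "u \<noteq> 0" "\<forall>a\<in>span A. u \<bullet> a = 0"
    using span_not_univ_subset_hyperplane[of A] span_superset[of A] by blast
  then show ?thesis
    using span_superset[of A] by (intro exI[of _ u]) (auto simp: inner_commute subset_iff)
next
  case True
  then have "independent A"
    using card_le_dim_spanning[of A UNIV] assms by simp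
  then obtain g :: "'a \<Rightarrow> real" where g: "linear g" "\<forall>a\<in>A. g a = - 1"
    using linear_independent_extend[of A "\<lambda>_. - 1"] by blast
  have "g a = a \<bullet> adjoint g 1" for a
    using adjoint_works[OF g(1), of a 1] by simp
  moreover have "adjoint g 1 \<noteq> 0"
  proof
    assume "adjoint g 1 = 0"
    then have "A = {}"
      using g calculation by auto
    then have "(UNIV :: 'a set) = {0}"
      using True by simp
    then show False
      using UNIV_not_singleton by blast
  qed
  ultimately show ?thesis
    using g by (intro exI[of _ "adjoint g 1"]) auto
qed

text \<open>
  A bounded cell has at least \<open>d + 1\<close> hyperfaces: otherwise a ray from the nucleus in a direction \<open>u\<close>
  which makes a non-acute angle with every neighbour direction would leave the cell through a hyperface,
  that is, move towards a neighbour.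
\<close>

lemma card_voronoi_neighbours_ge:
  fixes x :: "'a::euclidean_space"
  assumes fin: "locally_finite_set \<eta>" and bdd: "bounded (voronoi_cell \<eta> x)"
  shows "card (voronoi_neighbours \<eta> x) \<ge> DIM('a) + 1"
proof (rule ccontr)
  let ?C = "voronoi_cell \<eta> x"
  assume "\<not> ?thesis"
  then have card: "card (voronoi_neighbours \<eta> x) \<le> DIM('a)" by simp
  have finN: "finite (voronoi_neighbours \<eta> x)"
    by (rule finite_voronoi_neighbours[OF fin bdd])
  have "card ((\<lambda>x'. x' - x) ` voronoi_neighbours \<eta> x) \<le> DIM('a)"
    using card card_image_le[OF finN, of "\<lambda>x'. x' - x"] by linarith
  then obtain u where u: "u \<noteq> 0" "\<And>x'. x' \<in> voronoi_neighbours \<eta> x \<Longrightarrow> (x' - x) \<bullet> u \<le> 0"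
    using exists_nonpositive_direction[OF finite_imageI[OF finN], of "\<lambda>x'. x' - x"] by auto
  obtain d where d: "0 < d" "x + d *\<^sub>R u \<in> frontier ?C"
    using ray_to_frontier[OF bdd nucleus_in_interior_voronoi_cell[OF fin] u(1)] by blast
  define y where "y = x + d *\<^sub>R u"
  have "interior ?C \<noteq> {}"
    using nucleus_in_interior_voronoi_cell[OF fin] by blast
  then have "y \<in> rel_frontier ?C"
    using d by (simp add: rel_frontier_def frontier_def rel_interior_nonempty_interior y_def)
  then have "y \<in> ?C - rel_interior ?C"
    by (simp add: rel_frontier_def closed_voronoi_cell)
  then obtain F where F: "F facet_of ?C" "y \<in> F"
    using rel_boundary_of_polyhedron[OF polyhedron_bounded_voronoi_cell[OF fin bdd]] by auto
  have "aff_dim ?C = int DIM('a)"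
    using \<open>interior ?C \<noteq> {}\<close> by (rule aff_dim_nonempty_interior)
  then obtain x' where x': "x' \<in> voronoi_neighbours \<eta> x" "F = ?C \<inter> bisector x x'"
    using facet_on_bisector_of_neighbour[OF fin, of F] F(1) by (auto simp: facet_of_def)
  then have "2 * ((x' - x) \<bullet> y) = x' \<bullet> x' - x \<bullet> x" "x' \<noteq> x"
    using F(2) by (auto simp: bisector_eq_hyperplane voronoi_neighbours_def midpoint_def inner_simps inner_commute)
  then have "2 * d * ((x' - x) \<bullet> u) = (x' - x) \<bullet> (x' - x)"
    by (simp add: y_def inner_simps inner_commute algebra_simps)
  moreover have "2 * d * ((x' - x) \<bullet> u) \<le> 0"
    using u(2)[OF x'(1)] d by (simp add: mult_nonneg_nonpos)
  moreover have "(x' - x) \<bullet> (x' - x) > 0"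
    using \<open>x' \<noteq> x\<close> by simp
  ultimately show False by linarith
qed

section \<open>Circumscribed radii of cells and radii of spheres through nuclei\<close>

lemma circumscribed_radius_le_iff:
  assumes "0 \<le> r"
  shows "circumscribed_radius \<eta> x \<le> ennreal r \<longleftrightarrow> voronoi_cell \<eta> x \<subseteq> cball x r"
proof
  assume le: "circumscribed_radius \<eta> x \<le> ennreal r"
  then have "circumscribed_radius \<eta> x \<noteq> \<infinity>"
    by (auto simp: top_unique)
  then have "bounded (voronoi_cell \<eta> x)"
    using circumscribed_radius_unbounded by metis
  from circumscribed_radius_attained[OF this] obtain R where
    "0 \<le> R" "voronoi_cell \<eta> x \<subseteq> cball x R" "circumscribed_radius \<eta> x = ennreal R" by metis
  then show "voronoi_cell \<eta> x \<subseteq> cball x r"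
    using le assms by (force simp: subset_iff)
qed (use assms in \<open>auto simp: circumscribed_radius_def intro: INF_lower\<close>)

text \<open>
  A cell is the closure of its interior, so a dense set of test points suffices. With a
  countable dense set this exhibits the radius as a countable supremum.
\<close>

lemma circumscribed_radius_eq_SUP:
  fixes x :: "'a::euclidean_space"
  assumes fin: "locally_finite_set \<eta>" and D: "closure D = UNIV"
  shows "circumscribed_radius \<eta> x = (SUP q\<in>D \<inter> voronoi_cell \<eta> x. ennreal (dist x q))"
proof (rule antisym)
  let ?C = "voronoi_cell \<eta> x" and ?S = "SUP q\<in>D \<inter> voronoi_cell \<eta> x. ennreal (dist x q)"
  show "circumscribed_radius \<eta> x \<le> ?S"
  proof (cases "?S = top")
    case True
    then show ?thesis by (simp only: top_greatest)
  next
    case False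
    then obtain s where s: "?S = ennreal s" "0 \<le> s"
      by (cases ?S) auto
    have "dist x q \<le> s" if "q \<in> D \<inter> ?C" for q
    proof -
      have "ennreal (dist x q) \<le> ?S" using that by (rule SUP_upper)
      then show ?thesis using s by simp
    qed
    then have "closure (D \<inter> ?C) \<subseteq> cball x s"
      by (intro closure_minimal) auto
    moreover have "interior ?C \<subseteq> closure (D \<inter> ?C)"
      using open_Int_closure_subset[of "interior ?C" D] D interior_subset[of ?C]
        closure_mono[of "interior ?C \<inter> D" "D \<inter> ?C"] by auto
    moreover have "closure (interior ?C) = ?C"
      using convex_closure_interior[OF convex_voronoi_cell, of \<eta> x]
        nucleus_in_interior_voronoi_cell[OF fin, of x] closed_voronoi_cell[of \<eta> x] by auto
    ultimately have "?C \<subseteq> cball x s"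
      by (metis closed_cball closure_minimal order_trans)
    then show ?thesis
      using s circumscribed_radius_le_iff by metis
  qed
  show "?S \<le> circumscribed_radius \<eta> x"
    unfolding circumscribed_radius_def
    by (intro SUP_least INF_greatest ennreal_leI) auto
qed

text \<open>
  The smallest radius of a sphere passing through the first \<open>n \<ge> 1\<close> points of a sequence, and \<open>\<infinity>\<close> if there
  is no such sphere. For \<open>d + 1\<close> affinely independent points the sphere is unique; taking the infimum in
  general gives a total function, which is measurable and homogeneous of degree one under positive dilations.
\<close>

definition sphere_radius :: "nat \<Rightarrow> (nat \<Rightarrow> 'a::euclidean_space) \<Rightarrow> ennreal" where
  "sphere_radius n f = (INF z\<in>{z. \<forall>i<n. dist z (f i) = dist z (f 0)}. ennreal (dist z (f 0)))"

lemma sphere_radius_scaleR_ge: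
  fixes f :: "nat \<Rightarrow> 'a::euclidean_space"
  assumes "0 < c"
  shows "ennreal c * sphere_radius n f \<le> sphere_radius n (\<lambda>i. c *\<^sub>R f i)"
  unfolding sphere_radius_def[of n "\<lambda>i. c *\<^sub>R f i"]
proof (rule INF_greatest, clarify)
  fix z assume z: "\<forall>i<n. dist z (c *\<^sub>R f i) = dist z (c *\<^sub>R f 0)"
  have *: "dist z (c *\<^sub>R f i) = c * dist (z /\<^sub>R c) (f i)" for i
  proof -
    have "z - c *\<^sub>R f i = c *\<^sub>R (z /\<^sub>R c - f i)"
      using assms by (simp add: scaleR_diff_right)
    then show ?thesis using assms by (simp add: dist_norm)
  qed
  have "sphere_radius n f \<le> ennreal (dist (z /\<^sub>R c) (f 0))"
    unfolding sphere_radius_def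
  proof (rule INF_lower, clarify)
    fix i assume "i < n"
    then have "c * dist (z /\<^sub>R c) (f i) = c * dist (z /\<^sub>R c) (f 0)"
      using z unfolding *[symmetric] by blast
    then show "dist (z /\<^sub>R c) (f i) = dist (z /\<^sub>R c) (f 0)"
      using assms by simp
  qed
  then have "ennreal c * sphere_radius n f \<le> ennreal c * ennreal (dist (z /\<^sub>R c) (f 0))"
    by (rule mult_left_mono) simp
  also have "\<dots> = ennreal (dist z (c *\<^sub>R f 0))"
    unfolding *[of 0] using assms by (simp add: ennreal_mult)
  finally show "ennreal c * sphere_radius n f \<le> ennreal (dist z (c *\<^sub>R f 0))" .
qed

lemma sphere_radius_scaleR:
  assumes "0 < c"
  shows "sphere_radius n (\<lambda>i. c *\<^sub>R f i) = ennreal c * sphere_radius n f"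
proof (rule antisym[OF _ sphere_radius_scaleR_ge[OF assms]])
  have "sphere_radius n (\<lambda>i. c *\<^sub>R f i) =
      ennreal c * (ennreal (inverse c) * sphere_radius n (\<lambda>i. c *\<^sub>R f i))"
    using assms by (simp add: ennreal_mult[symmetric] mult.assoc[symmetric])
  also have "\<dots> \<le> ennreal c * sphere_radius n f"
    using sphere_radius_scaleR_ge[of "inverse c" n "\<lambda>i. c *\<^sub>R f i"] assms
    by (intro mult_left_mono) auto
  finally show "sphere_radius n (\<lambda>i. c *\<^sub>R f i) \<le> ennreal c * sphere_radius n f" .
qed

text \<open>
  By compactness, an equidistant centre exists as soon as there are approximately equidistant points of
  a dense set in a bounded region.
\<close>

lemma sphere_radius_le_iff:
  fixes f :: "nat \<Rightarrow> 'a::euclidean_space"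
  assumes c: "0 \<le> c" and D: "closure D = UNIV"
  shows "sphere_radius n f \<le> ennreal c \<longleftrightarrow>
    (\<forall>m::nat. \<exists>q\<in>D. dist q (f 0) < c + 1 / Suc m \<and> (\<forall>i<n. \<bar>dist q (f i) - dist q (f 0)\<bar> < 1 / Suc m))"
    (is "?L \<longleftrightarrow> ?R")
proof
  assume ?L
  show ?R
  proof
    fix m :: nat
    have "sphere_radius n f < ennreal (c + 1 / Suc m)"
      using c by (intro le_less_trans[OF \<open>?L\<close>] ennreal_lessI) (auto intro: add_nonneg_pos)
    then obtain z where z: "\<forall>i<n. dist z (f i) = dist z (f 0)" "ennreal (dist z (f 0)) < ennreal (c + 1 / Suc m)"
      unfolding sphere_radius_def INF_less_iff by auto
    have "dist z (f 0) < c + 1 / Suc m"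
      using z(2) by (simp add: ennreal_less_iff)
    define U where "U = {q. dist q (f 0) < c + 1 / Suc m} \<inter>
      (\<Inter>i\<in>{..<n}. {q. \<bar>dist q (f i) - dist q (f 0)\<bar> < 1 / Suc m})"
    have "open U" unfolding U_def
      by (intro open_Int open_INT open_Collect_less continuous_intros ballI) auto
    moreover have "\<bar>dist z (f i) - dist z (f 0)\<bar> < 1 / Suc m" if "i < n" for i
      using z(1)[rule_format, OF that] by simp
    then have "z \<in> U"
      using \<open>dist z (f 0) < _\<close> by (simp add: U_def)
    ultimately have "U \<inter> D \<noteq> {}"
      using open_Int_closure_eq_empty[of U D] D by auto
    then obtain q where "q \<in> D" "q \<in> U" by blast
    then show "\<exists>q\<in>D. dist q (f 0) < c + 1 / Suc m \<and> (\<forall>i<n. \<bar>dist q (f i) - dist q (f 0)\<bar> < 1 / Suc m)"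
      by (auto simp: U_def)
  qed
next
  assume ?R
  then obtain q where q: "\<And>m. dist (q m) (f 0) < c + 1 / Suc m"
     "\<And>m i. i < n \<Longrightarrow> \<bar>dist (q m) (f i) - dist (q m) (f 0)\<bar> < 1 / Suc m"
    by metis
  have lim: "(\<lambda>m. 1 / real (Suc m)) \<longlonglongrightarrow> 0"
    using LIMSEQ_inverse_real_of_nat by (simp add: inverse_eq_divide)
  have "q m \<in> cball (f 0) (c + 1)" for m
  proof -
    have "dist (q m) (f 0) < c + 1 / Suc m" by (rule q)
    also have "\<dots> \<le> c + 1" by simp
    finally show ?thesis by (simp add: dist_commute)
  qed
  then obtain z r where zr: "strict_mono r" "(q \<circ> r) \<longlonglongrightarrow> z"
    using compact_cball[of "f 0" "c + 1", unfolded compact_def, rule_format, of q] by auto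
  have lim': "(\<lambda>m. 1 / real (Suc (r m))) \<longlonglongrightarrow> 0"
    using LIMSEQ_subseq_LIMSEQ[OF lim zr(1)] by (simp add: o_def)
  have qz: "(\<lambda>m. dist (q (r m)) (f i)) \<longlonglongrightarrow> dist z (f i)" for i
    using zr(2) by (intro tendsto_intros) (simp add: o_def)
  have "dist z (f 0) \<le> c + 0"
    by (rule LIMSEQ_le[OF qz tendsto_add[OF tendsto_const lim']]) (use q in \<open>force intro: less_imp_le\<close>)
  moreover have "dist z (f i) = dist z (f 0)" if "i < n" for i
  proof -
    have "\<bar>dist z (f i) - dist z (f 0)\<bar> \<le> 0"
      by (rule LIMSEQ_le[OF tendsto_rabs[OF tendsto_diff[OF qz qz]] lim'])
         (use q(2)[OF that] in \<open>force intro: less_imp_le\<close>)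
    then show ?thesis by simp
  qed
  ultimately have "z \<in> {z. \<forall>i<n. dist z (f i) = dist z (f 0)}" "ennreal (dist z (f 0)) \<le> ennreal c"
    by (blast, intro ennreal_leI) linarith
  then show ?L
    unfolding sphere_radius_def by (rule INF_lower2)
qed

text \<open>
  The circumscribed radius of a bounded cell is attained at a point \<open>v\<close> of the cell. The nuclei at the
  same distance from \<open>v\<close> as \<open>x\<close> span the whole space relative to \<open>x\<close>, for otherwise \<open>v\<close> could be moved in two
  opposite directions inside the cell, and one of them would increase its distance from \<open>x\<close>. So \<open>v\<close> is the
  only centre of a sphere through \<open>x\<close> and \<open>d\<close> suitable other nuclei.
\<close>

lemma circumscribed_radius_eq_sphere_radius:
  fixes x :: "'a::euclidean_space"
  assumes fin: "locally_finite_set \<eta>" and x: "x \<in> \<eta>" and R: "circumscribed_radius \<eta> x = ennreal R" "0 \<le> R"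
  shows "0 < R" and "\<exists>f. inj_on f {..<DIM('a) + 1} \<and> f ` {..<DIM('a) + 1} \<subseteq> \<eta> \<inter> cball x (2 * R) \<and>
    sphere_radius (DIM('a) + 1) f = ennreal R"
proof -
  let ?C = "voronoi_cell \<eta> x"
  have sub: "?C \<subseteq> cball x R"
    using R circumscribed_radius_le_iff[of R \<eta> x] by simp
  have "compact ?C"
    using sub closed_voronoi_cell[of \<eta> x] bounded_subset[OF bounded_cball sub] by (simp add: compact_eq_bounded_closed)
  then obtain v where v: "v \<in> ?C" "\<And>z. z \<in> ?C \<Longrightarrow> dist x z \<le> dist x v"
    using distance_attains_sup[of ?C x] nucleus_in_voronoi_cell[of x \<eta>] by blast
  then have "?C \<subseteq> cball x (dist x v)" by auto
  then have "circumscribed_radius \<eta> x \<le> ennreal (dist x v)"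
    using circumscribed_radius_le_iff[of "dist x v" \<eta> x] by simp
  then have Rv: "dist x v = R"
    using R v(1) sub by (auto simp: subset_iff intro: antisym)
  have R_pos: "0 < R"
  proof -
    obtain e where e: "0 < e" "cball x e \<subseteq> ?C"
      using nucleus_in_interior_voronoi_cell[OF fin, of x] by (meson mem_interior_cball)
    obtain b :: 'a where b: "b \<in> Basis" using nonempty_Basis by blast
    have "dist x (x + e *\<^sub>R b) = e"
      using e b by (simp add: dist_norm)
    then have "x + e *\<^sub>R b \<in> cball x e"
      by simp
    then have "x + e *\<^sub>R b \<in> cball x R"
      using e(2) sub by blast
    then show ?thesis
      using e \<open>dist x (x + e *\<^sub>R b) = e\<close> by simp
  qed
  show "0 < R" by fact
  \<comment> \<open>the nuclei on the sphere around \<open>v\<close> through \<open>x\<close>, including \<open>x\<close> itself\<close>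
  define A where "A = {x'\<in>\<eta>. dist v x = dist v x'}"
  have span: "span ((\<lambda>x'. x' - x) ` A) = UNIV"
  proof (rule ccontr)
    assume "\<not> ?thesis"
    then obtain u where u: "u \<noteq> 0" "\<forall>a\<in>span ((\<lambda>x'. x' - x) ` A). u \<bullet> a = 0"
      using span_not_UNIV_orthogonal by blast
    then have orth: "(x' - x) \<bullet> u = 0" if "x' \<in> A" for x'
      using u(2) span_base[of "x' - x" "(\<lambda>x'. x' - x) ` A"] that by (simp add: inner_commute[of _ u])
    define U where "U = {y. \<forall>x'\<in>\<eta> - A. dist y x < dist y x'}"
    have "open U"
      unfolding U_def using fin by (intro open_strictly_nearest) (rule locally_finite_set_subset, auto)
    moreover have "v \<in> U"
    proof -
      have "dist v x < dist v x'" if "x' \<in> \<eta> - A" for x'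
        using that v(1) by (cases "x' = x") (auto simp: A_def voronoi_cell_def order.strict_iff_order)
      then show ?thesis by (simp add: U_def)
    qed
    ultimately obtain e where e: "e > 0" "cball v e \<subseteq> U"
      by (meson open_contains_cball)
    define w where "w = (e / norm u) *\<^sub>R u"
    have w: "norm w = e" "\<And>x'. x' \<in> A \<Longrightarrow> (x' - x) \<bullet> w = 0"
      using u e orth by (auto simp: w_def)
    have in_C: "v + s \<in> ?C" if s: "s = w \<or> s = - w" for s
      unfolding voronoi_cell_def
    proof safe
      fix x' assume x': "x' \<in> \<eta>" "x' \<noteq> x"
      show "dist (v + s) x \<le> dist (v + s) x'"
      proof (cases "x' \<in> A")
        case True
        then have "(x' - x) \<bullet> v = (x' - x) \<bullet> midpoint x x'"
          by (auto simp: A_def dist_eq_iff_hyperplane)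
        then show ?thesis
          using w(2)[OF True] s by (auto simp: dist_le_iff_halfspace inner_add_right inner_minus_right)
      next
        case False
        have "v + s \<in> U" using e w(1) s by (force simp: dist_norm)
        then show ?thesis using False x' by (auto simp: U_def intro: less_imp_le)
      qed
    qed
    have le: "norm (v - x + s) \<le> norm (v - x)" if "s = w \<or> s = - w" for s
      using v(2)[OF in_C[OF that]] by (simp add: dist_norm norm_minus_commute algebra_simps)
    have "(norm (v - x + w))\<^sup>2 \<le> (norm (v - x))\<^sup>2" "(norm (v - x + - w))\<^sup>2 \<le> (norm (v - x))\<^sup>2"
      using le[of w] le[of "- w"] by (intro power_mono; simp)+
    then have "2 * (w \<bullet> w) \<le> 0"
      by (simp add: power2_norm_eq_inner inner_simps inner_commute)
    then show False using w(1) e by (simp add: dot_square_norm)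
  qed
  obtain B where B: "B \<subseteq> (\<lambda>x'. x' - x) ` A" "independent B" "(\<lambda>x'. x' - x) ` A \<subseteq> span B"
      "card B = dim ((\<lambda>x'. x' - x) ` A)"
    using basis_exists by metis
  have card: "card B = DIM('a)"
    using B(4) span by (metis dim_UNIV dim_span)
  have spanB: "span B = UNIV"
    using span B(3) by (metis span_mono span_span top.extremum_unique)
  have "finite B" using B(2) independent_imp_finite by blast
  then obtain h where h: "bij_betw h {0..<DIM('a)} B"
    using ex_bij_betw_nat_finite[of B] card by auto
  define f where "f i = (if i = 0 then x else x + h (i - 1))" for i
  have hB: "h i \<in> B" if "i < DIM('a)" for i
    using h that by (auto simp: bij_betw_def)
  have fA: "f i \<in> A" if i: "i < DIM('a) + 1" for i
  proof (cases "i = 0")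
    case False
    then have "h (i - 1) \<in> (\<lambda>x'. x' - x) ` A"
      using hB[of "i - 1"] B(1) i by auto
    then show ?thesis using False by (auto simp: f_def)
  qed (use x in \<open>simp add: f_def A_def\<close>)
  have inj: "inj_on f {..<DIM('a) + 1}"
  proof (rule inj_onI)
    fix i j assume ij: "i \<in> {..<DIM('a) + 1}" "j \<in> {..<DIM('a) + 1}" "f i = f j"
    have "0 \<notin> B" using B(2) dependent_zero by blast
    then have nz: "h k \<noteq> 0" if "k < DIM('a)" for k using hB[OF that] by auto
    show "i = j"
    proof (cases "i = 0 \<or> j = 0")
      case True
      then show ?thesis
        using ij nz[of "i - 1"] nz[of "j - 1"] by (auto simp: f_def split: if_splits)
    next
      case False
      then have "h (i - 1) = h (j - 1)" using ij by (simp add: f_def)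
      then have "i - 1 = j - 1"
        using h ij False by (auto simp: bij_betw_def inj_on_def)
      then show ?thesis using False by (simp add: eq_diff_iff Suc_le_eq)
    qed
  qed
  have dist_f: "dist v (f i) = R" if "i < DIM('a) + 1" for i
    using fA[OF that] Rv by (simp add: A_def dist_commute)
  have near: "f i \<in> \<eta> \<inter> cball x (2 * R)" if "i < DIM('a) + 1" for i
    using fA[OF that] dist_f[OF that] Rv dist_triangle[of x "f i" v] by (simp add: A_def)
  have "z = v" if z: "\<forall>i<DIM('a) + 1. dist z (f i) = dist z (f 0)" for z
  proof -
    have "b \<bullet> (z - v) = 0" if "b \<in> B" for b
    proof -
      obtain i where i: "i < DIM('a)" "b = h i"
        using h \<open>b \<in> B\<close> by (auto simp: bij_betw_def)
      then have f: "f (Suc i) = x + b" "f 0 = x" by (auto simp: f_def)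
      have "dist z x = dist z (x + b)" "dist v x = dist v (x + b)"
        using z[rule_format, of "Suc i"] dist_f[of "Suc i"] i f Rv by (auto simp: dist_commute)
      then show ?thesis
        by (simp add: dist_eq_iff_hyperplane inner_diff_right)
    qed
    then have "(z - v) \<bullet> (z - v) = 0"
      using orthogonal_to_span[of "z - v" B "z - v"] spanB by (auto simp: orthogonal_def inner_commute)
    then show ?thesis by simp
  qed
  then have "{z. \<forall>i<DIM('a) + 1. dist z (f i) = dist z (f 0)} = {v}"
    using dist_f by auto
  then have "sphere_radius (DIM('a) + 1) f = ennreal R"
    unfolding sphere_radius_def using dist_f[of 0] by simp
  then show "\<exists>f. inj_on f {..<DIM('a) + 1} \<and> f ` {..<DIM('a) + 1} \<subseteq> \<eta> \<inter> cball x (2 * R) \<and>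
    sphere_radius (DIM('a) + 1) f = ennreal R"
    using inj near by (intro exI[of _ f]) auto
qed

section \<open>Measurability of cell characteristics\<close>

text \<open>
  Moving the witness slightly across the bisector gives an open condition, which can be tested on a
  countable dense set.
\<close>

lemma voronoi_neighbours_iff_dense:
  fixes x x' :: "'a::euclidean_space"
  assumes fin: "locally_finite_set \<eta>" and D: "closure D = UNIV" and "x' \<noteq> x"
  shows "(\<exists>y. dist y x = dist y x' \<and> (\<forall>x''\<in>\<eta> - {x, x'}. dist y x < dist y x'')) \<longleftrightarrow>
    (\<exists>q\<in>D. dist q x' < dist q x \<and> (\<forall>x''\<in>\<eta> - {x, x'}. dist q x < dist q x''))"
proof -
  \<comment> \<open>an open convex set containing \<open>x\<close>\<close>
  define U where "U = {y. \<forall>x''\<in>\<eta> - {x, x'}. dist y x < dist y x''}"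
  have opU: "open U"
    unfolding U_def using fin by (intro open_strictly_nearest) (rule locally_finite_set_subset, auto)
  have "(\<exists>y\<in>U. dist y x = dist y x') \<longleftrightarrow> (\<exists>q\<in>D. dist q x' < dist q x \<and> q \<in> U)"
  proof
    assume "\<exists>y\<in>U. dist y x = dist y x'"
    then obtain y where y: "y \<in> U" "dist y x = dist y x'" by blast
    obtain e where e: "e > 0" "cball y e \<subseteq> U"
      using opU y using open_contains_cball[of U] by auto
    define z where "z = y + (e / norm (x' - x)) *\<^sub>R (x' - x)"
    have "z \<in> cball y e"
      using e by (simp add: z_def dist_norm)
    moreover have "dist z x' < dist z x"
    proof -
      have "(x' - x) \<bullet> y = (x' - x) \<bullet> midpoint x x'"
        using y by (simp add: dist_eq_iff_hyperplane)
      moreover have "(x' - x) \<bullet> z = (x' - x) \<bullet> y + e * norm (x' - x)"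
        using assms(3) by (simp add: z_def inner_add_right dot_square_norm power2_eq_square)
      moreover have "e * norm (x' - x) > 0"
        using e assms(3) by simp
      ultimately have "\<not> dist z x \<le> dist z x'"
        unfolding dist_le_iff_halfspace by linarith
      then show ?thesis by simp
    qed
    ultimately have "z \<in> U \<inter> {q. dist q x' < dist q x}"
      using e by blast
    moreover have "open (U \<inter> {q. dist q x' < dist q x})"
      by (intro open_Int opU open_Collect_less continuous_intros)
    ultimately have "U \<inter> {q. dist q x' < dist q x} \<inter> D \<noteq> {}"
      using open_Int_closure_eq_empty[of "U \<inter> {q. dist q x' < dist q x}" D] D by auto
    then show "\<exists>q\<in>D. dist q x' < dist q x \<and> q \<in> U" by blast
  next
    assume "\<exists>q\<in>D. dist q x' < dist q x \<and> q \<in> U"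
    then obtain q where q: "dist q x' < dist q x" "q \<in> U" by blast
    have xU: "x \<in> U" by (auto simp: U_def)
    have conv: "convex U" unfolding U_def by (rule convex_strictly_nearest)
    let ?b = "(x' - x) \<bullet> midpoint x x'"
    have "\<exists>z\<in>U. (x' - x) \<bullet> z = ?b"
    proof (rule connected_ivt_hyperplane)
      show "connected U" using conv by (rule convex_connected)
      show "(x' - x) \<bullet> x \<le> ?b"
        using dist_le_iff_halfspace[of x x x'] by simp
      show "?b \<le> (x' - x) \<bullet> q"
        using q(1) dist_le_iff_halfspace[of q x x'] by linarith
    qed (use xU q in auto)
    then show "\<exists>y\<in>U. dist y x = dist y x'"
      by (simp add: dist_eq_iff_hyperplane)
  qed
  then show ?thesis by (auto simp: U_def)
qed

lemma dense_countable_set: "\<exists>D :: 'a::second_countable_topology set. countable D \<and> closure D = UNIV"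
proof -
  obtain D :: "'a set" where D: "countable D" "\<And>U. open U \<Longrightarrow> U \<noteq> {} \<Longrightarrow> \<exists>d\<in>D. d \<in> U"
    using countable_dense_setE by blast
  have "- closure D = {}"
    using D(2)[of "- closure D"] closure_subset[of D] by auto
  then show ?thesis using D(1) by auto
qed

text \<open>
  A countable basis of the topology consisting of bounded open sets. Each point of a locally finite set is
  the only point of that set in some basis element, so a quantifier over a random locally finite set
  becomes a countable one.
\<close>

definition isolating_sets :: "'a::euclidean_space set set" where
  "isolating_sets = {B \<in> (SOME \<B>. countable \<B> \<and> topological_basis \<B>). bounded B}"

lemma isolating_sets_basis:
  fixes Q U :: "'a::euclidean_space set"
  shows "countable (isolating_sets :: 'a set set)"
  "Q \<in> isolating_sets \<Longrightarrow> open Q" "Q \<in> isolating_sets \<Longrightarrow> bounded Q"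
  "open U \<Longrightarrow> x \<in> U \<Longrightarrow> \<exists>Q\<in>isolating_sets. x \<in> Q \<and> Q \<subseteq> U"
proof -
  define \<B> :: "'a set set" where "\<B> = (SOME \<B>. countable \<B> \<and> topological_basis \<B>)"
  have \<B>: "countable \<B>" "topological_basis \<B>"
    using someI_ex[OF ex_countable_basis] by (auto simp: \<B>_def)
  have eq: "isolating_sets = {B \<in> \<B>. bounded B}"
    by (simp add: isolating_sets_def \<B>_def)
  show "countable (isolating_sets :: 'a set set)"
    unfolding eq using \<B>(1) by (rule countable_subset[rotated]) auto
  show "Q \<in> isolating_sets \<Longrightarrow> open Q" "Q \<in> isolating_sets \<Longrightarrow> bounded Q"
    using \<B>(2) by (auto simp: eq topological_basis_open)
  assume "open U" "x \<in> U"
  then obtain Q where "Q \<in> \<B>" "x \<in> Q" "Q \<subseteq> U \<inter> ball x 1"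
    using topological_basisE[OF \<B>(2), of "U \<inter> ball x 1" x] by auto
  then show "\<exists>Q\<in>isolating_sets. x \<in> Q \<and> Q \<subseteq> U"
    unfolding eq using bounded_subset[OF bounded_ball] by (intro bexI[of _ Q]) auto
qed

lemma isolating_set_exists:
  assumes "locally_finite_set \<eta>" "x \<in> \<eta>" "open U" "x \<in> U"
  shows "\<exists>Q\<in>isolating_sets. Q \<subseteq> U \<and> \<eta> \<inter> Q = {x}"
proof -
  define F where "F = \<eta> \<inter> ball x 1 - {x}"
  have "finite F"
    using assms(1) by (auto simp: F_def locally_finite_set_def)
  then have "open (U \<inter> ball x 1 - F)"
    using assms(3) by (intro open_Diff open_Int open_ball finite_imp_closed)
  moreover have "x \<in> U \<inter> ball x 1 - F"
    using assms(4) by (auto simp: F_def)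
  ultimately obtain Q where "Q \<in> isolating_sets" "x \<in> Q" "Q \<subseteq> U \<inter> ball x 1 - F"
    using isolating_sets_basis(4) by metis
  then show ?thesis
    using assms(2) by (intro bexI[of _ Q]) (auto simp: F_def)
qed

lemma card_subset_eq_iff:
  assumes "0 < n"
  shows "card S = n \<longleftrightarrow> (\<exists>T\<subseteq>S. finite T \<and> card T = n) \<and> \<not> (\<exists>T\<subseteq>S. finite T \<and> card T = Suc n)"
proof (cases "finite S")
  case True
  have "card S = n" if "T \<subseteq> S" "card T = n" "\<not> (\<exists>T\<subseteq>S. finite T \<and> card T = Suc n)" for T
  proof -
    have "n \<le> card S"
      using card_mono[OF True that(1)] that(2) by simp
    moreover have "\<not> Suc n \<le> card S"
      using obtain_subset_with_card_n[of "Suc n" S] that(3) by blast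
    ultimately show ?thesis by simp
  qed
  moreover have "card T \<noteq> Suc (card S)" if "T \<subseteq> S" for T
    using card_mono[OF True that] by simp
  ultimately show ?thesis using True by blast
next
  case False
  then obtain T where "T \<subseteq> S" "finite T" "card T = Suc n"
    using infinite_arbitrarily_large by blast
  then show ?thesis
    using assms False by auto
qed

text \<open>
  The intensity is not required to be positive here; lemmas that need it assume so.
\<close>

locale poisson_process = prob_space M for M :: "'w measure" +
  fixes \<gamma> :: real and X :: "'w \<Rightarrow> 'a::euclidean_space set"
  assumes poisson: "homogeneous_poisson_process M \<gamma> X"
begin

lemma locally_finite_X: "\<omega> \<in> space M \<Longrightarrow> locally_finite_set (X \<omega>)"
  using poisson by (simp add: homogeneous_poisson_process_def)

lemma finite_X_Int: "\<omega> \<in> space M \<Longrightarrow> bounded B \<Longrightarrow> finite (X \<omega> \<inter> B)"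
  using locally_finite_X by (simp add: locally_finite_set_def)

lemma measurable_count:
  "B \<in> sets borel \<Longrightarrow> bounded B \<Longrightarrow> (\<lambda>\<omega>. card (X \<omega> \<inter> B)) \<in> M \<rightarrow>\<^sub>M count_space UNIV"
  using poisson by (simp add: homogeneous_poisson_process_def)

lemma pred_count [measurable (raw)]:
  assumes "B \<in> sets borel" "bounded B"
  shows "Measurable.pred M (\<lambda>\<omega>. P (card (X \<omega> \<inter> B)))"
  using measurable_compose[OF measurable_count[OF assms], of P "count_space UNIV"] by simp

text \<open>
  The unique point of the process in \<open>Q\<close>. The value \<open>0\<close> taken when there is not exactly one such point is
  arbitrary and serves only to make the function total.
\<close>

definition isolated_point :: "'a set \<Rightarrow> 'w \<Rightarrow> 'a" where
  "isolated_point Q \<omega> = (if card (X \<omega> \<inter> Q) = 1 then the_elem (X \<omega> \<inter> Q) else 0)"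

lemma isolated_point_eq: "X \<omega> \<inter> Q = {x} \<Longrightarrow> isolated_point Q \<omega> = x"
  by (simp add: isolated_point_def)

lemma isolated_point_mem:
  assumes "card (X \<omega> \<inter> Q) = 1"
  shows "isolated_point Q \<omega> \<in> X \<omega> \<inter> Q"
proof -
  obtain x where x: "X \<omega> \<inter> Q = {x}"
    using assms unfolding One_nat_def card_1_singleton_iff ..
  then show ?thesis
    using isolated_point_eq[OF x] by blast
qed

lemma measurable_isolated_point:
  assumes Q: "Q \<in> sets borel" "bounded Q"
  shows "isolated_point Q \<in> borel_measurable M"
proof (rule measurableI)
  fix A :: "'a set" assume A: "A \<in> sets borel"
  have "isolated_point Q \<omega> \<in> A \<longleftrightarrow>
      (card (X \<omega> \<inter> Q) = 1 \<and> card (X \<omega> \<inter> (Q \<inter> A)) = 1) \<or> (card (X \<omega> \<inter> Q) \<noteq> 1 \<and> 0 \<in> A)" for \<omega>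
  proof (cases "card (X \<omega> \<inter> Q) = 1")
    case True
    then obtain x where x: "X \<omega> \<inter> Q = {x}" by (auto simp: card_1_singleton_iff)
    then have "X \<omega> \<inter> (Q \<inter> A) = (if x \<in> A then {x} else {})" by auto
    then show ?thesis using True x by (simp add: isolated_point_def)
  qed (simp add: isolated_point_def)
  then have "isolated_point Q -` A \<inter> space M = {\<omega> \<in> space M.
      (card (X \<omega> \<inter> Q) = 1 \<and> card (X \<omega> \<inter> (Q \<inter> A)) = 1) \<or> (card (X \<omega> \<inter> Q) \<noteq> 1 \<and> 0 \<in> A)}"
    by auto
  also have "\<dots> \<in> sets M"
    using pred_count[of Q "\<lambda>n. n = 1"] pred_count[of "Q \<inter> A" "\<lambda>n. n = 1"] Q A
    by (simp add: bounded_Int)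
  finally show "isolated_point Q -` A \<inter> space M \<in> sets M" .
qed simp

lemma isolating_sets_borel: "Q \<in> isolating_sets \<Longrightarrow> Q \<in> sets borel"
  by (simp add: isolating_sets_basis(2))

lemma ball_X_iff:
  assumes "\<omega> \<in> space M"
  shows "(\<forall>x\<in>X \<omega>. P x) \<longleftrightarrow>
    (\<forall>Q\<in>isolating_sets. card (X \<omega> \<inter> Q) = 1 \<longrightarrow> P (isolated_point Q \<omega>))"
proof safe
  fix Q assume "\<forall>x\<in>X \<omega>. P x" "card (X \<omega> \<inter> Q) = 1"
  then show "P (isolated_point Q \<omega>)"
    using isolated_point_mem by blast
next
  fix x assume *: "\<forall>Q\<in>isolating_sets. card (X \<omega> \<inter> Q) = 1 \<longrightarrow> P (isolated_point Q \<omega>)" "x \<in> X \<omega>"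
  obtain Q where "Q \<in> isolating_sets" "X \<omega> \<inter> Q = {x}"
    using isolating_set_exists[OF locally_finite_X[OF assms] *(2) open_UNIV] by auto
  then show "P x"
    using * isolated_point_eq by fastforce
qed

lemma pred_ball_X:
  assumes "\<And>h. h \<in> borel_measurable M \<Longrightarrow> Measurable.pred M (\<lambda>\<omega>. P \<omega> (h \<omega>))"
  shows "Measurable.pred M (\<lambda>\<omega>. \<forall>x\<in>X \<omega>. P \<omega> x)"
proof -
  have "Measurable.pred M (\<lambda>\<omega>. \<forall>Q\<in>isolating_sets. card (X \<omega> \<inter> Q) = 1 \<longrightarrow> P \<omega> (isolated_point Q \<omega>))"
    by (intro measurable_pred_countable isolating_sets_basis(1) pred_intros_logic pred_count assms
        measurable_isolated_point isolating_sets_borel isolating_sets_basis(3))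
  then show ?thesis
    by (subst measurable_cong[OF ball_X_iff]) auto
qed

lemma pred_bex_X:
  assumes "\<And>h. h \<in> borel_measurable M \<Longrightarrow> Measurable.pred M (\<lambda>\<omega>. P \<omega> (h \<omega>))"
  shows "Measurable.pred M (\<lambda>\<omega>. \<exists>x\<in>X \<omega>. P \<omega> x)"
proof -
  have "Measurable.pred M (\<lambda>\<omega>. \<not> (\<forall>x\<in>X \<omega>. \<not> P \<omega> x))"
    by (intro pred_intros_logic(2) pred_ball_X assms)
  then show ?thesis by simp
qed

lemma pred_mem_voronoi_cell:
  assumes [measurable]: "h \<in> borel_measurable M" "k \<in> borel_measurable M"
  shows "Measurable.pred M (\<lambda>\<omega>. k \<omega> \<in> voronoi_cell (X \<omega>) (h \<omega>))"
proof -
  have "Measurable.pred M (\<lambda>\<omega>. \<forall>x'\<in>X \<omega>. x' \<noteq> h \<omega> \<longrightarrow> dist (k \<omega>) (h \<omega>) \<le> dist (k \<omega>) x')"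
  proof (rule pred_ball_X)
    fix g :: "'w \<Rightarrow> 'a" assume [measurable]: "g \<in> borel_measurable M"
    show "Measurable.pred M (\<lambda>\<omega>. g \<omega> \<noteq> h \<omega> \<longrightarrow> dist (k \<omega>) (h \<omega>) \<le> dist (k \<omega>) (g \<omega>))"
      by measurable
  qed
  then show ?thesis by (simp add: voronoi_cell_def)
qed

lemma pred_mem_voronoi_neighbours:
  assumes [measurable]: "h \<in> borel_measurable M" "k \<in> borel_measurable M"
  shows "Measurable.pred M (\<lambda>\<omega>. k \<omega> \<in> voronoi_neighbours (X \<omega>) (h \<omega>))"
proof -
  obtain D :: "'a set" where D: "countable D" "closure D = UNIV"
    using dense_countable_set by blast
  have in_X: "Measurable.pred M (\<lambda>\<omega>. k \<omega> \<in> X \<omega>)"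
  proof -
    have "Measurable.pred M (\<lambda>\<omega>. \<exists>x\<in>X \<omega>. x = k \<omega>)"
    proof (rule pred_bex_X)
      fix g :: "'w \<Rightarrow> 'a" assume [measurable]: "g \<in> borel_measurable M"
      show "Measurable.pred M (\<lambda>\<omega>. g \<omega> = k \<omega>)"
        by measurable
    qed
    then show ?thesis by simp
  qed
  have *: "Measurable.pred M (\<lambda>\<omega>. \<forall>x''\<in>X \<omega>. x'' \<noteq> h \<omega> \<and> x'' \<noteq> k \<omega> \<longrightarrow> dist q (h \<omega>) < dist q x'')" for q
  proof (rule pred_ball_X)
    fix g :: "'w \<Rightarrow> 'a" assume [measurable]: "g \<in> borel_measurable M"
    show "Measurable.pred M (\<lambda>\<omega>. g \<omega> \<noteq> h \<omega> \<and> g \<omega> \<noteq> k \<omega> \<longrightarrow> dist q (h \<omega>) < dist q (g \<omega>))"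
      by measurable
  qed
  have D_bex: "Measurable.pred M (\<lambda>\<omega>. \<exists>q\<in>D. dist q (k \<omega>) < dist q (h \<omega>) \<and>
      (\<forall>x''\<in>X \<omega>. x'' \<noteq> h \<omega> \<and> x'' \<noteq> k \<omega> \<longrightarrow> dist q (h \<omega>) < dist q x''))"
  proof (rule measurable_pred_countable(2)[OF D(1)], rule pred_intros_logic(3)[OF _ *])
    show "Measurable.pred M (\<lambda>\<omega>. dist q (k \<omega>) < dist q (h \<omega>))" for q
      by measurable
  qed
  have "Measurable.pred M (\<lambda>\<omega>. k \<omega> \<in> X \<omega> \<and> k \<omega> \<noteq> h \<omega> \<and> (\<exists>q\<in>D. dist q (k \<omega>) < dist q (h \<omega>) \<and>
      (\<forall>x''\<in>X \<omega>. x'' \<noteq> h \<omega> \<and> x'' \<noteq> k \<omega> \<longrightarrow> dist q (h \<omega>) < dist q x'')))"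
    by (intro pred_intros_logic(3) in_X D_bex) measurable
  also have "?this \<longleftrightarrow> ?thesis"
  proof (rule measurable_cong)
    fix \<omega> assume "\<omega> \<in> space M"
    from voronoi_neighbours_iff_dense[OF locally_finite_X[OF this] D(2), of "k \<omega>" "h \<omega>"]
    show "(k \<omega> \<in> X \<omega> \<and> k \<omega> \<noteq> h \<omega> \<and> (\<exists>q\<in>D. dist q (k \<omega>) < dist q (h \<omega>) \<and>
      (\<forall>x''\<in>X \<omega>. x'' \<noteq> h \<omega> \<and> x'' \<noteq> k \<omega> \<longrightarrow> dist q (h \<omega>) < dist q x''))) =
      (k \<omega> \<in> voronoi_neighbours (X \<omega>) (h \<omega>))"
      by (cases "k \<omega> = h \<omega>") (auto simp: voronoi_neighbours_def)
  qed
  finally show ?thesis .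
qed

text \<open>
  A finite set of points of the process corresponds to a finite set of isolating sets with distinct
  isolated points, and there are only countably many finite sets of isolating sets.
\<close>

lemma pred_finite_subset_X:
  assumes P: "\<And>h. h \<in> borel_measurable M \<Longrightarrow> Measurable.pred M (\<lambda>\<omega>. P \<omega> (h \<omega>))"
  shows "Measurable.pred M (\<lambda>\<omega>. \<exists>T\<subseteq>{x\<in>X \<omega>. P \<omega> x}. finite T \<and> card T = n)"
proof -
  define \<F> :: "'a set set set" where "\<F> = {\<Q>. \<Q> \<subseteq> isolating_sets \<and> finite \<Q> \<and> card \<Q> = n}"
  have "countable {\<Q> :: 'a set set. finite \<Q> \<and> \<Q> \<subseteq> isolating_sets}"
    by (rule countable_Collect_finite_subset[OF isolating_sets_basis(1)])
  then have count: "countable \<F>"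
    by (rule countable_subset[rotated]) (auto simp: \<F>_def)
  have iff: "(\<exists>T\<subseteq>{x\<in>X \<omega>. P \<omega> x}. finite T \<and> card T = n) \<longleftrightarrow>
    (\<exists>\<Q>\<in>\<F>. \<forall>Q\<in>\<Q>. (card (X \<omega> \<inter> Q) = 1 \<and> P \<omega> (isolated_point Q \<omega>)) \<and>
       (\<forall>Q'\<in>\<Q>. isolated_point Q \<omega> = isolated_point Q' \<omega> \<longrightarrow> Q = Q'))" (is "?L \<longleftrightarrow> ?R")
    if \<omega>: "\<omega> \<in> space M" for \<omega>
  proof
    assume ?L
    then obtain T where T: "T \<subseteq> {x\<in>X \<omega>. P \<omega> x}" "finite T" "card T = n" by blast
    have "\<exists>Q\<in>isolating_sets. X \<omega> \<inter> Q = {x}" if "x \<in> T" for x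
      using isolating_set_exists[OF locally_finite_X[OF \<omega>] _ open_UNIV, of x] T that by blast
    then obtain q where q: "\<And>x. x \<in> T \<Longrightarrow> q x \<in> isolating_sets \<and> X \<omega> \<inter> q x = {x}" by metis
    then have pt: "isolated_point (q x) \<omega> = x" if "x \<in> T" for x
      using that by (simp add: isolated_point_def)
    then have "inj_on q T" by (metis inj_onI)
    then have "q ` T \<in> \<F>"
      using T q by (auto simp: \<F>_def card_image)
    then show ?R
      using q pt T(1) by (intro bexI[of _ "q ` T"]) auto
  next
    assume ?R
    then obtain \<Q> where \<Q>: "\<Q> \<in> \<F>" "\<And>Q. Q \<in> \<Q> \<Longrightarrow> card (X \<omega> \<inter> Q) = 1 \<and> P \<omega> (isolated_point Q \<omega>)"
      "inj_on (\<lambda>Q. isolated_point Q \<omega>) \<Q>"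
      unfolding inj_on_def by blast
    have "isolated_point Q \<omega> \<in> X \<omega>" if "Q \<in> \<Q>" for Q
      using \<Q>(2)[OF that] isolated_point_mem by blast
    then have "(\<lambda>Q. isolated_point Q \<omega>) ` \<Q> \<subseteq> {x\<in>X \<omega>. P \<omega> x}"
      using \<Q>(2) by blast
    moreover have "finite \<Q>" "card \<Q> = n"
      using \<Q>(1) by (simp_all add: \<F>_def)
    ultimately show ?L
      using card_image[OF \<Q>(3)] by (metis finite_imageI)
  qed
  have pt: "isolated_point Q \<in> borel_measurable M" if "Q \<in> \<Q>" "\<Q> \<in> \<F>" for Q \<Q>
    using that by (intro measurable_isolated_point isolating_sets_borel isolating_sets_basis(3)) (auto simp: \<F>_def)
  have "Measurable.pred M (\<lambda>\<omega>. \<exists>\<Q>\<in>\<F>. \<forall>Q\<in>\<Q>. (card (X \<omega> \<inter> Q) = 1 \<and> P \<omega> (isolated_point Q \<omega>)) \<and>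
       (\<forall>Q'\<in>\<Q>. isolated_point Q \<omega> = isolated_point Q' \<omega> \<longrightarrow> Q = Q'))"
  proof (rule measurable_pred_countable(2)[OF count])
    fix \<Q> assume \<Q>: "\<Q> \<in> \<F>"
    have fin: "countable \<Q>" using \<Q> by (simp add: \<F>_def countable_finite)
    have iso: "Q \<in> isolating_sets" if "Q \<in> \<Q>" for Q using \<Q> that by (auto simp: \<F>_def)
    show "Measurable.pred M (\<lambda>\<omega>. \<forall>Q\<in>\<Q>. (card (X \<omega> \<inter> Q) = 1 \<and> P \<omega> (isolated_point Q \<omega>)) \<and>
       (\<forall>Q'\<in>\<Q>. isolated_point Q \<omega> = isolated_point Q' \<omega> \<longrightarrow> Q = Q'))"
    proof (rule measurable_pred_countable(1)[OF fin], rule pred_intros_logic(3))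
      fix Q assume Q: "Q \<in> \<Q>"
      show "Measurable.pred M (\<lambda>\<omega>. card (X \<omega> \<inter> Q) = 1 \<and> P \<omega> (isolated_point Q \<omega>))"
        by (rule pred_intros_logic(3)[OF pred_count P])
           (auto intro: pt Q \<Q> iso isolating_sets_borel isolating_sets_basis(3))
      show "Measurable.pred M (\<lambda>\<omega>. \<forall>Q'\<in>\<Q>. isolated_point Q \<omega> = isolated_point Q' \<omega> \<longrightarrow> Q = Q')"
      proof (rule measurable_pred_countable(1)[OF fin])
        fix Q' assume Q': "Q' \<in> \<Q>"
        note [measurable] = pt[OF Q \<Q>] pt[OF Q' \<Q>]
        show "Measurable.pred M (\<lambda>\<omega>. isolated_point Q \<omega> = isolated_point Q' \<omega> \<longrightarrow> Q = Q')"
          by measurable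
      qed
    qed
  qed
  then show ?thesis
    by (subst measurable_cong[OF iff]) auto
qed

lemma pred_card_voronoi_neighbours:
  assumes h: "h \<in> borel_measurable M" and "0 < n"
  shows "Measurable.pred M (\<lambda>\<omega>. card (voronoi_neighbours (X \<omega>) (h \<omega>)) = n)"
proof -
  have eq: "voronoi_neighbours (X \<omega>) (h \<omega>) = {x\<in>X \<omega>. x \<in> voronoi_neighbours (X \<omega>) (h \<omega>)}" for \<omega>
    by (auto simp: voronoi_neighbours_def)
  have "Measurable.pred M (\<lambda>\<omega>. \<exists>T\<subseteq>voronoi_neighbours (X \<omega>) (h \<omega>). finite T \<and> card T = m)" for m
    using pred_finite_subset_X[where P = "\<lambda>\<omega> x. x \<in> voronoi_neighbours (X \<omega>) (h \<omega>)" and n = m,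
        OF pred_mem_voronoi_neighbours[OF h]]
    unfolding eq[symmetric] .
  then have "Measurable.pred M (\<lambda>\<omega>. (\<exists>T\<subseteq>voronoi_neighbours (X \<omega>) (h \<omega>). finite T \<and> card T = n) \<and>
      \<not> (\<exists>T\<subseteq>voronoi_neighbours (X \<omega>) (h \<omega>). finite T \<and> card T = Suc n))"
    by (intro pred_intros_logic(2,3))
  then show ?thesis
    by (rule measurable_cong[THEN iffD2, OF card_subset_eq_iff[OF \<open>0 < n\<close>]])
qed

lemma measurable_circumscribed_radius:
  assumes h: "h \<in> borel_measurable M"
  shows "(\<lambda>\<omega>. circumscribed_radius (X \<omega>) (h \<omega>)) \<in> borel_measurable M"
proof -
  obtain D :: "'a set" where D: "countable D" "closure D = UNIV"
    using dense_countable_set by blast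
  have "(\<lambda>\<omega>. SUP q\<in>D. if q \<in> voronoi_cell (X \<omega>) (h \<omega>) then ennreal (dist (h \<omega>) q) else 0) \<in> borel_measurable M"
  proof (intro borel_measurable_SUP D(1))
    fix q
    note [measurable] = h pred_mem_voronoi_cell[OF h borel_measurable_const[of q]]
    show "(\<lambda>\<omega>. if q \<in> voronoi_cell (X \<omega>) (h \<omega>) then ennreal (dist (h \<omega>) q) else 0) \<in> borel_measurable M"
      by measurable
  qed
  also have "?this \<longleftrightarrow> ?thesis"
  proof (rule measurable_cong)
    fix \<omega> assume \<omega>: "\<omega> \<in> space M"
    let ?g = "\<lambda>q. if q \<in> voronoi_cell (X \<omega>) (h \<omega>) then ennreal (dist (h \<omega>) q) else 0"
    have "(SUP q\<in>D. ?g q) = (SUP q\<in>D \<inter> voronoi_cell (X \<omega>) (h \<omega>). ennreal (dist (h \<omega>) q))"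
    proof (intro antisym SUP_least)
      fix q assume "q \<in> D"
      then show "?g q \<le> (SUP q\<in>D \<inter> voronoi_cell (X \<omega>) (h \<omega>). ennreal (dist (h \<omega>) q))"
        by (cases "q \<in> voronoi_cell (X \<omega>) (h \<omega>)") (auto intro: SUP_upper)
    next
      fix q assume q: "q \<in> D \<inter> voronoi_cell (X \<omega>) (h \<omega>)"
      then have "?g q \<le> (SUP q\<in>D. ?g q)"
        by (intro SUP_upper) auto
      then show "ennreal (dist (h \<omega>) q) \<le> (SUP q\<in>D. ?g q)"
        using q by (simp only: Int_iff if_True)
    qed
    then show "(SUP q\<in>D. if q \<in> voronoi_cell (X \<omega>) (h \<omega>) then ennreal (dist (h \<omega>) q) else 0) =
       circumscribed_radius (X \<omega>) (h \<omega>)"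
      using circumscribed_radius_eq_SUP[OF locally_finite_X[OF \<omega>] D(2)] by simp
  qed
  finally show ?thesis .
qed

lemma measurable_min_circumscribed_radius:
  assumes W: "W \<in> sets borel"
  shows "(\<lambda>\<omega>. min_circumscribed_radius W (X \<omega>)) \<in> borel_measurable M"
proof -
  have "(\<lambda>\<omega>. INF Q\<in>isolating_sets. if card (X \<omega> \<inter> Q) = 1 \<and> isolated_point Q \<omega> \<in> W
      then circumscribed_radius (X \<omega>) (isolated_point Q \<omega>) else top) \<in> borel_measurable M"
  proof (intro borel_measurable_INF isolating_sets_basis(1))
    fix Q :: "'a set" assume Q: "Q \<in> isolating_sets"
    note [measurable] = measurable_isolated_point[OF isolating_sets_borel[OF Q] isolating_sets_basis(3)[OF Q]]
      pred_count[OF isolating_sets_borel[OF Q] isolating_sets_basis(3)[OF Q]]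
      measurable_circumscribed_radius[OF measurable_isolated_point[OF isolating_sets_borel[OF Q] isolating_sets_basis(3)[OF Q]]] W
    show "(\<lambda>\<omega>. if card (X \<omega> \<inter> Q) = 1 \<and> isolated_point Q \<omega> \<in> W
      then circumscribed_radius (X \<omega>) (isolated_point Q \<omega>) else top) \<in> borel_measurable M"
      by measurable
  qed
  also have "?this \<longleftrightarrow> ?thesis"
  proof (rule measurable_cong)
    fix \<omega> assume \<omega>: "\<omega> \<in> space M"
    let ?g = "\<lambda>Q. if card (X \<omega> \<inter> Q) = 1 \<and> isolated_point Q \<omega> \<in> W
      then circumscribed_radius (X \<omega>) (isolated_point Q \<omega>) else top"
    let ?m = "INF Q\<in>isolating_sets. ?g Q"
    have lower: "?m \<le> ?g Q" if "Q \<in> isolating_sets" for Q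
      using that by (rule INF_lower)
    have "\<forall>x\<in>X \<omega>. x \<in> W \<longrightarrow> ?m \<le> circumscribed_radius (X \<omega>) x"
      unfolding ball_X_iff[OF \<omega>]
    proof (intro ballI impI)
      fix Q assume Q: "Q \<in> isolating_sets" "card (X \<omega> \<inter> Q) = 1" "isolated_point Q \<omega> \<in> W"
      show "?m \<le> circumscribed_radius (X \<omega>) (isolated_point Q \<omega>)"
        using lower[OF Q(1)] Q(2,3) by (simp only: simp_thms if_True)
    qed
    then have "?m \<le> min_circumscribed_radius W (X \<omega>)"
      unfolding min_circumscribed_radius_def by (auto intro!: INF_greatest)
    moreover have "\<forall>x\<in>X \<omega>. x \<in> W \<longrightarrow> min_circumscribed_radius W (X \<omega>) \<le> circumscribed_radius (X \<omega>) x"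
      unfolding min_circumscribed_radius_def by (auto intro!: INF_lower)
    then have radius: "\<forall>Q\<in>isolating_sets. card (X \<omega> \<inter> Q) = 1 \<longrightarrow> isolated_point Q \<omega> \<in> W \<longrightarrow>
        min_circumscribed_radius W (X \<omega>) \<le> circumscribed_radius (X \<omega>) (isolated_point Q \<omega>)"
      unfolding ball_X_iff[OF \<omega>] .
    have "min_circumscribed_radius W (X \<omega>) \<le> ?m"
    proof (rule INF_greatest)
      fix Q :: "'a set" assume "Q \<in> isolating_sets"
      then show "min_circumscribed_radius W (X \<omega>) \<le> ?g Q"
        using radius by (cases "card (X \<omega> \<inter> Q) = 1 \<and> isolated_point Q \<omega> \<in> W") auto
    qed
    ultimately show "?m = min_circumscribed_radius W (X \<omega>)" by (rule antisym)
  qed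
  finally show ?thesis .
qed

text \<open>
  The event under consideration is measurable for every \<open>\<sigma>\<close>-algebra that makes the counts in bounded Borel
  sets measurable. This cannot be bypassed, since \<^const>\<open>measure\<close> vanishes on non-measurable sets.
\<close>

lemma pred_minimal_cells_simplices:
  assumes W: "W \<in> sets borel"
  shows "Measurable.pred M (\<lambda>\<omega>. \<forall>x\<in>X \<omega>. circumscribed_radius (X \<omega>) x = min_circumscribed_radius W (X \<omega>)
    \<longrightarrow> num_hyperfaces (voronoi_cell (X \<omega>) x) = DIM('a) + 1)"
proof (rule pred_ball_X)
  fix h :: "'w \<Rightarrow> 'a" assume h: "h \<in> borel_measurable M"
  note [measurable] = measurable_circumscribed_radius[OF h] measurable_min_circumscribed_radius[OF W]
    pred_card_voronoi_neighbours[OF h, of "DIM('a) + 1"]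
  have "Measurable.pred M (\<lambda>\<omega>. circumscribed_radius (X \<omega>) (h \<omega>) = min_circumscribed_radius W (X \<omega>)
    \<longrightarrow> card (voronoi_neighbours (X \<omega>) (h \<omega>)) = DIM('a) + 1)"
    by measurable
  then show "Measurable.pred M (\<lambda>\<omega>. circumscribed_radius (X \<omega>) (h \<omega>) = min_circumscribed_radius W (X \<omega>)
    \<longrightarrow> num_hyperfaces (voronoi_cell (X \<omega>) (h \<omega>)) = DIM('a) + 1)"
    by (rule measurable_cong[THEN iffD1, rotated]) (simp add: num_hyperfaces_voronoi_cell locally_finite_X)
qed

end

section \<open>Tuples with equal sphere radii\<close>

lemma emeasure_lborel_scaleR_vimage:
  fixes A :: "'a::euclidean_space set"
  assumes "0 < c" "A \<in> sets borel"
  shows "emeasure lborel A = ennreal (c ^ DIM('a)) * emeasure lborel ((\<lambda>x. c *\<^sub>R x) -` A)"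
proof -
  have "emeasure lborel A = emeasure (density (distr lborel borel (\<lambda>x. 0 + c *\<^sub>R x)) (\<lambda>_. \<bar>c\<bar> ^ DIM('a))) A"
    using lborel_affine[of c "0::'a"] assms by simp
  also have "\<dots> = ennreal (c ^ DIM('a)) * emeasure lborel ((\<lambda>x. c *\<^sub>R x) -` A)"
    using assms by (simp add: emeasure_density emeasure_distr nn_integral_cmult_indicator)
  finally show ?thesis .
qed

lemma measurable_sphere_radius:
  assumes "0 < n" "s + n \<le> k"
  shows "(\<lambda>f. sphere_radius n (\<lambda>i. f (s + i))) \<in>
    borel_measurable (PiM {..<k} (\<lambda>_. lborel :: 'a::euclidean_space measure))"
proof (rule borel_measurableI_le)
  fix y :: ennreal
  let ?L = "PiM {..<k} (\<lambda>_. lborel :: 'a measure)"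
  show "{f \<in> space ?L. sphere_radius n (\<lambda>i. f (s + i)) \<le> y} \<in> sets ?L"
  proof (cases y)
    case (real c)
    obtain D :: "'a set" where D: "countable D" "closure D = UNIV"
      using dense_countable_set by blast
    have *: "Measurable.pred ?L (\<lambda>f. \<forall>m::nat. \<exists>q\<in>D. dist q (f (s + 0)) < c + 1 / Suc m \<and>
        (\<forall>i\<in>{..<n}. \<bar>dist q (f (s + i)) - dist q (f (s + 0))\<bar> < 1 / Suc m))"
    proof (rule pred_intros_countable(1), rule measurable_pred_countable(2)[OF D(1)], rule pred_intros_logic(3))
      fix m :: nat and q :: 'a
      have comp: "(\<lambda>f. f (s + i)) \<in> borel_measurable ?L" if "i < n" for i
        using measurable_component_singleton[of "s + i" "{..<k}" "\<lambda>_. lborel :: 'a measure"] that assms by simp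
      note [measurable] = comp[of 0]
      show "Measurable.pred ?L (\<lambda>f. dist q (f (s + 0)) < c + 1 / Suc m)"
        using assms by measurable
      show "Measurable.pred ?L (\<lambda>f. \<forall>i\<in>{..<n}. \<bar>dist q (f (s + i)) - dist q (f (s + 0))\<bar> < 1 / Suc m)"
      proof (rule measurable_pred_countable(1))
        fix i assume "i \<in> {..<n}"
        then have [measurable]: "(\<lambda>f. f (s + i)) \<in> borel_measurable ?L"
          using comp by simp
        show "Measurable.pred ?L (\<lambda>f. \<bar>dist q (f (s + i)) - dist q (f (s + 0))\<bar> < 1 / Suc m)"
          using assms by measurable
      qed simp
    qed
    show ?thesis
      using * unfolding real(2) sphere_radius_le_iff[OF real(1) D(2)] pred_def Ball_def lessThan_iff .
  qed simp
qed

lemma sphere_radius_cong: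
  assumes "\<And>i. i < n \<Longrightarrow> f i = g i" "0 < n"
  shows "sphere_radius n f = sphere_radius n g"
proof -
  have f0: "f 0 = g 0" using assms by blast
  have "(\<forall>i<n. dist z (f i) = dist z (f 0)) \<longleftrightarrow> (\<forall>i<n. dist z (g i) = dist z (g 0))" for z
    using assms by metis
  then have *: "{z. \<forall>i<n. dist z (f i) = dist z (f 0)} = {z. \<forall>i<n. dist z (g i) = dist z (g 0)}"
    by blast
  show ?thesis
    unfolding sphere_radius_def by (rule INF_cong[OF *]) (simp only: f0)
qed

interpretation lborel_product: product_sigma_finite "\<lambda>_::nat. lborel :: 'a::euclidean_space measure"
  by standard

text \<open>
  For \<open>c > 0\<close>, let \<open>N c\<close> be the set of \<open>2 * n\<close>-tuples whose second half has \<open>c\<close> times the sphere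
  radius of its first half, the latter being positive and finite. These sets are disjoint, so by \<open>\<sigma>\<close>-finiteness all but countably many of them are null
  sets. Dilating the second half by \<open>c\<close> maps \<open>N 1\<close> into \<open>N c\<close> and multiplies Lebesgue measure by a constant,
  so \<open>N 1\<close> is a null set as well.
\<close>

lemma null_sets_equal_sphere_radii:
  assumes n: "0 < n"
  defines "L \<equiv> PiM {..<2 * n} (\<lambda>_. lborel :: 'a::euclidean_space measure)"
  shows "{f \<in> space L. sphere_radius n (\<lambda>i. f (n + i)) = sphere_radius n f \<and>
    0 < sphere_radius n f \<and> sphere_radius n f < \<infinity>} \<in> null_sets L"
proof -
  define r where "r f = sphere_radius n (\<lambda>i. f (0 + i))" for f :: "nat \<Rightarrow> 'a"
  define r' where "r' f = sphere_radius n (\<lambda>i. f (n + i))" for f :: "nat \<Rightarrow> 'a"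
  have [measurable]: "r \<in> borel_measurable L" "r' \<in> borel_measurable L"
    using measurable_sphere_radius[OF n, of 0 "2 * n"] measurable_sphere_radius[OF n, of n "2 * n"]
    by (simp_all add: r_def[abs_def] r'_def[abs_def] L_def)
  define N where "N c = {f \<in> space L. r' f = ennreal c * r f \<and> 0 < r f \<and> r f < \<infinity>}" for c
  have N_sets [measurable]: "N c \<in> sets L" for c
  proof -
    have [measurable]: "(\<lambda>f. ennreal c * r f) \<in> borel_measurable L" by measurable
    have "{f \<in> space L. r' f = ennreal c * r f} \<in> sets L"
      by (rule borel_measurable_eq) measurable
    moreover have "{f \<in> space L. 0 < r f \<and> r f < \<infinity>} \<in> sets L"
      by measurable
    moreover have "N c = {f \<in> space L. r' f = ennreal c * r f} \<inter> {f \<in> space L. 0 < r f \<and> r f < \<infinity>}"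
      by (auto simp: N_def)
    ultimately show ?thesis by (simp only: sets.Int)
  qed
  interpret sigma_finite_measure L
    unfolding L_def by (rule lborel_product.sigma_finite) simp
  obtain h where h: "h \<in> borel_measurable L" "integral\<^sup>N L h \<noteq> \<infinity>" "\<forall>f\<in>space L. 0 < h f \<and> h f < \<infinity>"
    using Ex_finite_integrable_function by blast
  note [measurable] = h(1)
  define g where "g f = enn2real (r' f) / enn2real (r f)" for f
  have [measurable]: "g \<in> borel_measurable L"
    unfolding g_def by measurable
  \<comment> \<open>\<open>h\<close> replaces \<open>L\<close> by a finite measure with the same null sets; \<open>P\<close> is then the law of the ratio \<open>g\<close>, which has only countably many atoms\<close>
  define P where "P = distr (density L h) borel g"
  have "finite_measure (density L h)"
    using h(2) by (intro finite_measureI) (simp add: emeasure_density cong: nn_integral_cong)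
  then interpret P: finite_measure P
    unfolding P_def by (rule finite_measure.finite_measure_distr) simp
  have "uncountable {0<..<1::real}"
    by (rule uncountable_open_interval[THEN iffD2]) simp
  then obtain c where c: "0 < c" "measure P {c} = 0"
    using P.countable_support countable_subset[of "{0<..<1::real}" "{x. measure P {x} \<noteq> 0}"] by fastforce
  have "emeasure (density L h) (N c) \<le> emeasure (density L h) (g -` {c} \<inter> space L)"
  proof (rule emeasure_mono)
    show "N c \<subseteq> g -` {c} \<inter> space L"
    proof
      fix f assume f: "f \<in> N c"
      then obtain x where x: "r f = ennreal x" "0 \<le> x"
        by (cases "r f") (auto simp: N_def)
      with f have "0 < x" by (auto simp: N_def)
      then show "f \<in> g -` {c} \<inter> space L"
        using f x c(1) by (simp add: N_def g_def enn2real_mult)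
    qed
  qed simp
  also have "\<dots> = emeasure P {c}"
    by (simp add: P_def emeasure_distr)
  also have "\<dots> = 0"
    using c(2) by (simp add: P.emeasure_eq_measure)
  finally have "N c \<in> null_sets (density L h)"
    by (auto intro!: null_setsI)
  then have "AE f in L. f \<in> N c \<longrightarrow> h f = 0"
    by (simp add: null_sets_density_iff)
  with AE_space have "AE f in L. f \<notin> N c"
    by eventually_elim (use h(3) in force)
  then have Nc: "emeasure L (N c) = 0"
    using N_sets[of c] by (simp add: AE_iff_null_sets null_setsD1)
  define T where "T f = (\<lambda>i\<in>{..<2 * n}. if i < n then f i else c *\<^sub>R f i)" for f :: "nat \<Rightarrow> 'a"
  have comp: "(\<lambda>f. f i) \<in> borel_measurable L" if "i < 2 * n" for i
    using measurable_component_singleton[of i "{..<2 * n}" "\<lambda>_. lborel :: 'a measure"] that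
    by (simp add: L_def)
  have T: "T \<in> measurable L L"
    unfolding T_def L_def[symmetric]
    by (subst (2) L_def, rule measurable_restrict) (use comp in \<open>auto split: if_splits\<close>)
  define C where "C = (\<Prod>i<2 * n. if i < n then 1 else ennreal (c ^ DIM('a)))"
  have "C \<noteq> 0" using c(1) by (auto simp: C_def)
  have "scale_measure C (distr L L T) = L"
    unfolding L_def
  proof (rule lborel_product.PiM_eqI)
    fix A :: "nat \<Rightarrow> 'a set" assume A: "\<And>i. i \<in> {..<2 * n} \<Longrightarrow> A i \<in> sets lborel"
    define B where "B i = (if i < n then A i else (\<lambda>x. c *\<^sub>R x) -` A i)" for i
    have B: "B i \<in> sets borel" if "i < 2 * n" for i
      using A[of i] that measurable_sets[of "\<lambda>x. c *\<^sub>R x" borel borel "A i"] by (simp add: B_def)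
    have eqB: "emeasure lborel (A i) = (if i < n then 1 else ennreal (c ^ DIM('a))) * emeasure lborel (B i)"
      if "i < 2 * n" for i
      using A[of i] that c(1) by (simp add: B_def emeasure_lborel_scaleR_vimage)
    have "T -` (Pi\<^sub>E {..<2 * n} A) \<inter> space L = Pi\<^sub>E {..<2 * n} B"
    proof (rule set_eqI)
      fix f
      have "T f \<in> Pi\<^sub>E {..<2 * n} A \<longleftrightarrow> (\<forall>i<2 * n. f i \<in> B i)"
        unfolding T_def restrict_PiE_iff by (auto simp: B_def)
      moreover have "f \<in> space L \<longleftrightarrow> f \<in> extensional {..<2 * n}"
        by (simp add: L_def space_PiM PiE_iff)
      ultimately show "f \<in> T -` (Pi\<^sub>E {..<2 * n} A) \<inter> space L \<longleftrightarrow> f \<in> Pi\<^sub>E {..<2 * n} B"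
        by (simp add: PiE_iff) blast
    qed
    then have "emeasure (distr L L T) (Pi\<^sub>E {..<2 * n} A) = emeasure L (Pi\<^sub>E {..<2 * n} B)"
      using A by (subst emeasure_distr[OF T]) (auto simp: L_def intro!: sets_PiM_I_finite)
    also have "\<dots> = (\<Prod>i<2 * n. emeasure lborel (B i))"
      unfolding L_def using B by (intro lborel_product.emeasure_PiM) auto
    finally show "emeasure (scale_measure C (distr (Pi\<^sub>M {..<2 * n} (\<lambda>_. lborel)) (Pi\<^sub>M {..<2 * n} (\<lambda>_. lborel)) T)) (Pi\<^sub>E {..<2 * n} A) =
        (\<Prod>i<2 * n. emeasure lborel (A i))"
      using eqB by (simp add: L_def[symmetric] C_def prod.distrib[symmetric])
  qed simp_all
  then have "C * emeasure L (T -` N c \<inter> space L) = emeasure L (N c)"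
    using emeasure_distr[OF T N_sets[of c]] by (metis emeasure_scale_measure)
  then have null: "emeasure L (T -` N c \<inter> space L) = 0"
    using Nc \<open>C \<noteq> 0\<close> by simp
  have sub: "N 1 \<subseteq> T -` N c \<inter> space L"
  proof
    fix f assume f: "f \<in> N 1"
    then have fL: "f \<in> space L" by (simp add: N_def)
    have "r (T f) = r f"
      unfolding r_def using n by (intro sphere_radius_cong) (auto simp: T_def)
    moreover have "r' (T f) = sphere_radius n (\<lambda>i. c *\<^sub>R f (n + i))"
      unfolding r'_def using n by (intro sphere_radius_cong) (auto simp: T_def)
    then have "r' (T f) = ennreal c * r' f"
      using sphere_radius_scaleR[OF c(1), of n "\<lambda>i. f (n + i)"] by (simp add: r'_def)
    ultimately show "f \<in> T -` N c \<inter> space L"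
      using f fL measurable_space[OF T fL] by (simp add: N_def)
  qed
  have "N 1 \<in> null_sets L"
    by (rule null_sets_subset[OF null_setsI[OF null]]) (use sub T in \<open>auto intro: measurable_sets\<close>)
  then show ?thesis
    by (simp add: N_def r_def r'_def)
qed

section \<open>Tuples of points of a Poisson process\<close>

lemma disjoint_isolating_sets:
  assumes lf: "locally_finite_set \<eta>" and inj: "inj_on f {..<k::nat}" and sub: "f ` {..<k} \<subseteq> \<eta>"
  shows "\<exists>Q\<in>Pi\<^sub>E {..<k} (\<lambda>_. isolating_sets). disjoint_family_on Q {..<k} \<and> (\<forall>i<k. \<eta> \<inter> Q i = {f i})"
proof -
  define S where "S = insert 1 ((\<lambda>(i, j). dist (f i) (f j)) ` ({..<k} \<times> {..<k} - Id))"
  define \<delta> where "\<delta> = Min S"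
  have "finite S" "S \<noteq> {}" by (auto simp: S_def)
  have "\<And>x. x \<in> S \<Longrightarrow> 0 < x"
    using inj by (auto simp: S_def inj_on_def)
  then have "0 < \<delta>"
    using \<open>finite S\<close> \<open>S \<noteq> {}\<close> by (simp add: \<delta>_def)
  have dist: "\<delta> \<le> dist (f i) (f j)" if "i < k" "j < k" "i \<noteq> j" for i j
    unfolding \<delta>_def using that by (intro Min_le \<open>finite S\<close>) (auto simp: S_def intro!: image_eqI[of _ _ "(i, j)"])
  have "\<exists>Q\<in>isolating_sets. Q \<subseteq> ball (f i) (\<delta> / 2) \<and> \<eta> \<inter> Q = {f i}" if "i < k" for i
    using that sub \<open>0 < \<delta>\<close> by (intro isolating_set_exists lf) auto
  then obtain Q where Q: "\<And>i. i < k \<Longrightarrow> Q i \<in> isolating_sets \<and> Q i \<subseteq> ball (f i) (\<delta> / 2) \<and> \<eta> \<inter> Q i = {f i}"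
    by metis
  have "Q i \<inter> Q j = {}" if "i < k" "j < k" "i \<noteq> j" for i j
  proof -
    have "ball (f i) (\<delta> / 2) \<inter> ball (f j) (\<delta> / 2) = {}"
      using dist[OF that] by (intro disjoint_ballI) simp
    then show ?thesis using Q[OF that(1)] Q[OF that(2)] by blast
  qed
  then show ?thesis
    using Q by (intro bexI[of _ "restrict Q {..<k}"]) (auto simp: disjoint_family_on_def)
qed

context poisson_process
begin

lemma prob_count:
  assumes "B \<in> sets borel" "bounded B"
  shows "prob {\<omega> \<in> space M. card (X \<omega> \<inter> B) = n} =
    exp (- (\<gamma> * measure lborel B)) * (\<gamma> * measure lborel B) ^ n / fact n"
  using poisson assms by (simp add: homogeneous_poisson_process_def)

lemma indep_counts_nat:
  fixes B :: "nat \<Rightarrow> 'a set"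
  assumes "\<And>i. i < n \<Longrightarrow> B i \<in> sets borel" "\<And>i. i < n \<Longrightarrow> bounded (B i)" "disjoint_family_on B {..<n}"
  shows "indep_vars (\<lambda>_. count_space UNIV) (\<lambda>i \<omega>. card (X \<omega> \<inter> B i)) {..<n}"
  using poisson assms by (simp add: homogeneous_poisson_process_def)

lemma indep_counts:
  assumes I: "finite I" and B: "\<And>i. i \<in> I \<Longrightarrow> B i \<in> sets borel" "\<And>i. i \<in> I \<Longrightarrow> bounded (B i)"
    and disj: "disjoint_family_on B I"
  shows "indep_vars (\<lambda>_. count_space UNIV) (\<lambda>i \<omega>. card (X \<omega> \<inter> B i)) I"
proof -
  obtain h where h: "bij_betw h {0..<card I} I"
    using ex_bij_betw_nat_finite[OF I] by blast
  define g where "g = inv_into {0..<card I} h"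
  have g: "g i < card I" "h (g i) = i" if "i \<in> I" for i
    using bij_betw_inv_into_right[OF h that] bij_betw_apply[OF bij_betw_inv_into[OF h] that]
    by (auto simp: g_def)
  have hI: "h j \<in> I" if "j < card I" for j
    using h that by (auto simp: bij_betw_def)
  have "disjoint_family_on (\<lambda>j. B (h j)) {..<card I}"
    unfolding disjoint_family_on_def
  proof (intro ballI impI)
    fix i j assume "i \<in> {..<card I}" "j \<in> {..<card I}" "i \<noteq> j"
    then have "h i \<noteq> h j" "h i \<in> I" "h j \<in> I"
      using hI bij_betw_imp_inj_on[OF h] by (auto dest: inj_onD)
    then show "B (h i) \<inter> B (h j) = {}"
      using disj by (auto simp: disjoint_family_on_def)
  qed
  then have "indep_vars (\<lambda>_. count_space UNIV) (\<lambda>j \<omega>. card (X \<omega> \<inter> B (h j))) {..<card I}"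
    by (intro indep_counts_nat) (use B hI in auto)
  then have "indep_vars (\<lambda>i. PiM {g i} (\<lambda>_. count_space UNIV))
      (\<lambda>i \<omega>. restrict (\<lambda>j. card (X \<omega> \<inter> B (h j))) {g i}) I"
    by (rule indep_vars_restrict) (use g in \<open>auto simp: disjoint_family_on_def, metis\<close>)
  then have "indep_vars (\<lambda>_. count_space UNIV)
      (\<lambda>i \<omega>. (\<lambda>f. f (g i)) (restrict (\<lambda>j. card (X \<omega> \<inter> B (h j))) {g i})) I"
    by (rule indep_vars_compose2) (rule measurable_component_singleton, simp)
  then show ?thesis
    using g by (subst indep_vars_cong[OF refl _ refl]) (auto simp: fun_eq_iff)
qed

lemma prob_counts:
  assumes I: "finite I" and B: "\<And>i. i \<in> I \<Longrightarrow> B i \<in> sets borel" "\<And>i. i \<in> I \<Longrightarrow> bounded (B i)"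
    and disj: "disjoint_family_on B I"
  shows "prob {\<omega> \<in> space M. \<forall>i\<in>I. card (X \<omega> \<inter> B i) \<in> N i} =
    (\<Prod>i\<in>I. prob {\<omega> \<in> space M. card (X \<omega> \<inter> B i) \<in> N i})"
proof (cases "I = {}")
  case False
  have eq: "(\<lambda>\<omega>. card (X \<omega> \<inter> B i)) -` N i \<inter> space M = {\<omega> \<in> space M. card (X \<omega> \<inter> B i) \<in> N i}" for i
    by auto
  have "{\<omega> \<in> space M. \<forall>i\<in>I. card (X \<omega> \<inter> B i) \<in> N i} =
      (\<Inter>i\<in>I. (\<lambda>\<omega>. card (X \<omega> \<inter> B i)) -` N i \<inter> space M)"
    using False by auto
  then show ?thesis
    using indep_varsD_finite[OF indep_counts[OF I B disj] False I, of N] by (simp add: eq)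
qed (simp add: prob_space)

end

lemma measurable_prod_indicator:
  fixes Q :: "nat \<Rightarrow> 'a::euclidean_space set" and c :: "nat \<Rightarrow> ennreal"
  assumes "\<And>i. i < k \<Longrightarrow> Q i \<in> sets borel"
  shows "(\<lambda>f. \<Prod>i<k. c i * indicator (Q i) (f i)) \<in> borel_measurable (PiM {..<k} (\<lambda>_. lborel))"
proof (rule borel_measurable_prod_ennreal)
  fix i assume i: "i \<in> {..<k}"
  then have "(\<lambda>f. f i) \<in> PiM {..<k} (\<lambda>_. lborel :: 'a measure) \<rightarrow>\<^sub>M lborel"
    by (rule measurable_component_singleton)
  moreover have [measurable]: "Q i \<in> sets borel"
    using assms i by simp
  have "(\<lambda>x. c i * indicator (Q i) x) \<in> borel_measurable lborel"
    by measurable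
  ultimately show "(\<lambda>f. c i * indicator (Q i) (f i)) \<in> borel_measurable (PiM {..<k} (\<lambda>_. lborel))"
    by (rule measurable_compose)
qed

lemma emeasure_density_product_PiE:
  fixes Q A :: "nat \<Rightarrow> 'a::euclidean_space set" and c :: "nat \<Rightarrow> ennreal"
  assumes Q: "\<And>i. i < k \<Longrightarrow> Q i \<in> sets borel" and A: "\<And>i. i < k \<Longrightarrow> A i \<in> sets borel"
  shows "emeasure (density (PiM {..<k} (\<lambda>_. lborel)) (\<lambda>f. \<Prod>i<k. c i * indicator (Q i) (f i))) (Pi\<^sub>E {..<k} A) =
    (\<Prod>i<k. c i * emeasure lborel (Q i \<inter> A i))"
proof -
  let ?L = "PiM {..<k} (\<lambda>_. lborel :: 'a measure)"
  have "(\<lambda>f. \<Prod>i<k. c i * indicator (Q i) (f i)) \<in> borel_measurable ?L"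
    using Q by (rule measurable_prod_indicator)
  moreover have "Pi\<^sub>E {..<k} A \<in> sets ?L"
    using A by (intro sets_PiM_I_finite) auto
  ultimately have "emeasure (density ?L (\<lambda>f. \<Prod>i<k. c i * indicator (Q i) (f i))) (Pi\<^sub>E {..<k} A) =
      (\<integral>\<^sup>+f. (\<Prod>i<k. c i * indicator (Q i) (f i)) * indicator (Pi\<^sub>E {..<k} A) f \<partial>?L)"
    by (rule emeasure_density)
  also have "\<dots> = (\<integral>\<^sup>+f. (\<Prod>i<k. c i * indicator (Q i \<inter> A i) (f i)) \<partial>?L)"
  proof (rule nn_integral_cong)
    fix f assume f: "f \<in> space ?L"
    show "(\<Prod>i<k. c i * indicator (Q i) (f i)) * indicator (Pi\<^sub>E {..<k} A) f =
        (\<Prod>i<k. c i * indicator (Q i \<inter> A i) (f i))"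
    proof (cases "f \<in> Pi\<^sub>E {..<k} A")
      case True
      then have "f i \<in> A i" if "i < k" for i using that by auto
      then show ?thesis
        using True by (auto intro!: prod.cong simp: indicator_def)
    next
      case False
      then obtain i where "i < k" "f i \<notin> A i"
        using f by (auto simp: space_PiM PiE_iff)
      then have "(\<Prod>i<k. c i * indicator (Q i \<inter> A i) (f i)) = 0"
        by (intro prod_zero bexI[of _ i]) auto
      then show ?thesis using False by simp
    qed
  qed
  also have "\<dots> = (\<Prod>i<k. \<integral>\<^sup>+x. c i * indicator (Q i \<inter> A i) x \<partial>lborel)"
  proof (rule lborel_product.product_nn_integral_prod)
    fix i assume "i \<in> {..<k}"
    then have [measurable]: "Q i \<inter> A i \<in> sets borel" using Q A by auto
    show "(\<lambda>x. c i * indicator (Q i \<inter> A i) x) \<in> borel_measurable lborel" by measurable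
  qed simp
  also have "\<dots> = (\<Prod>i<k. c i * emeasure lborel (Q i \<inter> A i))"
    using Q A by (intro prod.cong) (auto intro!: nn_integral_cmult_indicator)
  finally show ?thesis .
qed

context poisson_process
begin

lemma card_isolated_point_mem_iff:
  assumes \<omega>: "\<omega> \<in> space M" and Q: "bounded Q"
  shows "card (X \<omega> \<inter> Q) = 1 \<and> isolated_point Q \<omega> \<in> A \<longleftrightarrow>
    card (X \<omega> \<inter> (Q \<inter> A)) = 1 \<and> card (X \<omega> \<inter> (Q - A)) = 0"
proof
  assume *: "card (X \<omega> \<inter> Q) = 1 \<and> isolated_point Q \<omega> \<in> A"
  then obtain x where x: "X \<omega> \<inter> Q = {x}"
    unfolding One_nat_def card_1_singleton_iff by blast
  then have "x \<in> A" using * isolated_point_eq[OF x] by simp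
  then have "X \<omega> \<inter> (Q \<inter> A) = {x}" "X \<omega> \<inter> (Q - A) = {}" using x by auto
  then show "card (X \<omega> \<inter> (Q \<inter> A)) = 1 \<and> card (X \<omega> \<inter> (Q - A)) = 0" by simp
next
  assume *: "card (X \<omega> \<inter> (Q \<inter> A)) = 1 \<and> card (X \<omega> \<inter> (Q - A)) = 0"
  then obtain x where x: "X \<omega> \<inter> (Q \<inter> A) = {x}"
    unfolding One_nat_def card_1_singleton_iff by blast
  have "finite (X \<omega> \<inter> (Q - A))"
    using finite_X_Int[OF \<omega> Q] by (rule finite_subset[rotated]) auto
  then have "X \<omega> \<inter> (Q - A) = {}" using * by simp
  then have "X \<omega> \<inter> Q = {x}" "x \<in> A" using x by auto
  then show "card (X \<omega> \<inter> Q) = 1 \<and> isolated_point Q \<omega> \<in> A"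
    using isolated_point_eq[of \<omega> Q x] by simp
qed

text \<open>
  Splitting every set \<open>Q i\<close> into \<open>Q i \<inter> A i\<close> and \<open>Q i - A i\<close> reduces the event to \<open>2 * k\<close> independent
  Poisson counts.
\<close>

lemma prob_isolated_points_mem:
  assumes Q: "\<And>i. i < k \<Longrightarrow> Q i \<in> sets borel" "\<And>i. i < k \<Longrightarrow> bounded (Q i)" "disjoint_family_on Q {..<k::nat}"
    and A: "\<And>i. i < k \<Longrightarrow> A i \<in> sets borel"
  shows "prob {\<omega> \<in> space M. \<forall>i<k. card (X \<omega> \<inter> Q i) = 1 \<and> isolated_point (Q i) \<omega> \<in> A i} =
    (\<Prod>i<k. \<gamma> * exp (- (\<gamma> * measure lborel (Q i))) * measure lborel (Q i \<inter> A i))"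
proof -
  \<comment> \<open>the part of \<open>Q i\<close> inside \<open>A i\<close> must contain one point, the part outside none\<close>
  define B where "B p = (if snd p then Q (fst p) \<inter> A (fst p) else Q (fst p) - A (fst p))" for p :: "nat \<times> bool"
  define m where "m p = (if snd p then 1 else 0 :: nat)" for p :: "nat \<times> bool"
  have sets: "B p \<in> sets borel" "bounded (B p)" if "p \<in> {..<k} \<times> UNIV" for p
    using that Q(1,2) A by (auto simp: B_def bounded_Int bounded_diff)
  have disj: "disjoint_family_on B ({..<k} \<times> UNIV)"
    unfolding disjoint_family_on_def
  proof (intro ballI impI)
    fix p q assume pq: "p \<in> {..<k} \<times> (UNIV :: bool set)" "q \<in> {..<k} \<times> (UNIV :: bool set)" "p \<noteq> q"
    show "B p \<inter> B q = {}"
    proof (cases "fst p = fst q")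
      case True
      then have "snd p \<noteq> snd q" using pq(3) by (simp add: prod_eq_iff)
      then show ?thesis using True by (auto simp: B_def)
    next
      case False
      then have "Q (fst p) \<inter> Q (fst q) = {}"
        using disjoint_family_onD[OF Q(3), of "fst p" "fst q"] pq by auto
      then show ?thesis by (auto simp: B_def)
    qed
  qed
  have event: "(\<forall>i<k. card (X \<omega> \<inter> Q i) = 1 \<and> isolated_point (Q i) \<omega> \<in> A i) \<longleftrightarrow>
      (\<forall>p\<in>{..<k} \<times> UNIV. card (X \<omega> \<inter> B p) \<in> {m p})" if "\<omega> \<in> space M" for \<omega>
    using card_isolated_point_mem_iff[OF that Q(2)] by (auto simp: B_def m_def)
  have factor: "(\<Prod>b\<in>UNIV. prob {\<omega> \<in> space M. card (X \<omega> \<inter> B (i, b)) \<in> {m (i, b)}}) =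
      \<gamma> * exp (- (\<gamma> * measure lborel (Q i))) * measure lborel (Q i \<inter> A i)" if "i < k" for i
  proof -
    have "emeasure lborel (B p) \<noteq> \<infinity>" if "p \<in> {..<k} \<times> UNIV" for p
      using emeasure_bounded_finite[OF sets(2)[OF that]] by simp
    from this[of "(i, True)"] this[of "(i, False)"]
    have "measure lborel ((Q i \<inter> A i) \<union> (Q i - A i)) = measure lborel (Q i \<inter> A i) + measure lborel (Q i - A i)"
      using that Q(1) A by (intro measure_Union) (auto simp: B_def)
    then have "measure lborel (Q i) = measure lborel (Q i \<inter> A i) + measure lborel (Q i - A i)"
      by (simp add: Int_Diff_Un)
    then have "exp (- (\<gamma> * measure lborel (Q i))) =
        exp (- (\<gamma> * measure lborel (Q i \<inter> A i))) * exp (- (\<gamma> * measure lborel (Q i - A i)))"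
      by (simp add: exp_add[symmetric] algebra_simps)
    then show ?thesis
      using prob_count[OF sets[of "(i, True)"], of 1] prob_count[OF sets[of "(i, False)"], of 0] that
      by (simp add: UNIV_bool B_def m_def)
  qed
  have "{\<omega> \<in> space M. \<forall>i<k. card (X \<omega> \<inter> Q i) = 1 \<and> isolated_point (Q i) \<omega> \<in> A i} =
      {\<omega> \<in> space M. \<forall>p\<in>{..<k} \<times> UNIV. card (X \<omega> \<inter> B p) \<in> {m p}}"
    using event by (intro Collect_cong conj_cong refl)
  then have "prob {\<omega> \<in> space M. \<forall>i<k. card (X \<omega> \<inter> Q i) = 1 \<and> isolated_point (Q i) \<omega> \<in> A i} =
      (\<Prod>p\<in>{..<k} \<times> UNIV. prob {\<omega> \<in> space M. card (X \<omega> \<inter> B p) \<in> {m p}})"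
    using prob_counts[OF _ sets disj, of "\<lambda>p. {m p}"] by simp
  also have "\<dots> = (\<Prod>i<k. \<Prod>b\<in>UNIV. prob {\<omega> \<in> space M. card (X \<omega> \<inter> B (i, b)) \<in> {m (i, b)}})"
    by (subst prod.cartesian_product) (rule prod.cong, auto)
  also have "\<dots> = (\<Prod>i<k. \<gamma> * exp (- (\<gamma> * measure lborel (Q i))) * measure lborel (Q i \<inter> A i))"
    by (rule prod.cong[OF refl], rule factor) simp
  finally show ?thesis .
qed

text \<open>
  On the event that every \<open>Q i\<close> contains exactly one point, the tuple of these points is distributed with a
  density with respect to Lebesgue measure.
\<close>

lemma AE_isolated_points_notin_null_set:
  assumes \<gamma>: "0 < \<gamma>"
    and Q: "\<And>i. i < k \<Longrightarrow> Q i \<in> sets borel" "\<And>i. i < k \<Longrightarrow> bounded (Q i)" "disjoint_family_on Q {..<k::nat}"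
    and N: "N \<in> null_sets (PiM {..<k} (\<lambda>_. lborel))"
  shows "AE \<omega> in M. (\<forall>i<k. card (X \<omega> \<inter> Q i) = 1) \<longrightarrow> (\<lambda>i\<in>{..<k}. isolated_point (Q i) \<omega>) \<notin> N"
proof -
  let ?L = "PiM {..<k} (\<lambda>_. lborel :: 'a measure)"
  define T where "T \<omega> = (\<lambda>i\<in>{..<k}. isolated_point (Q i) \<omega>)" for \<omega>
  define E where "E = {\<omega> \<in> space M. \<forall>i\<in>{..<k}. card (X \<omega> \<inter> Q i) = 1}"
  define \<nu> where "\<nu> = distr (density M (indicator E)) ?L T"
  define c where "c i = ennreal (\<gamma> * exp (- (\<gamma> * measure lborel (Q i))))" for i
  have T: "T \<in> M \<rightarrow>\<^sub>M ?L"
    unfolding T_def using Q by (intro measurable_restrict) (simp add: measurable_isolated_point)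
  have E: "E \<in> sets M"
    unfolding E_def pred_def[symmetric] using Q by (intro measurable_pred_countable(1) pred_count) auto
  have \<nu>: "emeasure \<nu> A = emeasure M (T -` A \<inter> E)" if "A \<in> sets ?L" for A
  proof -
    have "emeasure \<nu> A = emeasure (density M (indicator E)) (T -` A \<inter> space M)"
      unfolding \<nu>_def using T that by (subst emeasure_distr) auto
    also have "\<dots> = emeasure M (E \<inter> (T -` A \<inter> space M))"
      using E measurable_sets[OF T that]
      by (subst emeasure_density) (auto simp: indicator_inter_arith[symmetric])
    also have "E \<inter> (T -` A \<inter> space M) = T -` A \<inter> E"
      by (auto simp: E_def)
    finally show ?thesis .
  qed
  have "\<nu> = density ?L (\<lambda>f. \<Prod>i<k. c i * indicator (Q i) (f i))"
  proof (rule measure_eqI_PiM_finite)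
    fix A :: "nat \<Rightarrow> 'a set" assume A: "\<And>i. i \<in> {..<k} \<Longrightarrow> A i \<in> sets lborel"
    then have A': "A i \<in> sets borel" if "i < k" for i using that by simp
    have "T -` (Pi\<^sub>E {..<k} A) \<inter> E =
        {\<omega> \<in> space M. \<forall>i<k. card (X \<omega> \<inter> Q i) = 1 \<and> isolated_point (Q i) \<omega> \<in> A i}"
      by (auto simp: T_def E_def restrict_PiE_iff)
    moreover have "Pi\<^sub>E {..<k} A \<in> sets ?L"
      using A by (intro sets_PiM_I_finite) auto
    ultimately have "emeasure \<nu> (Pi\<^sub>E {..<k} A) =
        ennreal (\<Prod>i<k. \<gamma> * exp (- (\<gamma> * measure lborel (Q i))) * measure lborel (Q i \<inter> A i))"
      using prob_isolated_points_mem[OF Q A'] by (simp add: \<nu> emeasure_eq_measure)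
    also have "\<dots> = (\<Prod>i<k. ennreal (\<gamma> * exp (- (\<gamma> * measure lborel (Q i))) * measure lborel (Q i \<inter> A i)))"
      using \<gamma> by (intro prod_ennreal[symmetric]) auto
    also have "\<dots> = (\<Prod>i<k. c i * emeasure lborel (Q i \<inter> A i))"
    proof (rule prod.cong[OF refl])
      fix i assume "i \<in> {..<k}"
      then have "emeasure lborel (Q i \<inter> A i) < \<infinity>"
        using Q(2)[of i] by (intro emeasure_bounded_finite bounded_Int) auto
      then show "ennreal (\<gamma> * exp (- (\<gamma> * measure lborel (Q i))) * measure lborel (Q i \<inter> A i)) =
          c i * emeasure lborel (Q i \<inter> A i)"
        using \<gamma> by (simp add: c_def ennreal_mult emeasure_eq_ennreal_measure)
    qed
    also have "\<dots> = emeasure (density ?L (\<lambda>f. \<Prod>i<k. c i * indicator (Q i) (f i))) (Pi\<^sub>E {..<k} A)"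
      using Q(1) A' by (subst emeasure_density_product_PiE) auto
    finally show "emeasure \<nu> (Pi\<^sub>E {..<k} A) =
        emeasure (density ?L (\<lambda>f. \<Prod>i<k. c i * indicator (Q i) (f i))) (Pi\<^sub>E {..<k} A)" .
  next
    let ?A = "\<lambda>_::nat. Pi\<^sub>E {..<k} (\<lambda>_. UNIV :: 'a set)"
    show "range ?A \<subseteq> prod_algebra {..<k} (\<lambda>_. lborel)"
      by (auto intro!: prod_algebraI_finite)
    show "(\<Union>i. ?A i) = space ?L" by (simp add: space_PiM)
    have "Pi\<^sub>E {..<k} (\<lambda>_. UNIV) \<in> sets ?L"
      by (intro sets_PiM_I_finite) auto
    then show "emeasure \<nu> (?A i) \<noteq> \<infinity>" for i
      by (simp add: \<nu> emeasure_eq_measure)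
  qed (simp_all add: \<nu>_def)
  moreover have "absolutely_continuous ?L (density ?L (\<lambda>f. \<Prod>i<k. c i * indicator (Q i) (f i)))"
    using Q(1) by (intro absolutely_continuousI_density measurable_prod_indicator)
  ultimately have "N \<in> null_sets \<nu>"
    using N by (auto simp: absolutely_continuous_def)
  then have "emeasure M (T -` N \<inter> E) = 0"
    using \<nu>[OF null_setsD2[OF N]] by (simp add: null_setsD1)
  moreover have "T -` N \<inter> E = (T -` N \<inter> space M) \<inter> E" by (auto simp: E_def)
  then have "T -` N \<inter> E \<in> sets M"
    using measurable_sets[OF T, of N] N E by auto
  ultimately have "T -` N \<inter> E \<in> null_sets M" by auto
  then show ?thesis
    by (rule AE_I') (auto simp: E_def T_def)
qed

lemma AE_no_tuple_in_null_set:
  assumes \<gamma>: "0 < \<gamma>" and N: "N \<in> null_sets (PiM {..<k::nat} (\<lambda>_. lborel))"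
  shows "AE \<omega> in M. \<forall>f. inj_on f {..<k} \<longrightarrow> f ` {..<k} \<subseteq> X \<omega> \<longrightarrow> restrict f {..<k} \<notin> N"
proof -
  define \<Q> where "\<Q> = {Q \<in> Pi\<^sub>E {..<k} (\<lambda>_. isolating_sets :: 'a set set). disjoint_family_on Q {..<k}}"
  have "countable (Pi\<^sub>E {..<k} (\<lambda>_. isolating_sets :: 'a set set))"
    by (intro countable_PiE isolating_sets_basis(1)) simp
  then have count: "countable \<Q>"
    by (rule countable_subset[rotated]) (auto simp: \<Q>_def)
  have "AE \<omega> in M. \<forall>Q\<in>\<Q>. (\<forall>i<k. card (X \<omega> \<inter> Q i) = 1) \<longrightarrow> (\<lambda>i\<in>{..<k}. isolated_point (Q i) \<omega>) \<notin> N"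
  proof (rule AE_ball_countable'[OF _ count])
    fix Q assume Q: "Q \<in> \<Q>"
    then have "Q i \<in> isolating_sets" if "i < k" for i
      using that by (auto simp: \<Q>_def)
    then show "AE \<omega> in M. (\<forall>i<k. card (X \<omega> \<inter> Q i) = 1) \<longrightarrow> (\<lambda>i\<in>{..<k}. isolated_point (Q i) \<omega>) \<notin> N"
      using Q by (intro AE_isolated_points_notin_null_set[OF \<gamma> _ _ _ N] isolating_sets_borel isolating_sets_basis(3))
        (auto simp: \<Q>_def)
  qed
  with AE_space show ?thesis
  proof eventually_elim
    case (elim \<omega>)
    show ?case
    proof (intro allI impI)
      fix f :: "nat \<Rightarrow> 'a" assume f: "inj_on f {..<k}" "f ` {..<k} \<subseteq> X \<omega>"
      obtain Q where Q: "Q \<in> \<Q>" "\<And>i. i < k \<Longrightarrow> X \<omega> \<inter> Q i = {f i}"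
        using disjoint_isolating_sets[OF locally_finite_X[OF elim(1)] f] unfolding \<Q>_def by blast
      have "restrict f {..<k} = (\<lambda>i\<in>{..<k}. isolated_point (Q i) \<omega>)"
        using isolated_point_eq[OF Q(2)] by (intro restrict_ext) simp
      moreover have "\<forall>i<k. card (X \<omega> \<inter> Q i) = 1"
        using Q(2) by simp
      ultimately show "restrict f {..<k} \<notin> N"
        using elim(2) Q(1) by simp
    qed
  qed
qed

text \<open>
  Two nuclei may well have equal circumscribed radii, namely when the same Voronoi vertex is furthest for
  both, but then they are close together. If they are further apart than \<open>4 * R\<close>, the nuclei that determine
  the two radii are \<open>2 * (d + 1)\<close> distinct points, and they form a tuple in the null set of
  \<open>null_sets_equal_sphere_radii\<close>.
\<close>

lemma AE_distant_cells_distinct_radii: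
  assumes \<gamma>: "0 < \<gamma>"
  shows "AE \<omega> in M. \<forall>x\<in>X \<omega>. \<forall>x'\<in>X \<omega>. \<forall>R\<ge>0. circumscribed_radius (X \<omega>) x = ennreal R \<longrightarrow>
    circumscribed_radius (X \<omega>) x' = ennreal R \<longrightarrow> dist x x' \<le> 4 * R"
proof -
  define n where "n = DIM('a) + 1"
  let ?L = "PiM {..<2 * n} (\<lambda>_. lborel :: 'a measure)"
  define N where "N = {f \<in> space ?L. sphere_radius n (\<lambda>i. f (n + i)) = sphere_radius n f \<and>
    0 < sphere_radius n f \<and> sphere_radius n f < \<infinity>}"
  have n: "0 < n" by (simp add: n_def)
  have "N \<in> null_sets ?L"
    unfolding N_def by (rule null_sets_equal_sphere_radii[OF n])
  from AE_no_tuple_in_null_set[OF \<gamma> this] AE_space show ?thesis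
  proof eventually_elim
    case (elim \<omega>)
    show ?case
    proof (intro ballI allI impI, rule ccontr)
      fix x x' and R :: real
      assume x: "x \<in> X \<omega>" "x' \<in> X \<omega>" and R: "0 \<le> R" "circumscribed_radius (X \<omega>) x = ennreal R"
        "circumscribed_radius (X \<omega>) x' = ennreal R" and far: "\<not> dist x x' \<le> 4 * R"
      note lf = locally_finite_X[OF elim(2)]
      have "0 < R"
        by (rule circumscribed_radius_eq_sphere_radius(1)[OF lf x(1) R(2,1)])
      obtain f where f: "inj_on f {..<n}" "f ` {..<n} \<subseteq> X \<omega> \<inter> cball x (2 * R)" "sphere_radius n f = ennreal R"
        using circumscribed_radius_eq_sphere_radius(2)[OF lf x(1) R(2,1)] unfolding n_def by blast
      obtain f' where f': "inj_on f' {..<n}" "f' ` {..<n} \<subseteq> X \<omega> \<inter> cball x' (2 * R)" "sphere_radius n f' = ennreal R"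
        using circumscribed_radius_eq_sphere_radius(2)[OF lf x(2) R(3,1)] unfolding n_def by blast
      define g where "g i = (if i < n then f i else f' (i - n))" for i
      have apart: "f i \<noteq> f' j" if "i < n" "j < n" for i j
      proof
        assume eq: "f i = f' j"
        have "f i \<in> cball x (2 * R)" "f' j \<in> cball x' (2 * R)" using f(2) f'(2) that by auto
        then show False
          using far eq dist_triangle2[of x x' "f i"] by auto
      qed
      have "inj_on g {..<2 * n}"
      proof (rule inj_onI)
        fix i j assume ij: "i \<in> {..<2 * n}" "j \<in> {..<2 * n}" "g i = g j"
        consider "i < n" "j < n" | "i < n" "\<not> j < n" | "\<not> i < n" "j < n" | "\<not> i < n" "\<not> j < n" by blast
        then show "i = j"
        proof cases
          case 1
          then show ?thesis using ij f(1) by (auto simp: g_def dest: inj_onD)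
        next
          case 2
          then show ?thesis using ij apart[of i "j - n"] by (simp add: g_def)
        next
          case 3
          then have "f j = f' (i - n)" using ij by (simp add: g_def)
          moreover have "i - n < n" using 3 ij by auto
          ultimately show ?thesis using 3(2) apart[of j "i - n"] by simp
        next
          case 4
          then have "f' (i - n) = f' (j - n)" "i - n < n" "j - n < n"
            using ij by (auto simp: g_def)
          then have "i - n = j - n" using f'(1) by (auto dest: inj_onD)
          then show ?thesis using 4 by simp
        qed
      qed
      moreover have "g i \<in> X \<omega>" if "i < 2 * n" for i
        using f(2) f'(2) that by (cases "i < n") (auto simp: g_def)
      then have "g ` {..<2 * n} \<subseteq> X \<omega>" by auto
      ultimately have "restrict g {..<2 * n} \<notin> N" using elim(1) by blast
      moreover have "sphere_radius n (restrict g {..<2 * n}) = ennreal R"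
        unfolding f(3)[symmetric] by (rule sphere_radius_cong) (auto simp: g_def n)
      moreover have "sphere_radius n (\<lambda>i. restrict g {..<2 * n} (n + i)) = ennreal R"
        unfolding f'(3)[symmetric] by (rule sphere_radius_cong) (auto simp: g_def n)
      ultimately show False
        using \<open>0 < R\<close> by (simp add: N_def space_PiM)
    qed
  qed
qed

end

section \<open>Small cells from simplex configurations\<close>

text \<open>
  The origin together with the vertices \<open>b\<^sub>1, \<dots>, b\<^sub>d, - (b\<^sub>1 + \<dots> + b\<^sub>d)\<close> of a simplex around it, where the
  \<open>b\<^sub>i\<close> are the basis vectors.
\<close>

definition simplex_directions :: "'a::euclidean_space set" where
  "simplex_directions = insert 0 (insert (- (\<Sum>Basis)) Basis)"

lemma finite_simplex_directions: "finite (simplex_directions :: 'a::euclidean_space set)"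
  by (simp add: simplex_directions_def)

lemma card_simplex_directions_le: "card (simplex_directions :: 'a::euclidean_space set) \<le> DIM('a) + 2"
proof -
  have "card (insert (- (\<Sum>Basis)) Basis :: 'a set) \<le> DIM('a) + 1"
    using card_insert_le_m1[of "DIM('a) + 1" "Basis :: 'a set"] by simp
  then show ?thesis
    unfolding simplex_directions_def by (intro card_insert_le_m1) auto
qed

lemma inner_simplex_directions:
  assumes "v \<in> simplex_directions" "b \<in> Basis"
  shows "v \<bullet> b \<in> {- 1, 0, 1}"
  using assms by (auto simp: simplex_directions_def inner_Basis inner_sum_left sum.If_cases)

lemma norm_simplex_directions_le:
  fixes v :: "'a::euclidean_space"
  assumes "v \<in> simplex_directions"
  shows "norm v \<le> DIM('a)"
proof -
  have "norm v \<le> (\<Sum>b\<in>Basis. \<bar>v \<bullet> b\<bar>)" by (rule norm_le_l1)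
  also have "\<dots> \<le> (\<Sum>b\<in>(Basis :: 'a set). 1)"
    using inner_simplex_directions[OF assms] by (intro sum_mono) force
  finally show ?thesis by simp
qed

text \<open>
  Quantitative form of the fact that the vertices of the simplex surround the origin.
\<close>

lemma norm_le_of_simplex_inner_le:
  fixes u :: "'a::euclidean_space"
  assumes h: "0 \<le> h" and le: "\<And>v. v \<in> simplex_directions \<Longrightarrow> v \<bullet> u \<le> h"
  shows "norm u \<le> real DIM('a) ^ 2 * h"
proof -
  have up: "u \<bullet> b \<le> h" if "b \<in> Basis" for b
    using le[of b] that by (simp add: simplex_directions_def inner_commute)
  have "(- (\<Sum>Basis)) \<bullet> u \<le> h"
    by (rule le) (simp add: simplex_directions_def)
  then have sum: "- (\<Sum>b\<in>Basis. u \<bullet> b) \<le> h"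
    by (simp add: inner_commute[of _ u] inner_sum_right)
  have "\<bar>u \<bullet> b\<bar> \<le> real DIM('a) * h" if b: "b \<in> Basis" for b
  proof -
    have "(\<Sum>c\<in>Basis - {b}. u \<bullet> c) \<le> (\<Sum>c\<in>(Basis :: 'a set) - {b}. h)"
      using up by (intro sum_mono) auto
    also have "\<dots> = (real DIM('a) - 1) * h"
      using b by (simp add: card_Diff_singleton of_nat_diff)
    finally have "(\<Sum>c\<in>Basis. u \<bullet> c) \<le> u \<bullet> b + (real DIM('a) - 1) * h"
      using b by (simp add: sum.remove[of Basis b])
    then have "- (real DIM('a) * h) \<le> u \<bullet> b"
      using sum by (simp add: algebra_simps)
    moreover have "1 * h \<le> real DIM('a) * h"
      using h by (intro mult_right_mono) (auto simp: Suc_le_eq)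
    ultimately show ?thesis using up[OF b] by auto
  qed
  then have "(\<Sum>b\<in>Basis. \<bar>u \<bullet> b\<bar>) \<le> (\<Sum>b\<in>(Basis :: 'a set). real DIM('a) * h)"
    by (rule sum_mono)
  then show ?thesis
    using norm_le_l1[of u] by (simp add: power2_eq_square)
qed

text \<open>
  If there are points near \<open>p\<close> and near the vertices of a simplex of size \<open>s\<close> around \<open>p\<close>, then the cell of
  the point near \<open>p\<close> is small, whatever the other points are: further nuclei only make it smaller.
\<close>

lemma voronoi_cell_subset_cball_if_simplex:
  fixes p :: "'a::euclidean_space"
  defines "d \<equiv> real DIM('a)"
  assumes s: "0 < s"
    and x: "\<And>v. v \<in> simplex_directions \<Longrightarrow> x v \<in> \<eta> \<inter> ball (p + s *\<^sub>R v) (s * (1 / (4 * d\<^sup>2)))"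
  shows "voronoi_cell \<eta> (x 0) \<subseteq> cball (x 0) (s * (d\<^sup>2 * (d + 1)\<^sup>2))"
proof
  fix y assume y: "y \<in> voronoi_cell \<eta> (x 0)"
  have d: "1 \<le> d" by (simp add: d_def Suc_le_eq)
  then have d2: "1 \<le> d\<^sup>2" by simp
  define u where "u = y - x 0"
  have zero: "0 \<in> simplex_directions" by (simp add: simplex_directions_def)
  have "v \<bullet> u \<le> s * (d + 1)\<^sup>2 / 2 + norm u / (2 * d\<^sup>2)" if v: "v \<in> simplex_directions" for v
  proof -
    define a where "a = x v - x 0"
    have "norm (p + s *\<^sub>R v - x v) < s / (4 * d\<^sup>2)" "norm (p - x 0) < s / (4 * d\<^sup>2)"
      using x[OF v] x[OF zero] by (simp_all add: dist_norm)
    moreover have "norm (s *\<^sub>R v - a) \<le> norm (p + s *\<^sub>R v - x v) + norm (p - x 0)"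
      using norm_triangle_ineq4[of "p + s *\<^sub>R v - x v" "p - x 0"] by (simp add: a_def algebra_simps)
    ultimately have close: "norm (s *\<^sub>R v - a) \<le> s / (2 * d\<^sup>2)"
      by (simp add: field_simps)
    have "s / (2 * d\<^sup>2) \<le> s"
      using s d2 by (simp add: divide_le_eq)
    moreover have "norm a \<le> s * norm v + norm (s *\<^sub>R v - a)"
      using norm_triangle_ineq4[of "s *\<^sub>R v" "s *\<^sub>R v - a"] s by simp
    moreover have "s * norm v \<le> s * d"
      using norm_simplex_directions_le[OF v] s by (simp add: d_def)
    ultimately have "norm a \<le> s * (d + 1)"
      using close by (simp add: algebra_simps)
    then have norm_a: "a \<bullet> a \<le> (s * (d + 1))\<^sup>2"
      unfolding dot_square_norm by (intro power_mono) auto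
    have "dist y (x 0) \<le> dist y (x v)"
      using y x[OF v] by (cases "x v = x 0") (auto simp: voronoi_cell_def)
    then have "2 * (a \<bullet> u) \<le> a \<bullet> a"
      by (simp add: dist_le_iff_halfspace midpoint_def u_def a_def inner_simps inner_commute algebra_simps)
    moreover have "(s *\<^sub>R v - a) \<bullet> u \<le> s / (2 * d\<^sup>2) * norm u"
      using norm_cauchy_schwarz[of "s *\<^sub>R v - a" u] mult_right_mono[OF close, of "norm u"] by simp
    ultimately have "s * (v \<bullet> u) \<le> (s * (d + 1))\<^sup>2 / 2 + s / (2 * d\<^sup>2) * norm u"
      using norm_a by (simp add: inner_diff_left)
    also have "\<dots> = s * (s * (d + 1)\<^sup>2 / 2 + norm u / (2 * d\<^sup>2))"
      by (simp add: power2_eq_square algebra_simps)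
    finally show ?thesis
      using s by (simp only: mult_le_cancel_left_pos)
  qed
  then have "norm u \<le> d\<^sup>2 * (s * (d + 1)\<^sup>2 / 2 + norm u / (2 * d\<^sup>2))"
    unfolding d_def using s by (intro norm_le_of_simplex_inner_le) auto
  also have "\<dots> = s * (d\<^sup>2 * (d + 1)\<^sup>2) / 2 + norm u / 2"
    using d by (simp add: algebra_simps)
  finally show "y \<in> cball (x 0) (s * (d\<^sup>2 * (d + 1)\<^sup>2))"
    by (simp add: u_def dist_norm norm_minus_commute)
qed

text \<open>
  The points of a cubic grid of mesh \<open>4 * s\<close> based at \<open>w\<close>; simplices of size \<open>s\<close> around distinct grid points
  are separated.
\<close>

definition grid_point :: "'a \<Rightarrow> real \<Rightarrow> ('a \<Rightarrow> nat) \<Rightarrow> 'a::euclidean_space" where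
  "grid_point w s z = w + (\<Sum>b\<in>Basis. (4 * s * real (z b)) *\<^sub>R b)"

lemma grid_balls_disjoint:
  fixes z z' :: "'a::euclidean_space \<Rightarrow> nat"
  assumes s: "0 < s" and \<delta>: "\<delta> \<le> 1 / 2" and zz': "z \<in> extensional Basis" "z' \<in> extensional Basis"
    and v: "v \<in> simplex_directions" "v' \<in> simplex_directions" and ne: "(z, v) \<noteq> (z', v')"
  shows "ball (grid_point w s z + s *\<^sub>R v) (s * \<delta>) \<inter> ball (grid_point w s z' + s *\<^sub>R v') (s * \<delta>) = {}"
proof (rule disjoint_ballI)
  have "s * \<delta> + s * \<delta> \<le> s"
    using s \<delta> mult_left_mono[of \<delta> "1/2" s] by simp
  moreover have "\<exists>b\<in>Basis. s \<le> \<bar>(grid_point w s z + s *\<^sub>R v - (grid_point w s z' + s *\<^sub>R v')) \<bullet> b\<bar>"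
  proof (cases "z = z'")
    case True
    then obtain b where b: "b \<in> Basis" "v \<bullet> b \<noteq> v' \<bullet> b"
      using ne by (auto simp: euclidean_eq_iff[of v v'])
    then have "1 \<le> \<bar>v \<bullet> b - v' \<bullet> b\<bar>"
      using inner_simplex_directions[OF v(1) b(1)] inner_simplex_directions[OF v(2) b(1)] by auto
    then have "s * 1 \<le> s * \<bar>v \<bullet> b - v' \<bullet> b\<bar>"
      using s by (intro mult_left_mono) auto
    also have "\<dots> = \<bar>(grid_point w s z + s *\<^sub>R v - (grid_point w s z' + s *\<^sub>R v')) \<bullet> b\<bar>"
      using True s by (simp add: inner_diff_left inner_add_left abs_mult right_diff_distrib[symmetric])
    finally show ?thesis using b(1) by auto
  next
    case False
    then obtain b where b: "b \<in> Basis" "z b \<noteq> z' b"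
      using zz' by (metis extensionalityI)
    define D where "D = 4 * (real (z b) - real (z' b)) + (v \<bullet> b - v' \<bullet> b)"
    have "(grid_point w s z + s *\<^sub>R v - (grid_point w s z' + s *\<^sub>R v')) \<bullet> b = s * D"
      using b(1) by (simp add: grid_point_def D_def inner_diff_left inner_add_left algebra_simps)
    moreover have "1 \<le> \<bar>D\<bar>"
      using inner_simplex_directions[OF v(1) b(1)] inner_simplex_directions[OF v(2) b(1)] b(2)
      by (auto simp: D_def)
    then have "s * 1 \<le> s * \<bar>D\<bar>"
      using s by (intro mult_left_mono) auto
    ultimately show ?thesis
      using s by (intro bexI[OF _ b(1)]) (simp only: abs_mult abs_of_pos)
  qed
  ultimately show "s * \<delta> + s * \<delta> \<le> dist (grid_point w s z + s *\<^sub>R v) (grid_point w s z' + s *\<^sub>R v')"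
    unfolding dist_norm by (meson Basis_le_norm order_trans)
qed

section \<open>Probability estimates at a given scale\<close>

context poisson_process
begin

lemma prob_count_ge_le:
  assumes B: "B \<in> sets borel" "bounded B" and \<gamma>: "0 < \<gamma>"
  shows "prob {\<omega> \<in> space M. k \<le> card (X \<omega> \<inter> B)} \<le> (\<gamma> * measure lborel B) ^ k"
proof -
  define l where "l = \<gamma> * measure lborel B"
  have l: "0 \<le> l" using \<gamma> by (simp add: l_def)
  define A where "A n = {\<omega> \<in> space M. card (X \<omega> \<inter> B) = n + k}" for n
  have A: "A n \<in> sets M" for n
    using pred_count[OF B, of "\<lambda>m. m = n + k"] by (simp add: A_def pred_def)
  have "{\<omega> \<in> space M. k \<le> card (X \<omega> \<inter> B)} = (\<Union>n. A n)"
    by (auto simp: A_def le_iff_add add.commute)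
  moreover have "(\<lambda>n. prob (A n)) sums prob (\<Union>n. A n)"
    by (rule finite_measure_UNION) (use A in \<open>auto simp: A_def disjoint_family_on_def\<close>)
  ultimately have 1: "(\<lambda>n. prob (A n)) sums prob {\<omega> \<in> space M. k \<le> card (X \<omega> \<inter> B)}"
    by simp
  have "(\<lambda>n. l ^ n /\<^sub>R fact n) sums exp l" by (rule exp_converges)
  then have "(\<lambda>n. l ^ k * exp (- l) * (l ^ n /\<^sub>R fact n)) sums (l ^ k * exp (- l) * exp l)"
    by (rule sums_mult)
  then have 2: "(\<lambda>n. l ^ k * exp (- l) * (l ^ n /\<^sub>R fact n)) sums l ^ k"
    by (simp add: mult.assoc exp_add[symmetric])
  have "prob (A n) \<le> l ^ k * exp (- l) * (l ^ n /\<^sub>R fact n)" for n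
  proof -
    have "prob (A n) = exp (- l) * l ^ (n + k) / fact (n + k)"
      unfolding A_def l_def by (rule prob_count[OF B])
    also have "\<dots> \<le> exp (- l) * l ^ (n + k) / fact n"
      using l by (intro divide_left_mono) (auto intro!: fact_mono)
    finally show ?thesis by (simp add: power_add field_simps)
  qed
  then have "prob {\<omega> \<in> space M. k \<le> card (X \<omega> \<inter> B)} \<le> l ^ k"
    using sums_le[OF _ 1 2] by blast
  then show ?thesis by (simp add: l_def)
qed

text \<open>
  This bounds the probability that some ball of radius \<open>t\<close>, centred at a point of the process in a given
  cube, contains at least \<open>m\<close> points. The centre lies in a grid cube of side \<open>t\<close>, and the ball in the concentric cube of side \<open>3 * t\<close>; a
  union bound over the grid cubes suffices. The event itself is covered by the measurable event \<open>E\<close>.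
\<close>

lemma prob_cluster_le:
  assumes \<gamma>: "0 < \<gamma>" and t: "0 < t" "t \<le> 1" and a: "0 \<le> a"
  shows "\<exists>E\<in>sets M. prob E \<le> ((2 * a + 5) / t) ^ DIM('a) * (\<gamma> * (3 * t) ^ DIM('a)) ^ m \<and>
    (\<forall>\<omega>\<in>space M - E. \<forall>x\<in>X \<omega>. (\<forall>b\<in>Basis. \<bar>x \<bullet> b\<bar> \<le> a) \<longrightarrow> card (X \<omega> \<inter> cball x t) < m)"
proof -
  define n where "n = \<lceil>a / t\<rceil> + 1"
  define Z where "Z = Pi\<^sub>E (Basis :: 'a set) (\<lambda>_. {- n..n})"
  define Q where "Q z = cbox (\<Sum>b\<in>Basis. (t * (of_int (z b) - 1)) *\<^sub>R b) (\<Sum>b\<in>Basis. (t * (of_int (z b) + 2)) *\<^sub>R b)"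
    for z :: "'a \<Rightarrow> int"
  define E where "E = (\<Union>z\<in>Z. {\<omega> \<in> space M. m \<le> card (X \<omega> \<inter> Q z)})"
  have "0 \<le> a / t" using a t(1) by simp
  then have n0: "0 \<le> n" unfolding n_def by linarith
  have finZ: "finite Z" unfolding Z_def by (intro finite_PiE) auto
  have "card Z = nat (2 * n + 1) ^ DIM('a)"
    using n0 by (simp add: Z_def card_PiE)
  then have "real (card Z) = (2 * real_of_int n + 1) ^ DIM('a)"
    using n0 by simp
  also have "\<dots> \<le> ((2 * a + 5) / t) ^ DIM('a)"
  proof (rule power_mono)
    have "real_of_int n \<le> a / t + 2" unfolding n_def by linarith
    then have "2 * real_of_int n + 1 \<le> 2 * a / t + 5 * 1" by simp
    also have "\<dots> \<le> 2 * a / t + 5 * (1 / t)"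
      using t by (intro add_left_mono mult_left_mono) auto
    finally show "2 * real_of_int n + 1 \<le> (2 * a + 5) / t"
      by (simp add: add_divide_distrib)
  qed (use n0 in simp)
  finally have cardZ: "real (card Z) \<le> ((2 * a + 5) / t) ^ DIM('a)" .
  have Q: "Q z \<in> sets borel" "bounded (Q z)" for z by (auto simp: Q_def)
  have measure_Q: "measure lborel (Q z) = (3 * t) ^ DIM('a)" for z
  proof -
    let ?l = "\<Sum>b\<in>Basis. (t * (of_int (z b) - 1)) *\<^sub>R b :: 'a"
    let ?u = "\<Sum>b\<in>Basis. (t * (of_int (z b) + 2)) *\<^sub>R b :: 'a"
    have inner: "?l \<bullet> b = t * (of_int (z b) - 1)" "?u \<bullet> b = t * (of_int (z b) + 2)" if "b \<in> Basis" for b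
      using that by (simp_all only: inner_sum_left_Basis)
    have "measure lborel (cbox ?l ?u) = (\<Prod>b\<in>Basis. (?u - ?l) \<bullet> b)"
    proof -
      have "?l \<bullet> b \<le> ?u \<bullet> b" if "b \<in> Basis" for b
        unfolding inner[OF that] using t(1) by simp
      then have "\<forall>b\<in>Basis. ?l \<bullet> b \<le> ?u \<bullet> b" by (rule ballI)
      then show ?thesis
        unfolding measure_lborel_cbox_eq by (rule if_P)
    qed
    also have "\<dots> = (\<Prod>b\<in>(Basis :: 'a set). 3 * t)"
    proof (rule prod.cong[OF refl])
      fix b :: 'a assume "b \<in> Basis"
      from inner[OF this] show "(?u - ?l) \<bullet> b = 3 * t"
        unfolding inner_diff_left by (simp only:) (simp add: algebra_simps)
    qed
    finally show ?thesis by (simp add: Q_def)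
  qed
  have meas: "{\<omega> \<in> space M. m \<le> card (X \<omega> \<inter> Q z)} \<in> sets M" for z
    using pred_count[OF Q, of "\<lambda>k. m \<le> k"] by (simp add: pred_def)
  have "prob E \<le> (\<Sum>z\<in>Z. prob {\<omega> \<in> space M. m \<le> card (X \<omega> \<inter> Q z)})"
    unfolding E_def using finZ meas by (intro finite_measure_subadditive_finite) auto
  also have "\<dots> \<le> (\<Sum>z\<in>Z. (\<gamma> * (3 * t) ^ DIM('a)) ^ m)"
    using prob_count_ge_le[OF Q \<gamma>] by (intro sum_mono) (simp add: measure_Q)
  also have "\<dots> \<le> ((2 * a + 5) / t) ^ DIM('a) * (\<gamma> * (3 * t) ^ DIM('a)) ^ m"
    using cardZ \<gamma> t by (simp add: mult_right_mono)
  finally have "prob E \<le> ((2 * a + 5) / t) ^ DIM('a) * (\<gamma> * (3 * t) ^ DIM('a)) ^ m" .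
  moreover have "E \<in> sets M"
    unfolding E_def using finZ meas by auto
  moreover have "card (X \<omega> \<inter> cball x t) < m"
    if \<omega>: "\<omega> \<in> space M - E" and x: "x \<in> X \<omega>" "\<forall>b\<in>Basis. \<bar>x \<bullet> b\<bar> \<le> a" for \<omega> x
  proof -
    define z where "z = (\<lambda>b\<in>Basis. \<lfloor>x \<bullet> b / t\<rfloor>)"
    have "\<lfloor>x \<bullet> b / t\<rfloor> \<in> {- n..n}" if "b \<in> Basis" for b
    proof -
      have "\<bar>x \<bullet> b\<bar> \<le> a"
        using x(2) that by blast
      then have "x \<bullet> b \<le> a" "- a \<le> x \<bullet> b"
        by linarith+
      then have "x \<bullet> b / t \<le> a / t" "- (a / t) \<le> x \<bullet> b / t"
        using t(1) by (simp_all add: field_simps)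
      then have "\<lfloor>x \<bullet> b / t\<rfloor> \<le> n" "- n \<le> \<lfloor>x \<bullet> b / t\<rfloor>"
        unfolding n_def by linarith+
      then show ?thesis by simp
    qed
    then have "z \<in> Z" by (simp add: z_def Z_def)
    then have "card (X \<omega> \<inter> Q z) < m" using \<omega> by (auto simp: E_def not_le[symmetric])
    moreover have "cball x t \<subseteq> Q z"
    proof
      fix y assume "y \<in> cball x t"
      then have near: "\<bar>(x - y) \<bullet> b\<bar> \<le> t" if "b \<in> Basis" for b
        using Basis_le_norm[OF that, of "x - y"] by (simp add: dist_norm)
      have floor: "t * \<lfloor>x \<bullet> b / t\<rfloor> \<le> x \<bullet> b" "x \<bullet> b \<le> t * (\<lfloor>x \<bullet> b / t\<rfloor> + 1)" for b
      proof -
        have "t * \<lfloor>x \<bullet> b / t\<rfloor> \<le> t * (x \<bullet> b / t)" "t * (x \<bullet> b / t) \<le> t * (\<lfloor>x \<bullet> b / t\<rfloor> + 1)"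
          using t(1) by (intro mult_left_mono; linarith)+
        then show "t * \<lfloor>x \<bullet> b / t\<rfloor> \<le> x \<bullet> b" "x \<bullet> b \<le> t * (\<lfloor>x \<bullet> b / t\<rfloor> + 1)"
          using t(1) by simp_all
      qed
      show "y \<in> Q z"
        unfolding Q_def mem_box
      proof
        fix b :: 'a assume b: "b \<in> Basis"
        then have "t * (of_int (z b) - 1) \<le> y \<bullet> b" "y \<bullet> b \<le> t * (of_int (z b) + 2)"
          using near[OF b] floor[of b] by (auto simp: z_def inner_diff_left abs_le_iff algebra_simps)
        then show "(\<Sum>b\<in>Basis. (t * (of_int (z b) - 1)) *\<^sub>R b) \<bullet> b \<le> y \<bullet> b \<and>
            y \<bullet> b \<le> (\<Sum>b\<in>Basis. (t * (of_int (z b) + 2)) *\<^sub>R b) \<bullet> b"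
          unfolding inner_sum_left_Basis[OF b] by simp
      qed
    qed
    moreover have "finite (X \<omega> \<inter> Q z)" using \<omega> Q(2) finite_X_Int by auto
    ultimately show ?thesis
      using card_mono[of "X \<omega> \<inter> Q z" "X \<omega> \<inter> cball x t"]
      by (meson Int_mono le_less_trans order_refl)
  qed
  ultimately show ?thesis by blast
qed

text \<open>
  Grouping the independent counts by their first index \<open>z\<close> gives independent blocks, and a block is full if
  all its sets are hit.
\<close>

lemma prob_no_full_block:
  assumes fin: "finite Z" "finite J"
    and A: "\<And>z v. z \<in> Z \<Longrightarrow> v \<in> J \<Longrightarrow> A z v \<in> sets borel" "\<And>z v. z \<in> Z \<Longrightarrow> v \<in> J \<Longrightarrow> bounded (A z v)"
    and disj: "disjoint_family_on (\<lambda>(z, v). A z v) (Z \<times> J)"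
  shows "prob {\<omega> \<in> space M. \<forall>z\<in>Z. \<exists>v\<in>J. card (X \<omega> \<inter> A z v) = 0} =
    (\<Prod>z\<in>Z. 1 - (\<Prod>v\<in>J. prob {\<omega> \<in> space M. card (X \<omega> \<inter> A z v) \<noteq> 0}))"
proof (cases "Z = {}")
  case False
  define B where "B p = A (fst p) (snd p)" for p
  have B: "B p \<in> sets borel" "bounded (B p)" if "p \<in> Z \<times> J" for p
    using A that by (auto simp: B_def)
  have disjB: "disjoint_family_on B (Z \<times> J)"
    using disj by (simp add: B_def[abs_def] case_prod_unfold)
  have "indep_vars (\<lambda>z. PiM ({z} \<times> J) (\<lambda>_. count_space UNIV))
      (\<lambda>z \<omega>. restrict (\<lambda>p. card (X \<omega> \<inter> B p)) ({z} \<times> J)) Z"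
    by (rule indep_vars_restrict[OF indep_counts[OF _ B disjB]])
       (use fin in \<open>auto simp: disjoint_family_on_def\<close>)
  then have "indep_vars (\<lambda>_. count_space UNIV)
      (\<lambda>z \<omega>. \<forall>v\<in>J. restrict (\<lambda>p. card (X \<omega> \<inter> B p)) ({z} \<times> J) (z, v) \<noteq> 0) Z"
  proof (rule indep_vars_compose2[where Y = "\<lambda>z f. \<forall>v\<in>J. f (z, v) \<noteq> (0::nat)"])
    fix z assume "z \<in> Z"
    show "(\<lambda>f. \<forall>v\<in>J. f (z, v) \<noteq> (0::nat)) \<in> PiM ({z} \<times> J) (\<lambda>_. count_space UNIV) \<rightarrow>\<^sub>M count_space UNIV"
    proof (rule measurable_pred_countable(1))
      fix v assume v: "v \<in> J"
      have "(\<lambda>f. f (z, v)) \<in> PiM ({z} \<times> J) (\<lambda>_. count_space (UNIV :: nat set)) \<rightarrow>\<^sub>M count_space UNIV"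
        by (rule measurable_component_singleton) (use v in simp)
      from measurable_compose[OF this, of "\<lambda>k. k \<noteq> 0"]
      show "Measurable.pred (PiM ({z} \<times> J) (\<lambda>_. count_space UNIV)) (\<lambda>f. f (z, v) \<noteq> (0::nat))" by simp
    qed (use fin in \<open>simp add: countable_finite\<close>)
  qed
  then have indep: "indep_vars (\<lambda>_. count_space UNIV) (\<lambda>z \<omega>. \<forall>v\<in>J. card (X \<omega> \<inter> A z v) \<noteq> 0) Z"
    by (subst indep_vars_cong[OF refl _ refl]) (auto simp: B_def fun_eq_iff)
  have vimage: "(\<lambda>\<omega>. \<forall>v\<in>J. card (X \<omega> \<inter> A z v) \<noteq> 0) -` {False} \<inter> space M =
      {\<omega> \<in> space M. \<exists>v\<in>J. card (X \<omega> \<inter> A z v) = 0}" for z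
    by (intro set_eqI) (simp add: conj_commute)
  have "(\<Inter>z\<in>Z. {\<omega> \<in> space M. \<exists>v\<in>J. card (X \<omega> \<inter> A z v) = 0}) =
      {\<omega> \<in> space M. \<forall>z\<in>Z. \<exists>v\<in>J. card (X \<omega> \<inter> A z v) = 0}"
    using False by blast
  then have "prob {\<omega> \<in> space M. \<forall>z\<in>Z. \<exists>v\<in>J. card (X \<omega> \<inter> A z v) = 0} =
      (\<Prod>z\<in>Z. prob {\<omega> \<in> space M. \<exists>v\<in>J. card (X \<omega> \<inter> A z v) = 0})"
    using indep_varsD_finite[OF indep False fin(1), of "\<lambda>_. {False}"] unfolding vimage by simp
  moreover have "prob {\<omega> \<in> space M. \<exists>v\<in>J. card (X \<omega> \<inter> A z v) = 0} =
      1 - (\<Prod>v\<in>J. prob {\<omega> \<in> space M. card (X \<omega> \<inter> A z v) \<noteq> 0})" if z: "z \<in> Z" for z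
  proof -
    let ?F = "{\<omega> \<in> space M. \<forall>v\<in>J. card (X \<omega> \<inter> A z v) \<in> - {0}}"
    have "Measurable.pred M (\<lambda>\<omega>. \<forall>v\<in>J. card (X \<omega> \<inter> A z v) \<in> - {0})"
      using fin A z by (intro measurable_pred_countable(1) pred_count) (auto intro: countable_finite)
    then have "prob (space M - ?F) = 1 - prob ?F"
      by (intro prob_compl) (simp add: pred_def)
    moreover have "{\<omega> \<in> space M. \<exists>v\<in>J. card (X \<omega> \<inter> A z v) = 0} = space M - ?F"
      by (intro set_eqI) (simp, blast)
    moreover have "disjoint_family_on (A z) J"
      unfolding disjoint_family_on_def
    proof (intro ballI impI)
      fix v v' assume "v \<in> J" "v' \<in> J" "v \<noteq> v'"
      then show "A z v \<inter> A z v' = {}"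
        using disjoint_family_onD[OF disj, of "(z, v)" "(z, v')"] z by simp
    qed
    then have "prob ?F = (\<Prod>v\<in>J. prob {\<omega> \<in> space M. card (X \<omega> \<inter> A z v) \<in> - {0}})"
      using A z by (intro prob_counts fin) auto
    ultimately show ?thesis by simp
  qed
  ultimately show ?thesis by simp
qed (simp add: prob_space)

end

context poisson_process
begin

text \<open>
  Of the order of \<open>(l / s) ^ d\<close> disjoint blocks of at most \<open>d + 2\<close> small balls in simplex position fit into a cube,
  and every full block provides a nucleus with a small cell.
\<close>

lemma prob_no_simplex_cell_le:
  fixes w :: 'a and s l :: real
  defines "d \<equiv> DIM('a)"
  defines "\<kappa> \<equiv> unit_ball_vol (real d) * (1 / (4 * (real d)\<^sup>2)) ^ d"
  assumes \<gamma>: "0 < \<gamma>" and s: "0 < s" "8 * s \<le> l"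
  shows "\<exists>E\<in>sets M. prob E \<le> exp (- ((1 - exp (- (\<gamma> * (\<kappa> * s ^ d)))) ^ (d + 2) * (l / (8 * s)) ^ d)) \<and>
    (\<forall>\<omega>\<in>space M - E. \<exists>x\<in>X \<omega>. (\<forall>b\<in>Basis. \<bar>x \<bullet> b - w \<bullet> b\<bar> \<le> l) \<and>
      voronoi_cell (X \<omega>) x \<subseteq> cball x (s * ((real d)\<^sup>2 * (real d + 1)\<^sup>2)))"
proof -
  define \<delta> where "\<delta> = 1 / (4 * (real d)\<^sup>2)"
  have d: "1 \<le> real d" by (simp add: d_def Suc_le_eq)
  then have "1 \<le> (real d)\<^sup>2" by simp
  with d have \<delta>: "0 < \<delta>" "\<delta> \<le> 1 / 4" by (simp_all add: \<delta>_def divide_le_eq)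
  \<comment> \<open>the number of grid points in each coordinate direction, which keeps the blocks inside the cube\<close>
  define N where "N = nat \<lfloor>l / (4 * s)\<rfloor>"
  have l: "0 \<le> l / (4 * s)" using s by simp
  then have "real N \<le> l / (4 * s)" unfolding N_def by linarith
  then have "4 * s * real N \<le> 4 * s * (l / (4 * s))"
    using s(1) by (intro mult_left_mono) auto
  then have N_le: "4 * s * real N \<le> l" using s(1) by simp
  have "l / (4 * s) - 1 \<le> real N"
    using l unfolding N_def by linarith
  moreover have "l / (8 * s) \<le> l / (4 * s) - 1"
    using s by (simp add: field_simps)
  ultimately have N_ge: "l / (8 * s) \<le> real N" by simp
  define Z where "Z = Pi\<^sub>E (Basis :: 'a set) (\<lambda>_. {..<N})"
  have finZ: "finite Z" unfolding Z_def by (intro finite_PiE) auto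
  have cardZ: "card Z = N ^ d"
    by (simp add: Z_def card_PiE d_def)
  let ?J = "simplex_directions :: 'a set"
  define A where "A z v = ball (grid_point w s z + s *\<^sub>R v) (s * \<delta>)" for z and v :: 'a
  have A: "A z v \<in> sets borel" "bounded (A z v)" for z v by (simp_all add: A_def)
  have measure_A: "measure lborel (A z v) = \<kappa> * s ^ d" for z v
  proof -
    have "\<kappa> = unit_ball_vol (real d) * \<delta> ^ d"
      by (simp only: \<kappa>_def \<delta>_def)
    then show ?thesis
      unfolding A_def using s(1) \<delta>(1)
      by (simp add: content_ball d_def[symmetric] power_mult_distrib)
  qed
  define q where "q = 1 - exp (- (\<gamma> * (\<kappa> * s ^ d)))"
  have \<kappa>: "0 \<le> \<kappa>" by (simp add: \<kappa>_def)
  have q: "0 \<le> q" "q \<le> 1" using \<gamma> s \<kappa> by (simp_all add: q_def)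
  have prob_A: "prob {\<omega> \<in> space M. card (X \<omega> \<inter> A z v) \<noteq> 0} = q" for z v
  proof -
    have "prob (space M - {\<omega> \<in> space M. card (X \<omega> \<inter> A z v) = 0}) =
        1 - prob {\<omega> \<in> space M. card (X \<omega> \<inter> A z v) = 0}"
      using pred_count[OF A, of "\<lambda>k. k = 0"] by (intro prob_compl) (simp add: pred_def)
    moreover have "space M - {\<omega> \<in> space M. card (X \<omega> \<inter> A z v) = 0} =
        {\<omega> \<in> space M. card (X \<omega> \<inter> A z v) \<noteq> 0}"
      by (intro set_eqI) (simp, blast)
    ultimately show ?thesis
      using prob_count[OF A, of z v 0] by (simp add: q_def measure_A)
  qed
  have disj: "disjoint_family_on (\<lambda>(z, v). A z v) (Z \<times> ?J)"
    unfolding disjoint_family_on_def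
  proof (intro ballI impI)
    fix p p' assume p: "p \<in> Z \<times> ?J" "p' \<in> Z \<times> ?J" "p \<noteq> p'"
    obtain z v z' v' where eq: "p = (z, v)" "p' = (z', v')" by (metis surj_pair)
    have "A z v \<inter> A z' v' = {}"
      unfolding A_def using p \<delta> s(1) by (intro grid_balls_disjoint) (auto simp: eq Z_def PiE_def)
    then show "(case p of (z, v) \<Rightarrow> A z v) \<inter> (case p' of (z, v) \<Rightarrow> A z v) = {}"
      by (simp add: eq)
  qed
  define E where "E = {\<omega> \<in> space M. \<forall>z\<in>Z. \<exists>v\<in>?J. card (X \<omega> \<inter> A z v) = 0}"
  have E: "E \<in> sets M"
    unfolding E_def pred_def[symmetric] using finZ finite_simplex_directions A
    by (intro measurable_pred_countable pred_count) (auto intro: countable_finite)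
  have "prob E = (1 - q ^ card ?J) ^ (N ^ d)"
    unfolding E_def using prob_no_full_block[OF finZ finite_simplex_directions A disj]
    by (simp only: prob_A prod_constant cardZ)
  also have "\<dots> \<le> exp (- (q ^ card ?J)) ^ (N ^ d)"
  proof (rule power_mono)
    show "1 - q ^ card ?J \<le> exp (- (q ^ card ?J))"
      using exp_ge_add_one_self[of "- (q ^ card ?J)"] by simp
    show "0 \<le> 1 - q ^ card ?J" using q by (simp add: power_le_one)
  qed
  also have "\<dots> = exp (- (q ^ card ?J * real N ^ d))"
    by (simp add: exp_of_nat_mult[symmetric] mult.commute)
  also have "\<dots> \<le> exp (- (q ^ (d + 2) * (l / (8 * s)) ^ d))"
  proof -
    have "q ^ (d + 2) \<le> q ^ card ?J"
      using q card_simplex_directions_le[where 'a = 'a] by (intro power_decreasing) (auto simp: d_def)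
    moreover have "(l / (8 * s)) ^ d \<le> real N ^ d"
      using N_ge s by (intro power_mono) auto
    ultimately have "q ^ (d + 2) * (l / (8 * s)) ^ d \<le> q ^ card ?J * real N ^ d"
      using q s by (intro mult_mono) auto
    then show ?thesis by simp
  qed
  finally have "prob E \<le> exp (- (q ^ (d + 2) * (l / (8 * s)) ^ d))" .
  moreover have "\<exists>x\<in>X \<omega>. (\<forall>b\<in>Basis. \<bar>x \<bullet> b - w \<bullet> b\<bar> \<le> l) \<and>
      voronoi_cell (X \<omega>) x \<subseteq> cball x (s * ((real d)\<^sup>2 * (real d + 1)\<^sup>2))"
    if \<omega>: "\<omega> \<in> space M - E" for \<omega>
  proof -
    obtain z where z: "z \<in> Z" "\<And>v. v \<in> ?J \<Longrightarrow> card (X \<omega> \<inter> A z v) \<noteq> 0"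
      using \<omega> by (auto simp: E_def)
    have "\<exists>x. x \<in> X \<omega> \<inter> A z v" if "v \<in> ?J" for v
      using z(2)[OF that] by (metis card.empty equals0I)
    then obtain x where x: "\<And>v. v \<in> ?J \<Longrightarrow> x v \<in> X \<omega> \<inter> A z v" by metis
    have zero: "0 \<in> ?J" by (simp add: simplex_directions_def)
    have "voronoi_cell (X \<omega>) (x 0) \<subseteq> cball (x 0) (s * ((real d)\<^sup>2 * (real d + 1)\<^sup>2))"
      using x s(1) unfolding d_def A_def \<delta>_def by (intro voronoi_cell_subset_cball_if_simplex) auto
    moreover have "\<bar>x 0 \<bullet> b - w \<bullet> b\<bar> \<le> l" if b: "b \<in> Basis" for b
    proof -
      have "dist (grid_point w s z) (x 0) < s * \<delta>"
        using x[OF zero] by (simp add: A_def)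
      then have "norm (x 0 - grid_point w s z) \<le> s * \<delta>"
        by (simp add: dist_norm norm_minus_commute)
      also have "\<dots> \<le> s"
        using \<delta> s(1) by (simp add: mult_le_cancel_left1)
      finally have "\<bar>(x 0 - grid_point w s z) \<bullet> b\<bar> \<le> s"
        using Basis_le_norm[OF b] order_trans by blast
      moreover have "(x 0 - grid_point w s z) \<bullet> b = x 0 \<bullet> b - w \<bullet> b - 4 * s * real (z b)"
        unfolding grid_point_def inner_diff_left inner_add_left inner_sum_left_Basis[OF b] by simp
      moreover have "4 * s * real (z b) \<le> 4 * s * (real N - 1)"
      proof -
        have "Suc (z b) \<le> N" using PiE_mem[OF z(1)[unfolded Z_def] b] by (simp add: Suc_le_eq)
        then have "real (Suc (z b)) \<le> real N" by (simp only: of_nat_le_iff)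
        then show ?thesis using s(1) by (intro mult_left_mono) auto
      qed
      moreover have "0 \<le> 4 * s * real (z b)" using s(1) by simp
      ultimately show ?thesis
        using N_le s unfolding right_diff_distrib abs_le_iff by linarith
    qed
    ultimately show ?thesis using x[OF zero] by blast
  qed
  ultimately show ?thesis
    using E unfolding q_def by blast
qed

text \<open>
  Outside the two exceptional events and a null set, every nucleus \<open>x\<close> of minimal radius has radius at most
  \<open>s * K\<close>, lies within distance 1 of the window, and has fewer than \<open>d + 3\<close> points, itself included,
  within distance \<open>2 * (s * K)\<close>, hence at most \<open>d + 1\<close> neighbours.
\<close>

lemma prob_minimal_cells_simplices_ge:
  fixes w :: 'a and W :: "'a set" and a s l :: real
  defines "d \<equiv> DIM('a)"
  defines "\<kappa> \<equiv> unit_ball_vol (real d) * (1 / (4 * (real d)\<^sup>2)) ^ d"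
  defines "K \<equiv> (real d)\<^sup>2 * (real d + 1)\<^sup>2"
  assumes \<gamma>: "0 < \<gamma>" and s: "0 < s" "8 * s \<le> l" "4 * (s * K) \<le> 1"
    and W: "W \<in> sets borel" "bounded W"
    and inner: "\<And>x. (\<forall>b\<in>Basis. \<bar>x \<bullet> b - w \<bullet> b\<bar> \<le> l) \<Longrightarrow> x \<in> W"
    and outer: "\<And>x. x \<in> W \<Longrightarrow> \<forall>b\<in>Basis. \<bar>x \<bullet> b\<bar> \<le> a"
  shows "1 - exp (- ((1 - exp (- (\<gamma> * (\<kappa> * s ^ d)))) ^ (d + 2) * (l / (8 * s)) ^ d))
      - ((2 * (a + 1) + 5) / (2 * (s * K))) ^ d * (\<gamma> * (3 * (2 * (s * K))) ^ d) ^ (d + 3) \<le>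
    prob {\<omega> \<in> space M. \<forall>x\<in>X \<omega>. circumscribed_radius (X \<omega>) x = min_circumscribed_radius W (X \<omega>)
      \<longrightarrow> num_hyperfaces (voronoi_cell (X \<omega>) x) = d + 1}"
    (is "1 - ?p1 - ?p2 \<le> prob ?G")
proof -
  have d: "1 \<le> real d" by (simp add: d_def Suc_le_eq)
  then have K: "0 < K" by (simp add: K_def)
  obtain E1 where E1: "E1 \<in> sets M" "prob E1 \<le> ?p1"
    "\<And>\<omega>. \<omega> \<in> space M - E1 \<Longrightarrow> \<exists>x\<in>X \<omega>. (\<forall>b\<in>Basis. \<bar>x \<bullet> b - w \<bullet> b\<bar> \<le> l) \<and>
      voronoi_cell (X \<omega>) x \<subseteq> cball x (s * K)"
    using prob_no_simplex_cell_le[OF \<gamma> s(1,2), of w] unfolding d_def \<kappa>_def K_def by blast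
  have "w \<in> W" by (rule inner) (use s in auto)
  moreover obtain b :: 'a where "b \<in> Basis" using nonempty_Basis by blast
  ultimately have "\<bar>w \<bullet> b\<bar> \<le> a" using outer by blast
  then have a: "0 \<le> a" by linarith
  have t: "0 < 2 * (s * K)" "2 * (s * K) \<le> 1" using s K by auto
  obtain E2 where E2: "E2 \<in> sets M" "prob E2 \<le> ?p2"
    "\<And>\<omega> x. \<omega> \<in> space M - E2 \<Longrightarrow> x \<in> X \<omega> \<Longrightarrow> \<forall>b\<in>Basis. \<bar>x \<bullet> b\<bar> \<le> a + 1 \<Longrightarrow>
      card (X \<omega> \<inter> cball x (2 * (s * K))) < d + 3"
    using prob_cluster_le[OF \<gamma> t, of "a + 1" "d + 3"] a unfolding d_def by auto
  have G: "?G \<in> sets M"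
    using pred_minimal_cells_simplices[OF W(1)] by (simp add: pred_def d_def)
  have good: "num_hyperfaces (voronoi_cell (X \<omega>) x) = d + 1"
    if \<omega>: "\<omega> \<in> space M - E1 - E2" and x: "x \<in> X \<omega>"
      and eq: "circumscribed_radius (X \<omega>) x = min_circumscribed_radius W (X \<omega>)"
      and dist: "\<And>x x' R. x \<in> X \<omega> \<Longrightarrow> x' \<in> X \<omega> \<Longrightarrow> 0 \<le> R \<Longrightarrow> circumscribed_radius (X \<omega>) x = ennreal R \<Longrightarrow>
        circumscribed_radius (X \<omega>) x' = ennreal R \<Longrightarrow> dist x x' \<le> 4 * R" for \<omega> x
  proof -
    have lf: "locally_finite_set (X \<omega>)" using \<omega> locally_finite_X by auto
    obtain x0 where x0: "x0 \<in> X \<omega>" "x0 \<in> W" "voronoi_cell (X \<omega>) x0 \<subseteq> cball x0 (s * K)"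
      using E1(3)[of \<omega>] \<omega> inner by blast
    have "min_circumscribed_radius W (X \<omega>) \<le> circumscribed_radius (X \<omega>) x0"
      unfolding min_circumscribed_radius_def using x0 by (intro INF_lower) auto
    also have "\<dots> \<le> ennreal (s * K)"
      using x0(3) circumscribed_radius_le_iff[of "s * K" "X \<omega>" x0] s(1) K by simp
    finally have le: "circumscribed_radius (X \<omega>) x \<le> ennreal (s * K)"
      using eq by simp
    then obtain R where R: "circumscribed_radius (X \<omega>) x = ennreal R" "0 \<le> R"
      by (cases "circumscribed_radius (X \<omega>) x") (auto simp: top_unique)
    have Rs: "R \<le> s * K"
      using le R s K by (simp add: ennreal_le_iff)
    obtain x' where x': "x' \<in> X \<omega> \<inter> W" "circumscribed_radius (X \<omega>) x' = min_circumscribed_radius W (X \<omega>)"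
      using min_circumscribed_radius_attained[OF lf W(2)] x0(1,2) by blast
    \<comment> \<open>here a nucleus of the same radius far from the window is excluded\<close>
    have "dist x x' \<le> 4 * R"
      using dist[OF x _ R(2) R(1)] x' eq R by auto
    then have near: "norm (x - x') \<le> 1"
      using Rs s(3) by (simp add: dist_norm)
    have "\<forall>b\<in>Basis. \<bar>x \<bullet> b\<bar> \<le> a + 1"
    proof
      fix b :: 'a assume b: "b \<in> Basis"
      then have "\<bar>(x - x') \<bullet> b\<bar> \<le> 1"
        using Basis_le_norm[OF b, of "x - x'"] near by linarith
      moreover have "\<bar>x' \<bullet> b\<bar> \<le> a" using outer[of x'] x'(1) b by blast
      ultimately show "\<bar>x \<bullet> b\<bar> \<le> a + 1" by (simp add: inner_diff_left)
    qed
    then have few: "card (X \<omega> \<inter> cball x (2 * (s * K))) < d + 3"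
      using E2(3)[of \<omega> x] \<omega> x by blast
    have cell: "voronoi_cell (X \<omega>) x \<subseteq> cball x R"
      using R circumscribed_radius_le_iff[of R "X \<omega>" x] by simp
    then have bdd: "bounded (voronoi_cell (X \<omega>) x)"
      by (rule bounded_subset[OF bounded_cball])
    have "insert x (voronoi_neighbours (X \<omega>) x) \<subseteq> X \<omega> \<inter> cball x (2 * (s * K))"
      using dist_voronoi_neighbour_le[OF cell] Rs x s K by (fastforce simp: voronoi_neighbours_def)
    moreover have "finite (X \<omega> \<inter> cball x (2 * (s * K)))"
      using lf by (simp add: locally_finite_set_def)
    ultimately have "card (insert x (voronoi_neighbours (X \<omega>) x)) < d + 3"
      using few card_mono le_less_trans by blast
    moreover have "x \<notin> voronoi_neighbours (X \<omega>) x"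
      by (simp add: voronoi_neighbours_def)
    ultimately have "card (voronoi_neighbours (X \<omega>) x) < d + 2"
      using finite_voronoi_neighbours[OF lf bdd] by simp
    moreover have "d + 1 \<le> card (voronoi_neighbours (X \<omega>) x)"
      unfolding d_def by (rule card_voronoi_neighbours_ge[OF lf bdd])
    ultimately show ?thesis
      using num_hyperfaces_voronoi_cell[OF lf, of x] by simp
  qed
  have "AE \<omega> in M. \<omega> \<in> space M - ?G \<longrightarrow> \<omega> \<in> E1 \<union> E2"
    using AE_distant_cells_distinct_radii[OF \<gamma>]
  proof eventually_elim
    case (elim \<omega>)
    show ?case
    proof (intro impI, rule ccontr)
      assume \<omega>: "\<omega> \<in> space M - ?G" "\<omega> \<notin> E1 \<union> E2"
      have "\<omega> \<in> ?G" using good[of \<omega>] elim \<omega> by blast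
      with \<omega> show False by blast
    qed
  qed
  then have "prob (space M - ?G) \<le> prob (E1 \<union> E2)"
    using G E1(1) E2(1) by (intro finite_measure_mono_AE) auto
  also have "\<dots> \<le> prob E1 + prob E2"
    using E1(1) E2(1) by (rule measure_Un_le)
  also have "\<dots> \<le> ?p1 + ?p2" using E1(2) E2(2) by simp
  finally show ?thesis
    using prob_compl[OF G] by simp
qed

end

section \<open>The limit of large intensity\<close>

text \<open>
  The length \<open>s\<close> with \<open>\<gamma> * s ^ d = \<gamma> powr (- \<beta>)\<close> for \<open>\<beta> = 1 / (d + 3 / 2)\<close>. Any exponent \<open>\<beta>\<close> strictly between
  \<open>1 / (d + 2)\<close> and \<open>1 / (d + 1)\<close> would do: then \<open>\<gamma> * (\<gamma> * s ^ d) ^ (d + 1)\<close> tends to infinity and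
  \<open>\<gamma> * (\<gamma> * s ^ d) ^ (d + 2)\<close> to zero.
\<close>

definition cell_scale :: "nat \<Rightarrow> real \<Rightarrow> real" where
  "cell_scale d \<gamma> = \<gamma> powr (- ((1 + 1 / (real d + 3 / 2)) / real d))"

lemma cell_scale_pos: "0 < \<gamma> \<Longrightarrow> 0 < cell_scale d \<gamma>"
  by (simp add: cell_scale_def)

lemma cell_scale_power:
  assumes "0 < \<gamma>" "0 < d"
  shows "cell_scale d \<gamma> ^ d = \<gamma> powr (- (1 + 1 / (real d + 3 / 2)))"
    and "\<gamma> * cell_scale d \<gamma> ^ d = \<gamma> powr (- (1 / (real d + 3 / 2)))"
proof -
  show 1: "cell_scale d \<gamma> ^ d = \<gamma> powr (- (1 + 1 / (real d + 3 / 2)))"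
    using assms unfolding cell_scale_def
    by (subst powr_realpow[symmetric]) (simp, simp only: powr_powr, simp)
  have "\<gamma> powr 1 * \<gamma> powr (- (1 + 1 / (real d + 3 / 2))) = \<gamma> powr (- (1 / (real d + 3 / 2)))"
    by (simp only: powr_add[symmetric]) simp
  then show "\<gamma> * cell_scale d \<gamma> ^ d = \<gamma> powr (- (1 / (real d + 3 / 2)))"
    using assms by (simp only: 1 powr_one)
qed

lemma cell_scale_tendsto_0:
  assumes "0 < d"
  shows "(cell_scale d \<longlongrightarrow> 0) at_top"
proof -
  have "- ((1 + 1 / (real d + 3 / 2)) / real d) < 0"
    using assms by (simp add: add_pos_pos)
  then show ?thesis
    unfolding cell_scale_def by (rule tendsto_neg_powr[OF _ filterlim_ident])
qed

lemma no_simplex_bound_tendsto_0: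
  fixes d :: nat and \<kappa> l :: real
  assumes d: "0 < d" and \<kappa>: "0 < \<kappa>" and l: "0 < l"
  shows "((\<lambda>\<gamma>. exp (- ((1 - exp (- (\<gamma> * (\<kappa> * cell_scale d \<gamma> ^ d)))) ^ (d + 2) *
    (l / (8 * cell_scale d \<gamma>)) ^ d))) \<longlongrightarrow> 0) at_top"
proof -
  define \<beta> where "\<beta> = 1 / (real d + 3 / 2)"
  have "\<beta> * (real d + 3 / 2) = 1" by (simp add: \<beta>_def)
  then have "1 + \<beta> - \<beta> * real (d + 2) = \<beta> / 2" by (simp add: algebra_simps)
  moreover have "0 < \<beta>" by (simp add: \<beta>_def)
  ultimately have \<beta>: "0 < \<beta>" "0 < 1 + \<beta> - \<beta> * real (d + 2)" by simp_all
  define c where "c = (\<kappa> / 2) ^ (d + 2) * (l / 8) ^ d"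
  have c: "0 < c" using \<kappa> l by (simp add: c_def)
  have "filterlim (\<lambda>\<gamma>::real. \<gamma> powr (1 + \<beta> - \<beta> * real (d + 2))) at_top at_top"
    by (rule real_powr_at_top[OF \<beta>(2)])
  then have "filterlim (\<lambda>\<gamma>. c * \<gamma> powr (1 + \<beta> - \<beta> * real (d + 2))) at_top at_top"
    using c by (simp add: filterlim_tendsto_pos_mult_at_top[OF tendsto_const])
  then have "filterlim (\<lambda>\<gamma>. - (c * \<gamma> powr (1 + \<beta> - \<beta> * real (d + 2)))) at_bot at_top"
    by (simp add: filterlim_uminus_at_bot)
  then have lim: "((\<lambda>\<gamma>. exp (- (c * \<gamma> powr (1 + \<beta> - \<beta> * real (d + 2))))) \<longlongrightarrow> 0) at_top"
    by (rule filterlim_compose[OF exp_at_bot])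
  have "((\<lambda>\<gamma>::real. \<kappa> * \<gamma> powr (- \<beta>)) \<longlongrightarrow> \<kappa> * 0) at_top"
    using \<beta>(1) by (intro tendsto_mult tendsto_const tendsto_neg_powr filterlim_ident) simp
  then have small: "\<forall>\<^sub>F \<gamma> in at_top. \<kappa> * \<gamma> powr (- \<beta>) < 1"
    by (rule order_tendstoD) simp
  show ?thesis
  proof (rule tendsto_sandwich[OF _ _ tendsto_const lim])
    show "\<forall>\<^sub>F \<gamma> in at_top. exp (- ((1 - exp (- (\<gamma> * (\<kappa> * cell_scale d \<gamma> ^ d)))) ^ (d + 2) *
      (l / (8 * cell_scale d \<gamma>)) ^ d)) \<le> exp (- (c * \<gamma> powr (1 + \<beta> - \<beta> * real (d + 2))))"
      using small eventually_gt_at_top[of 0]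
    proof eventually_elim
      case (elim \<gamma>)
      let ?s = "cell_scale d \<gamma>" and ?t = "\<gamma> powr (- \<beta>)"
      have s: "0 < ?s" using elim(2) by (rule cell_scale_pos)
      have t: "\<gamma> * (\<kappa> * ?s ^ d) = \<kappa> * ?t"
        using cell_scale_power(2)[OF elim(2) d] by (simp add: \<beta>_def mult.left_commute[of \<gamma>])
      have s_d: "1 / ?s ^ d = \<gamma> powr (1 + \<beta>)"
        unfolding cell_scale_power(1)[OF elim(2) d] \<beta>_def by (simp only: powr_minus divide_inverse[of 1 "inverse _"] inverse_inverse_eq mult_1)
      have t_pow: "?t ^ (d + 2) = \<gamma> powr (- (\<beta> * real (d + 2)))"
        using elim(2) by (subst powr_realpow[symmetric]) (simp, simp only: powr_powr, simp)
      \<comment> \<open>\<open>1 - exp (- x) \<ge> x / 2\<close> for \<open>x\<close> between 0 and 1\<close>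
      have "\<kappa> * ?t / 2 \<le> 1 - exp (- (\<kappa> * ?t))"
      proof -
        let ?x = "\<kappa> * ?t"
        have x: "0 \<le> ?x" "?x < 1" using elim(1) \<kappa> by simp_all
        have "(1 + ?x) * exp (- ?x) \<le> exp ?x * exp (- ?x)"
          using exp_ge_add_one_self[of ?x] by (intro mult_right_mono) simp_all
        then have "(1 + ?x) * exp (- ?x) \<le> 1" by (simp add: exp_add[symmetric])
        moreover have "1 \<le> (1 + ?x) * (1 - ?x / 2)"
          using x mult_left_mono[of ?x 1 ?x] by (simp add: algebra_simps)
        ultimately have "(1 + ?x) * exp (- ?x) \<le> (1 + ?x) * (1 - ?x / 2)" by linarith
        then have "exp (- ?x) \<le> 1 - ?x / 2"
          using x(1) by (subst (asm) mult_le_cancel_left_pos) simp_all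
        then show ?thesis by simp
      qed
      then have "(\<kappa> * ?t / 2) ^ (d + 2) * (l / (8 * ?s)) ^ d \<le>
          (1 - exp (- (\<kappa> * ?t))) ^ (d + 2) * (l / (8 * ?s)) ^ d"
        using \<kappa> l s by (intro mult_right_mono power_mono) auto
      moreover have "(\<kappa> * ?t / 2) ^ (d + 2) * (l / (8 * ?s)) ^ d = c * (?t ^ (d + 2) * (1 / ?s ^ d))"
        by (simp only: c_def power_mult_distrib power_divide) (simp add: field_simps)
      moreover have "?t ^ (d + 2) * (1 / ?s ^ d) = \<gamma> powr (1 + \<beta> - \<beta> * real (d + 2))"
        unfolding t_pow s_d powr_add[symmetric]
        by (rule arg_cong[where f = "\<lambda>e. \<gamma> powr e"]) linarith
      ultimately show ?case
        unfolding t exp_le_cancel_iff neg_le_iff_le by (simp only:)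
    qed
  qed simp
qed

lemma cluster_bound_tendsto_0:
  fixes d :: nat and K a :: real
  assumes d: "0 < d" and K: "0 < K"
  shows "((\<lambda>\<gamma>. (a / (2 * (cell_scale d \<gamma> * K))) ^ d *
    (\<gamma> * (3 * (2 * (cell_scale d \<gamma> * K))) ^ d) ^ (d + 3)) \<longlongrightarrow> 0) at_top"
proof -
  define \<beta> where "\<beta> = 1 / (real d + 3 / 2)"
  have "\<beta> * (real d + 3 / 2) = 1" by (simp add: \<beta>_def)
  then have "1 + \<beta> - \<beta> * real (d + 3) = - (\<beta> / 2)" by (simp add: algebra_simps)
  moreover have "0 < \<beta>" by (simp add: \<beta>_def)
  ultimately have \<beta>: "1 + \<beta> - \<beta> * real (d + 3) < 0" by simp
  define c where "c = (a / (2 * K)) ^ d * ((6 * K) ^ d) ^ (d + 3)"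
  have "((\<lambda>\<gamma>::real. c * \<gamma> powr (1 + \<beta> - \<beta> * real (d + 3))) \<longlongrightarrow> c * 0) at_top"
    by (intro tendsto_mult tendsto_const tendsto_neg_powr[OF \<beta>] filterlim_ident)
  then have lim: "((\<lambda>\<gamma>::real. c * \<gamma> powr (1 + \<beta> - \<beta> * real (d + 3))) \<longlongrightarrow> 0) at_top"
    by simp
  show ?thesis
  proof (rule Lim_transform_eventually[OF lim])
    show "\<forall>\<^sub>F \<gamma> in at_top. c * \<gamma> powr (1 + \<beta> - \<beta> * real (d + 3)) =
      (a / (2 * (cell_scale d \<gamma> * K))) ^ d * (\<gamma> * (3 * (2 * (cell_scale d \<gamma> * K))) ^ d) ^ (d + 3)"
      using eventually_gt_at_top[of 0]
    proof eventually_elim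
      case (elim \<gamma>)
      let ?s = "cell_scale d \<gamma>" and ?t = "\<gamma> powr (- \<beta>)"
      have t: "\<gamma> * ?s ^ d = ?t"
        using cell_scale_power(2)[OF elim d] by (simp add: \<beta>_def)
      have s_d: "1 / ?s ^ d = \<gamma> powr (1 + \<beta>)"
        unfolding cell_scale_power(1)[OF elim d] \<beta>_def by (simp only: powr_minus divide_inverse[of 1 "inverse _"] inverse_inverse_eq mult_1)
      have t_pow: "?t ^ (d + 3) = \<gamma> powr (- (\<beta> * real (d + 3)))"
        using elim by (subst powr_realpow[symmetric]) (simp, simp only: powr_powr, simp)
      have e1: "(a / (2 * (?s * K))) ^ d = (a / (2 * K)) ^ d * (1 / ?s ^ d)"
        by (simp add: power_mult_distrib power_divide)
      have e2: "\<gamma> * (3 * (2 * (?s * K))) ^ d = (6 * K) ^ d * (\<gamma> * ?s ^ d)"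
      proof -
        have "3 * (2 * (?s * K)) = (6 * K) * ?s" by simp
        then show ?thesis by (simp only: power_mult_distrib[of "6 * K"] mult.left_commute)
      qed
      have e3: "\<gamma> powr (1 + \<beta>) * \<gamma> powr (- (\<beta> * real (d + 3))) = \<gamma> powr (1 + \<beta> - \<beta> * real (d + 3))"
        by (simp only: powr_add[symmetric]) simp
      have "(a / (2 * (?s * K))) ^ d * (\<gamma> * (3 * (2 * (?s * K))) ^ d) ^ (d + 3) =
          (a / (2 * K)) ^ d * \<gamma> powr (1 + \<beta>) * ((6 * K) ^ d * ?t) ^ (d + 3)"
        unfolding e1 e2 s_d t ..
      also have "\<dots> = c * (\<gamma> powr (1 + \<beta>) * ?t ^ (d + 3))"
        unfolding c_def power_mult_distrib[of "(6 * K) ^ d"] by (simp only: mult_ac)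
      finally show ?case
        unfolding t_pow e3 by (rule sym)
    qed
  qed
qed

theorem corollary1:
  fixes M :: "real \<Rightarrow> 'w measure"
    and X :: "real \<Rightarrow> 'w \<Rightarrow> 'a::euclidean_space set"
    and W :: "'a set"
  assumes poisson: "\<And>\<gamma>. 0 < \<gamma> \<Longrightarrow> homogeneous_poisson_process (M \<gamma>) \<gamma> (X \<gamma>)"
    and body: "convex_body W"
    and volume: "measure lborel W = 1"
  shows "((\<lambda>\<gamma>. measure (M \<gamma>) {\<omega> \<in> space (M \<gamma>).
            \<forall>x\<in>X \<gamma> \<omega>. circumscribed_radius (X \<gamma> \<omega>) x = min_circumscribed_radius W (X \<gamma> \<omega>)
              \<longrightarrow> num_hyperfaces (voronoi_cell (X \<gamma> \<omega>) x) = DIM('a) + 1})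
          \<longlongrightarrow> 1) at_top"
    (is "((\<lambda>\<gamma>. ?P \<gamma>) \<longlongrightarrow> 1) at_top")
proof -
  let ?d = "DIM('a)"
  have d: "0 < ?d" by simp
  define \<kappa> where "\<kappa> = unit_ball_vol (real ?d) * (1 / (4 * (real ?d)\<^sup>2)) ^ ?d"
  define K where "K = (real ?d)\<^sup>2 * (real ?d + 1)\<^sup>2"
  have \<kappa>: "0 < \<kappa>" and K: "0 < K" by (simp_all add: \<kappa>_def K_def)
  have W: "W \<in> sets borel" "bounded W"
    using body by (auto simp: convex_body_def borel_compact compact_imp_bounded)
  obtain a where a: "\<And>x. x \<in> W \<Longrightarrow> norm x \<le> a"
    using W(2) by (auto simp: bounded_iff)
  have outer: "\<forall>b\<in>Basis. \<bar>x \<bullet> b\<bar> \<le> a" if "x \<in> W" for x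
    using a[OF that] Basis_le_norm order_trans by blast
  obtain w where "w \<in> interior W"
    using body by (auto simp: convex_body_def)
  then obtain r where r: "0 < r" "cball w r \<subseteq> W"
    by (meson mem_interior_cball)
  \<comment> \<open>then the cube of half-side \<open>l\<close> around \<open>w\<close> is contained in the ball of radius \<open>r\<close>\<close>
  define l where "l = r / ?d"
  have l: "0 < l" using r(1) by (simp add: l_def)
  have inner: "x \<in> W" if x: "\<forall>b\<in>Basis. \<bar>x \<bullet> b - w \<bullet> b\<bar> \<le> l" for x
  proof -
    have "norm (x - w) \<le> (\<Sum>b\<in>Basis. \<bar>(x - w) \<bullet> b\<bar>)" by (rule norm_le_l1)
    also have "\<dots> \<le> (\<Sum>b\<in>(Basis :: 'a set). l)"
      using x by (intro sum_mono) (simp add: inner_diff_left)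
    also have "\<dots> = r" by (simp add: l_def)
    finally show ?thesis using r(2) by (auto simp: dist_norm norm_minus_commute)
  qed
  let ?s = "cell_scale ?d"
  let ?p1 = "\<lambda>\<gamma>. exp (- ((1 - exp (- (\<gamma> * (\<kappa> * ?s \<gamma> ^ ?d)))) ^ (?d + 2) * (l / (8 * ?s \<gamma>)) ^ ?d))"
  let ?p2 = "\<lambda>\<gamma>. ((2 * (a + 1) + 5) / (2 * (?s \<gamma> * K))) ^ ?d *
      (\<gamma> * (3 * (2 * (?s \<gamma> * K))) ^ ?d) ^ (?d + 3)"
  have "((\<lambda>\<gamma>. 1 - ?p1 \<gamma> - ?p2 \<gamma>) \<longlongrightarrow> 1 - 0 - 0) at_top"
    by (intro tendsto_diff tendsto_const no_simplex_bound_tendsto_0 cluster_bound_tendsto_0 d \<kappa> K l)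
  then have lower: "((\<lambda>\<gamma>. 1 - ?p1 \<gamma> - ?p2 \<gamma>) \<longlongrightarrow> 1) at_top"
    by simp
  have "\<forall>\<^sub>F \<gamma> in at_top. ?s \<gamma> < min (l / 8) (1 / (4 * K))"
    using l K by (intro order_tendstoD(2)[OF cell_scale_tendsto_0[OF d]]) simp
  then have "\<forall>\<^sub>F \<gamma> in at_top. 1 - ?p1 \<gamma> - ?p2 \<gamma> \<le> ?P \<gamma>"
    using eventually_gt_at_top[of 0]
  proof eventually_elim
    case (elim \<gamma>)
    have "prob_space (M \<gamma>)"
      using poisson[OF elim(2)] by (simp add: homogeneous_poisson_process_def)
    then interpret poisson_process "M \<gamma>" \<gamma> "X \<gamma>"
      using poisson[OF elim(2)] by (simp add: poisson_process_def poisson_process_axioms_def)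
    have "8 * ?s \<gamma> \<le> l" using elim(1) by simp
    moreover have "4 * (?s \<gamma> * K) \<le> 1"
      using elim(1) K by (simp add: field_simps)
    ultimately show ?case
      using prob_minimal_cells_simplices_ge[OF elim(2) cell_scale_pos[OF elim(2)] _ _ W, of ?d l w a] inner outer
      unfolding \<kappa>_def K_def by blast
  qed
  moreover have "\<forall>\<^sub>F \<gamma> in at_top. ?P \<gamma> \<le> 1"
    using eventually_gt_at_top[of 0]
  proof eventually_elim
    case (elim \<gamma>)
    then interpret prob_space "M \<gamma>"
      using poisson[OF elim] by (simp add: homogeneous_poisson_process_def)
    show ?case by (rule prob_le_1)
  qed
  ultimately show ?thesis
    by (rule tendsto_sandwich[OF _ _ lower tendsto_const])
qed

end
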